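(* Assume $1 \leq p \leq \infty$ and $\eta \in L^p(\mathbb{R}^d)$ with $P|\eta| \in L^p_{loc}(\mathbb{R}^d)$. Let $m \in \mathbb{N}$ and define $$\psi = \underbrace{\beta * \cdots * \beta}_{m \text{ factors}} * \,\eta, \qquad \beta = |b\mathcal{C}|^{-1} \mathbf{1}_{b\mathcal{C}} .$$ Then $\psi \in W^{m,p}(\mathbb{R}^d)$, and $S : \ell^1(w^{m,p},\alpha) \to W^{m,p}(\mathbb{R}^d)$ is bounded. More precisely, if $c \in \ell^1(w^{m,p},\alpha)$ then the series $Sc = \sum_{j>0} \sum_{k \in \mathbb{Z}^d} c_{j,k} \psi_{j,k}$ converges in $W^{m,p}$ in the sense that the sum over $k$ converges pointwise absolutely a.e. to a function in $W^{m,p}$ and the sum over $j$ converges absolutely in $W^{m,p}$; and furthermore $$\| M_b Sc \|_{W^{m,p}} \leq |\det b|^{-1/p} \, \| P|\eta| \|_{L^p(b\mathcal{C})} \, \| c \|_{\ell^1(w^{m,p},\alpha)} .$$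
   Context: Fix $d\in\mathbb{N}$. The dilation matrices are isotropic and expanding: $a_j=\alpha_j I$ ($j=1,2,3,\ldots$), where $\alpha_j$ are nonzero real numbers with $|\alpha_j|\to\infty$ as $j\to\infty$. The translation matrix $b$ is an invertible $d\times d$ real matrix. Functions are complex-valued; sums over $j>0$ are over $j=1,2,3,\ldots$; $1/\infty=0$. $\mathcal{C}=[0,1)^d$, $b\mathcal{C}=\{bx:x\in\mathcal{C}\}$, $|b\mathcal{C}|$ is its Lebesgue measure, and $\mathbf{1}_E$ is the indicator function of $E$. $\psi_{j,k}(x)=|\det a_j|^{1/p}\psi(a_jx-bk)$ for $k\in\mathbb{Z}^d$. The periodization is $Pf(x)=|\det b|\sum_{k\in\mathbb{Z}^d}f(x-bk)$. The matrix rescaling operator is $(M_bf)(x)=|\det b|f(bx)$. $W^{m,p}=W^{m,p}(\mathbb{R}^d)$ is the Sobolev space of functions with $m$ derivatives in $L^p$, normed by $\|f\|_{W^{m,p}}=\sum_{|\rho|\le m}\|D^\rho f\|_p$ ($\rho$ multiindices). For sequences $s=\{s_k\}_{k\in\mathbb{Z}^d}$, $\Delta_ts=\{s_k-s_{k-e_t}\}_{k\in\mathbb{Z}^d}$, $t=1,\ldots,d$, with $e_t$ the $t$-th coordinate unit vector, and $\Delta^\rho=\Delta_1^{\rho_1}\cdots\Delta_d^{\rho_d}$. For $c=\{c_{j,k}\}_{j>0,k\in\mathbb{Z}^d}$ complex, $\Delta^\rho$ acts on the $k$-index, and $$\|c\|_{\ell^1(w^{m,p},\alpha)}=\sum_{j>0}\sum_{|\rho|\le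 m}|\alpha_j|^{|\rho|}\Big(\sum_{k\in\mathbb{Z}^d}|(\Delta^\rho c)_{j,k}|^p\Big)^{1/p}$$ (with the inner $\ell^p$ norm replaced by the supremum over $k$ if $p=\infty$). $\ell^1(w^{m,p},\alpha)$ is the Banach space of sequences for which this norm is finite. *)

theory Defs
  imports "HOL-Analysis.Analysis" "HOL-Probability.Essential_Supremum"
begin

section \<open>Lebesgue norms with exponent in \<open>[1, \<infinity>]\<close>\<close>

text \<open>Exponents \<open>p\<close> have type \<^typ>\<open>ennreal\<close>, with \<open>p = \<infinity>\<close> allowed. The real number
  \<open>inv_exponent p\<close> is \<open>1/p\<close>, so that \<open>inv_exponent \<infinity> = 0\<close>.\<close>

definition inv_exponent :: "ennreal \<Rightarrow> real"
  where "inv_exponent p = enn2real (1 / p)"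

text \<open>Powers of extended nonnegative numbers, used for positive exponents only.\<close>

definition epowr :: "ennreal \<Rightarrow> real \<Rightarrow> ennreal"
  where "epowr x a = (if x = \<infinity> then \<infinity> else ennreal (enn2real x powr a))"

text \<open>Norms are \<^typ>\<open>ennreal\<close>-valued, and the basic norm is defined for \<^typ>\<open>ennreal\<close>-valued
  functions, so that it applies to the periodization of \<open>|\<eta>|\<close>, which may be infinite at some
  points.\<close>

definition Lp_enorm :: "ennreal \<Rightarrow> 'a measure \<Rightarrow> ('a \<Rightarrow> ennreal) \<Rightarrow> ennreal"
  where "Lp_enorm p M g =
    (if p = \<infinity> then esssup M g
     else epowr (\<integral>\<^sup>+ x. epowr (g x) (enn2real p) \<partial>M) (inv_exponent p))"

definition Lp_norm :: "ennreal \<Rightarrow> (real ^ 'n \<Rightarrow> complex) \<Rightarrow> ennreal"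
  where "Lp_norm p f = Lp_enorm p lebesgue (\<lambda>x. ennreal (norm (f x)))"

definition Lp_space :: "ennreal \<Rightarrow> (real ^ 'n \<Rightarrow> complex) set"
  where "Lp_space p = {f. f \<in> borel_measurable lebesgue \<and> Lp_norm p f < \<infinity>}"

definition Lp_loc :: "ennreal \<Rightarrow> (real ^ 'n \<Rightarrow> ennreal) set"
  where "Lp_loc p = {g. g \<in> borel_measurable lebesgue \<and>
    (\<forall>K. compact K \<longrightarrow> Lp_enorm p (lebesgue_on K) g < \<infinity>)}"

definition lp_seq_norm :: "ennreal \<Rightarrow> ('k \<Rightarrow> complex) \<Rightarrow> ennreal"
  where "lp_seq_norm p s =
    (if p = \<infinity> then (SUP k. ennreal (norm (s k)))
     else epowr (\<Sum>\<^sub>\<infinity>k. epowr (ennreal (norm (s k))) (enn2real p)) (inv_exponent p))"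

section \<open>Multiindices\<close>

text \<open>A multiindex is a function \<open>\<rho> :: 'n \<Rightarrow> nat\<close> on the coordinates. To write
  \<open>F\<^sub>1\<^bsup>\<rho>\<^sub>1\<^esup> \<dots> F\<^sub>d\<^bsup>\<rho>\<^sub>d\<^esup>\<close> an enumeration of the coordinates is fixed; the operators to
  which this is applied (partial derivatives of smooth functions, differences of sequences)
  commute, so the choice does not matter.\<close>

definition coordinates :: "'n::finite list"
  where "coordinates = (SOME ts. distinct ts \<and> set ts = UNIV)"

definition multi_power :: "('n::finite \<Rightarrow> 'a \<Rightarrow> 'a) \<Rightarrow> ('n \<Rightarrow> nat) \<Rightarrow> 'a \<Rightarrow> 'a"
  where "multi_power F \<rho> = foldr (\<lambda>t. F t ^^ \<rho> t) coordinates"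

definition order_of :: "('n::finite \<Rightarrow> nat) \<Rightarrow> nat"
  where "order_of \<rho> = (\<Sum>t\<in>UNIV. \<rho> t)"

section \<open>Sobolev spaces\<close>

definition partial_deriv :: "'n::finite \<Rightarrow> (real ^ 'n \<Rightarrow> complex) \<Rightarrow> (real ^ 'n \<Rightarrow> complex)"
  where "partial_deriv t \<phi> = (\<lambda>x. frechet_derivative \<phi> (at x) (axis t 1))"

text \<open>\<open>C\<^sup>\<infinity>\<close> functions with compact support: all iterated partial derivatives, in any order, are
  differentiable (hence also continuous).\<close>

definition test_functions :: "(real ^ 'n::finite \<Rightarrow> complex) set"
  where "test_functions = {\<phi>.
    (\<forall>ts. foldr partial_deriv ts \<phi> differentiable_on UNIV) \<and> compact (closure {x. \<phi> x \<noteq> 0})}"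

definition locally_integrable :: "(real ^ 'n::finite \<Rightarrow> complex) \<Rightarrow> bool"
  where "locally_integrable f \<longleftrightarrow> (\<forall>K. compact K \<longrightarrow> set_integrable lebesgue K f)"

definition is_weak_deriv ::
    "('n::finite \<Rightarrow> nat) \<Rightarrow> (real ^ 'n \<Rightarrow> complex) \<Rightarrow> (real ^ 'n \<Rightarrow> complex) \<Rightarrow> bool"
  where "is_weak_deriv \<rho> f g \<longleftrightarrow> locally_integrable f \<and> locally_integrable g \<and>
    (\<forall>\<phi>\<in>test_functions.
      (\<integral>x. f x * multi_power partial_deriv \<rho> \<phi> x \<partial>lebesgue) =
      (-1) ^ order_of \<rho> * (\<integral>x. g x * \<phi> x \<partial>lebesgue))"

text \<open>Weak derivatives are unique only up to null sets; a representative is chosen.\<close>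

definition weak_deriv :: "('n::finite \<Rightarrow> nat) \<Rightarrow> (real ^ 'n \<Rightarrow> complex) \<Rightarrow> (real ^ 'n \<Rightarrow> complex)"
  where "weak_deriv \<rho> f = (SOME g. is_weak_deriv \<rho> f g)"

definition sobolev :: "nat \<Rightarrow> ennreal \<Rightarrow> (real ^ 'n::finite \<Rightarrow> complex) set"
  where "sobolev m p = {f. f \<in> Lp_space p \<and>
    (\<forall>\<rho>. order_of \<rho> \<le> m \<longrightarrow> (\<exists>g\<in>Lp_space p. is_weak_deriv \<rho> f g))}"

text \<open>The norm is set to \<open>\<infinity>\<close> outside the Sobolev space.\<close>

definition sobolev_norm :: "nat \<Rightarrow> ennreal \<Rightarrow> (real ^ 'n::finite \<Rightarrow> complex) \<Rightarrow> ennreal"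
  where "sobolev_norm m p f =
    (if f \<in> sobolev m p then (\<Sum>\<rho> | order_of \<rho> \<le> m. Lp_norm p (weak_deriv \<rho> f)) else \<infinity>)"

text \<open>Convergence in norm of the series \<open>f\<^sub>1 + f\<^sub>2 + f\<^sub>3 + \<dots>\<close> (the index \<open>0\<close> is not used) to \<open>F\<close>.\<close>

definition sobolev_sums ::
    "nat \<Rightarrow> ennreal \<Rightarrow> (nat \<Rightarrow> real ^ 'n::finite \<Rightarrow> complex) \<Rightarrow> (real ^ 'n \<Rightarrow> complex) \<Rightarrow> bool"
  where "sobolev_sums m p f F \<longleftrightarrow> (\<forall>j>0. f j \<in> sobolev m p) \<and> F \<in> sobolev m p \<and>
    (\<lambda>J. sobolev_norm m p (\<lambda>x. F x - (\<Sum>j=1..J. f j x))) \<longlonglongrightarrow> 0"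

section \<open>Weighted sequence spaces\<close>

definition diff_op :: "'n::finite \<Rightarrow> (int ^ 'n \<Rightarrow> complex) \<Rightarrow> (int ^ 'n \<Rightarrow> complex)"
  where "diff_op t s = (\<lambda>k. s k - s (k - axis t 1))"

definition ell1_norm ::
    "nat \<Rightarrow> ennreal \<Rightarrow> (nat \<Rightarrow> real) \<Rightarrow> (nat \<Rightarrow> int ^ 'n::finite \<Rightarrow> complex) \<Rightarrow> ennreal"
  where "ell1_norm m p \<alpha> c =
    (\<Sum>\<^sub>\<infinity>j\<in>{0<..}. \<Sum>\<rho> | order_of \<rho> \<le> m.
      ennreal (\<bar>\<alpha> j\<bar> ^ order_of \<rho>) * lp_seq_norm p (multi_power diff_op \<rho> (c j)))"

definition ell1_space ::
    "nat \<Rightarrow> ennreal \<Rightarrow> (nat \<Rightarrow> real) \<Rightarrow> (nat \<Rightarrow> int ^ 'n::finite \<Rightarrow> complex) set"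
  where "ell1_space m p \<alpha> = {c. ell1_norm m p \<alpha> c < \<infinity>}"

section \<open>Affine synthesis\<close>

definition lattice_point :: "real ^ 'n ^ 'n::finite \<Rightarrow> int ^ 'n \<Rightarrow> real ^ 'n"
  where "lattice_point b k = b *v (\<chi> i. real_of_int (k $ i))"

definition cell :: "real ^ 'n ^ 'n::finite \<Rightarrow> (real ^ 'n) set"
  where "cell b = (\<lambda>x. b *v x) ` {x. \<forall>i. 0 \<le> x $ i \<and> x $ i < 1}"

definition periodization :: "real ^ 'n ^ 'n::finite \<Rightarrow> (real ^ 'n \<Rightarrow> ennreal) \<Rightarrow> (real ^ 'n \<Rightarrow> ennreal)"
  where "periodization b f = (\<lambda>x. ennreal \<bar>det b\<bar> * (\<Sum>\<^sub>\<infinity>k. f (x - lattice_point b k)))"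

definition matrix_rescale :: "real ^ 'n ^ 'n::finite \<Rightarrow> (real ^ 'n \<Rightarrow> complex) \<Rightarrow> (real ^ 'n \<Rightarrow> complex)"
  where "matrix_rescale b f = (\<lambda>x. complex_of_real \<bar>det b\<bar> * f (b *v x))"

definition convolution ::
    "(real ^ 'n::finite \<Rightarrow> complex) \<Rightarrow> (real ^ 'n \<Rightarrow> complex) \<Rightarrow> (real ^ 'n \<Rightarrow> complex)"
  where "convolution f g = (\<lambda>x. \<integral>y. f y * g (x - y) \<partial>lebesgue)"

definition box_kernel :: "real ^ 'n ^ 'n::finite \<Rightarrow> (real ^ 'n \<Rightarrow> complex)"
  where "box_kernel b = (\<lambda>x. complex_of_real (indicator (cell b) x / measure lebesgue (cell b)))"

definition dilation :: "(nat \<Rightarrow> real) \<Rightarrow> nat \<Rightarrow> real ^ 'n ^ 'n::finite"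
  where "dilation \<alpha> j = mat (\<alpha> j)"

definition affine_element ::
    "ennreal \<Rightarrow> (nat \<Rightarrow> real ^ 'n ^ 'n) \<Rightarrow> real ^ 'n ^ 'n \<Rightarrow> (real ^ 'n \<Rightarrow> complex) \<Rightarrow>
      nat \<Rightarrow> int ^ 'n::finite \<Rightarrow> real ^ 'n \<Rightarrow> complex"
  where "affine_element p a b \<psi> j k x =
    complex_of_real (\<bar>det (a j)\<bar> powr inv_exponent p) * \<psi> (a j *v x - lattice_point b k)"

definition scale_sum ::
    "ennreal \<Rightarrow> (nat \<Rightarrow> real ^ 'n ^ 'n) \<Rightarrow> real ^ 'n ^ 'n \<Rightarrow> (real ^ 'n \<Rightarrow> complex) \<Rightarrow>
      (nat \<Rightarrow> int ^ 'n::finite \<Rightarrow> complex) \<Rightarrow> nat \<Rightarrow> real ^ 'n \<Rightarrow> complex"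
  where "scale_sum p a b \<psi> c j x = (\<Sum>\<^sub>\<infinity>k. c j k * affine_element p a b \<psi> j k x)"

text \<open>The sum over \<open>j\<close> is taken in the Sobolev space; it is determined up to null sets, and a
  representative is chosen.\<close>

definition synthesis ::
    "nat \<Rightarrow> ennreal \<Rightarrow> (nat \<Rightarrow> real ^ 'n ^ 'n) \<Rightarrow> real ^ 'n ^ 'n \<Rightarrow> (real ^ 'n \<Rightarrow> complex) \<Rightarrow>
      (nat \<Rightarrow> int ^ 'n::finite \<Rightarrow> complex) \<Rightarrow> real ^ 'n \<Rightarrow> complex"
  where "synthesis m p a b \<psi> c = (SOME F. sobolev_sums m p (scale_sum p a b \<psi> c) F)"

text \<open>Bounded linear operators from the weighted sequence space to the Sobolev space. Functions
  represent their classes modulo null sets, so linearity holds almost everywhere.\<close>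

definition bounded_operator ::
    "nat \<Rightarrow> ennreal \<Rightarrow> (nat \<Rightarrow> real) \<Rightarrow>
      ((nat \<Rightarrow> int ^ 'n::finite \<Rightarrow> complex) \<Rightarrow> real ^ 'n \<Rightarrow> complex) \<Rightarrow> bool"
  where "bounded_operator m p \<alpha> S \<longleftrightarrow>
    (\<forall>c\<in>ell1_space m p \<alpha>. S c \<in> sobolev m p) \<and>
    (\<forall>c\<in>ell1_space m p \<alpha>. \<forall>c'\<in>ell1_space m p \<alpha>.
      AE x in lebesgue. S (\<lambda>j k. c j k + c' j k) x = S c x + S c' x) \<and>
    (\<forall>z. \<forall>c\<in>ell1_space m p \<alpha>. AE x in lebesgue. S (\<lambda>j k. z * c j k) x = z * S c x) \<and>
    (\<exists>B::real. \<forall>c\<in>ell1_space m p \<alpha>. sobolev_norm m p (S c) \<le> ennreal B * ell1_norm m p \<alpha> c)"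

end

theory Submission
  imports Defs "HOL-Computational_Algebra.Polynomial" "HOL-Probability.Probability_Measure"
begin

text \<open>Let \<open>T\<close> be convolution with the normalized indicator of the cell \<open>b[0,1)\<^sup>n\<close>. Differentiating \<open>T f\<close> in the
  direction of a lattice vector \<open>b e\<^sub>t\<close> gives the difference \<open>f - f(\<sqdot> - b e\<^sub>t)\<close> averaged over a face of the
  cell, and differences of \<open>\<Sum>\<^sub>k c\<^sub>k \<eta>(\<sqdot> - b k)\<close> fall on the coefficients. Hence a derivative of order
  \<open>\<rho>\<close>, with \<open>|\<rho>| \<le> m\<close>, of \<open>T\<^sup>m \<Sum>\<^sub>k c\<^sub>k \<eta>(\<sqdot> - b k)\<close> in lattice directions is an average of the function
  \<open>\<Sum>\<^sub>k (\<Delta>\<^sup>\<rho> c)\<^sub>k \<eta>(\<sqdot> - b k)\<close>, and Hoelder's inequality against the weights \<open>|\<eta>(x - b k)|\<close> bounds its norm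
  by \<open>\<parallel>\<Delta>\<^sup>\<rho> c\<parallel>\<^sub>p\<close> times the norm over the cell of \<open>\<Sum>\<^sub>k |\<eta>(\<sqdot> - b k)|\<close>. Dilation by \<open>\<alpha>\<^sub>j\<close> contributes the
  factor \<open>|\<alpha>\<^sub>j|\<^sup>|\<^sup>\<rho>\<^sup>|\<close>, and the rescaling by \<open>b\<close> turns lattice directions into coordinate directions.\<close>

section \<open>Test functions\<close>

text \<open>Three features shape the details. A face of the cell is a null set, so an average over
  it is convolution with a singular measure; it is meaningful at almost every point only and asks
  for functions that are fixed everywhere. This is why the work is done with Borel representatives.
  Derivatives are weak and their representatives are chosen arbitrarily, so each one is found by
  duality, moving averages onto test functions, and then identified almost everywhere by the
  fundamental lemma of the calculus of variations. Finally, the directions in which derivatives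
  become lattice differences depend on \<open>b\<close>, while dilations and rescalings change
  directions; bounds are therefore carried for derivatives along arbitrary lists of vectors and
  specialised to coordinate directions last. For the operator itself this costs a factor depending
  on \<open>b\<close>. After rescaling by \<open>b\<close> each coordinate derivative is exactly one
  lattice difference, which yields the stated constant: |det b| from the rescaling is absorbed into
  P|\<eta>|, and |det b|^(-1/p) comes from the change of variables.\<close>

definition dir_deriv :: "real ^ 'n \<Rightarrow> (real ^ 'n \<Rightarrow> complex) \<Rightarrow> real ^ 'n::finite \<Rightarrow> complex"
  where "dir_deriv v \<phi> = (\<lambda>x. frechet_derivative \<phi> (at x) v)"

lemma partial_deriv_dir_deriv: "partial_deriv t = dir_deriv (axis t 1)"
  by (simp add: partial_deriv_def dir_deriv_def fun_eq_iff)

lemma dir_deriv_eq: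
  assumes "(\<phi> has_derivative D) (at x)"
  shows "dir_deriv v \<phi> x = D v"
  using frechet_derivative_at[OF assms] by (simp add: dir_deriv_def)

lemma dir_deriv_sum_partial:
  assumes "\<phi> differentiable at x"
  shows "dir_deriv v \<phi> x = (\<Sum>t\<in>UNIV. of_real (v $ t) * partial_deriv t \<phi> x)"
proof -
  have lin: "linear (frechet_derivative \<phi> (at x))"
    using assms by (rule linear_frechet_derivative)
  have "dir_deriv v \<phi> x = frechet_derivative \<phi> (at x) (\<Sum>t\<in>UNIV. v $ t *\<^sub>R axis t 1)"
    using basis_expansion[of v] by (simp add: dir_deriv_def scalar_mult_eq_scaleR)
  also have "\<dots> = (\<Sum>t\<in>UNIV. v $ t *\<^sub>R frechet_derivative \<phi> (at x) (axis t 1))"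
    using lin by (simp add: linear_sum linear_scale)
  finally show ?thesis by (simp add: partial_deriv_def scaleR_conv_of_real)
qed

text \<open>Induction on the order of differentiability: by the product and chain rules a derivative
  of a product or a composition is a sum of terms of one order less, whereas a fixed list of
  derivatives would have to be split between the factors. \<open>diff_upto_iff_foldr\<close> matches
  this with the lists in \<open>test_functions\<close>.\<close>

fun diff_upto :: "nat \<Rightarrow> (real ^ 'n::finite \<Rightarrow> complex) \<Rightarrow> bool" where
  "diff_upto 0 \<phi> = True"
| "diff_upto (Suc n) \<phi> = ((\<forall>x. \<phi> differentiable at x) \<and> (\<forall>t. diff_upto n (partial_deriv t \<phi>)))"

lemma diff_upto_iff_foldr:
  fixes \<phi> :: "real ^ 'n::finite \<Rightarrow> complex"
  shows "diff_upto n \<phi> \<longleftrightarrow> (\<forall>ts. length ts < n \<longrightarrow> foldr partial_deriv ts \<phi> differentiable_on UNIV)"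
proof (induction n arbitrary: \<phi>)
  case (Suc n)
  have "(\<forall>ts. length ts < Suc n \<longrightarrow> foldr partial_deriv ts \<phi> differentiable_on UNIV) \<longleftrightarrow>
    \<phi> differentiable_on UNIV \<and>
    (\<forall>t ts. length ts < n \<longrightarrow> foldr partial_deriv ts (partial_deriv t \<phi>) differentiable_on UNIV)"
    (is "?L \<longleftrightarrow> ?R")
  proof
    assume L: ?L
    show ?R
    proof (intro conjI allI impI)
      show "\<phi> differentiable_on UNIV" using L[rule_format, of "[]"] by simp
      fix t and ts :: "'n list" assume "length ts < n"
      then show "foldr partial_deriv ts (partial_deriv t \<phi>) differentiable_on UNIV"
        using L[rule_format, of "ts @ [t]"] by simp
    qed
  next
    assume R: ?R
    show ?L
    proof (intro allI impI)
      fix ts :: "'n list" assume "length ts < Suc n"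
      then show "foldr partial_deriv ts \<phi> differentiable_on UNIV"
        using R by (cases ts rule: rev_cases) auto
    qed
  qed
  then show ?case using Suc.IH by (simp add: differentiable_on_def)
qed simp

lemma test_functions_iff:
  "\<phi> \<in> test_functions \<longleftrightarrow> (\<forall>n. diff_upto n \<phi>) \<and> compact (closure {x. \<phi> x \<noteq> 0})"
  unfolding test_functions_def diff_upto_iff_foldr by (auto intro: lessI)

lemma diff_upto_mono: "diff_upto n \<phi> \<Longrightarrow> k \<le> n \<Longrightarrow> diff_upto k \<phi>"
  by (auto simp: diff_upto_iff_foldr)

lemma partial_deriv_add:
  assumes "\<phi> differentiable at x" "\<theta> differentiable at x"
  shows "partial_deriv t (\<lambda>x. \<phi> x + \<theta> x) x = partial_deriv t \<phi> x + partial_deriv t \<theta> x"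
  using dir_deriv_eq[OF has_derivative_add[OF assms[unfolded frechet_derivative_works]]]
  by (simp add: partial_deriv_dir_deriv) (simp add: dir_deriv_def)

lemma diff_upto_add:
  "diff_upto n \<phi> \<Longrightarrow> diff_upto n \<theta> \<Longrightarrow> diff_upto n (\<lambda>x. \<phi> x + \<theta> x)"
proof (induction n arbitrary: \<phi> \<theta>)
  case (Suc n)
  then have "partial_deriv t (\<lambda>x. \<phi> x + \<theta> x) = (\<lambda>x. partial_deriv t \<phi> x + partial_deriv t \<theta> x)" for t
    by (auto simp: partial_deriv_add)
  with Suc show ?case by auto
qed simp

lemma diff_upto_const: "diff_upto n (\<lambda>x::real^'n::finite. c)"
proof (induction n arbitrary: c)
  case (Suc n)
  have "partial_deriv t (\<lambda>x::real^'n. c) = (\<lambda>x. 0)" for t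
    by (simp add: partial_deriv_def)
  with Suc show ?case by auto
qed simp

lemma diff_upto_mult:
  "diff_upto n \<phi> \<Longrightarrow> diff_upto n \<theta> \<Longrightarrow> diff_upto n (\<lambda>x. \<phi> x * \<theta> x)"
proof (induction n arbitrary: \<phi> \<theta>)
  case (Suc n)
  have d: "((\<lambda>x. \<phi> x * \<theta> x) has_derivative
      (\<lambda>h. \<phi> x * frechet_derivative \<theta> (at x) h + frechet_derivative \<phi> (at x) h * \<theta> x)) (at x)" for x
    using Suc.prems by (intro has_derivative_mult) (auto simp: frechet_derivative_works)
  have p: "partial_deriv t (\<lambda>x. \<phi> x * \<theta> x) = (\<lambda>x. \<phi> x * partial_deriv t \<theta> x + partial_deriv t \<phi> x * \<theta> x)" for t
    using dir_deriv_eq[OF d] by (simp add: partial_deriv_dir_deriv fun_eq_iff) (simp add: dir_deriv_def)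
  have "diff_upto n \<phi>" "diff_upto n \<theta>"
    using Suc.prems by (auto intro: diff_upto_mono[of "Suc n"] simp del: diff_upto.simps)
  moreover have "\<forall>x. (\<lambda>x. \<phi> x * \<theta> x) differentiable at x"
    using d by (auto simp: differentiable_def)
  ultimately show ?case using Suc by (auto simp: p intro!: diff_upto_add)
qed simp

lemma diff_upto_sum:
  "(\<And>i. i \<in> I \<Longrightarrow> diff_upto n (\<phi> i)) \<Longrightarrow> diff_upto n (\<lambda>x. \<Sum>i\<in>I. \<phi> i x)"
  by (induction I rule: infinite_finite_induct) (auto intro: diff_upto_const diff_upto_add)

lemma diff_upto_prod:
  "(\<And>i. i \<in> I \<Longrightarrow> diff_upto n (\<phi> i)) \<Longrightarrow> diff_upto n (\<lambda>x. \<Prod>i\<in>I. \<phi> i x)"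
  by (induction I rule: infinite_finite_induct) (auto intro: diff_upto_const diff_upto_mult)

lemma has_derivative_compose_affine:
  fixes A :: "real ^ 'n ^ 'm" and \<phi> :: "real ^ 'm \<Rightarrow> complex"
  assumes "\<phi> differentiable at (A *v x + y)"
  shows "((\<lambda>x. \<phi> (A *v x + y)) has_derivative
    (\<lambda>h. frechet_derivative \<phi> (at (A *v x + y)) (A *v h))) (at x)"
proof -
  have "((\<lambda>x. A *v x + y) has_derivative (\<lambda>h. A *v h)) (at x)"
    by (auto intro!: derivative_eq_intros bounded_linear_imp_has_derivative
        simp: matrix_vector_mul_bounded_linear)
  from diff_chain_at[OF this, of \<phi> "frechet_derivative \<phi> (at (A *v x + y))"] assms
  show ?thesis by (simp add: frechet_derivative_works o_def)
qed

lemma dir_deriv_compose_affine: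
  assumes "\<phi> differentiable at (A *v x + y)"
  shows "dir_deriv v (\<lambda>x. \<phi> (A *v x + y)) x = dir_deriv (A *v v) \<phi> (A *v x + y)"
  using dir_deriv_eq[OF has_derivative_compose_affine[OF assms]] by (simp add: dir_deriv_def)

text \<open>By the chain rule a partial derivative of the composition is a constant combination of
  partial derivatives of \<open>\<phi>\<close> composed with the same affine map, so the induction
  hypothesis applies to each term.\<close>

lemma diff_upto_compose_affine:
  fixes A :: "real ^ 'n::finite ^ 'm::finite"
  shows "diff_upto n \<phi> \<Longrightarrow> diff_upto n (\<lambda>x. \<phi> (A *v x + y))"
proof (induction n arbitrary: \<phi>)
  case (Suc n)
  have p: "partial_deriv t (\<lambda>x. \<phi> (A *v x + y))
      = (\<lambda>x. \<Sum>s\<in>UNIV. of_real ((A *v axis t 1) $ s) * partial_deriv s \<phi> (A *v x + y))" for t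
    using Suc.prems
    by (simp add: partial_deriv_dir_deriv[of t] fun_eq_iff dir_deriv_compose_affine dir_deriv_sum_partial)
  have "\<forall>x. (\<lambda>x. \<phi> (A *v x + y)) differentiable at x"
    using has_derivative_compose_affine[of \<phi>] Suc.prems by (auto simp: differentiable_def)
  with Suc show ?case
    by (auto simp: p intro!: diff_upto_sum diff_upto_mult diff_upto_const)
qed simp

lemma diff_upto_dir_deriv:
  assumes "diff_upto (Suc n) \<phi>"
  shows "diff_upto n (dir_deriv v \<phi>)"
proof -
  have "dir_deriv v \<phi> = (\<lambda>x. \<Sum>t\<in>UNIV. of_real (v $ t) * partial_deriv t \<phi> x)"
    using assms by (auto simp: dir_deriv_sum_partial)
  then show ?thesis
    using assms by (auto intro!: diff_upto_sum diff_upto_mult diff_upto_const)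
qed

lemma test_functions_differentiable: "\<phi> \<in> test_functions \<Longrightarrow> \<phi> differentiable at x"
  unfolding test_functions_iff by (metis diff_upto.simps(2))

lemma test_functions_continuous: "\<phi> \<in> test_functions \<Longrightarrow> continuous_on S \<phi>"
  using test_functions_differentiable
  by (metis continuous_at_imp_continuous_on differentiable_imp_continuous_within)

lemma test_functions_support:
  assumes "\<phi> \<in> test_functions"
  obtains R where "R > 0" "\<And>x. norm x > R \<Longrightarrow> \<phi> x = 0"
proof -
  have "bounded (closure {x. \<phi> x \<noteq> 0})"
    using assms by (auto simp: test_functions_iff compact_imp_bounded)
  then obtain R where "R > 0" "\<forall>x\<in>closure {x. \<phi> x \<noteq> 0}. norm x \<le> R"
    by (auto simp: bounded_pos)
  then show ?thesis
    using closure_subset[of "{x. \<phi> x \<noteq> 0}"] by (intro that[of R]) force+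
qed

lemma compact_closure_if_zero_outside:
  fixes \<phi> :: "real ^ 'n \<Rightarrow> complex"
  assumes "\<And>x. norm x > R \<Longrightarrow> \<phi> x = 0"
  shows "compact (closure {x. \<phi> x \<noteq> 0})"
proof -
  have "bounded {x. \<phi> x \<noteq> 0}"
    by (rule boundedI[of _ R]) (use assms in \<open>force simp: not_le[symmetric]\<close>)
  then show ?thesis by (simp add: compact_closure)
qed

lemma test_functions_dir_deriv:
  assumes "\<phi> \<in> test_functions"
  shows "dir_deriv v \<phi> \<in> test_functions"
proof -
  obtain R where R: "R > 0" "\<And>x. norm x > R \<Longrightarrow> \<phi> x = 0"
    using test_functions_support[OF assms] by blast
  have "dir_deriv v \<phi> x = 0" if "norm x > R" for x
  proof -
    have "(\<phi> has_derivative (\<lambda>_. 0)) (at x)"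
    proof (rule has_derivative_transform_within_open[of "\<lambda>_. 0" _ _ _ "- cball 0 R"])
      show "x \<in> - cball 0 R" using that by auto
    qed (use R in \<open>auto simp: not_le\<close>)
    then show ?thesis by (rule dir_deriv_eq)
  qed
  then have "compact (closure {x. dir_deriv v \<phi> x \<noteq> 0})"
    by (rule compact_closure_if_zero_outside)
  with assms show ?thesis
    by (auto simp: test_functions_iff intro: diff_upto_dir_deriv simp del: compact_closure)
qed

lemma test_functions_partial_deriv:
  "\<phi> \<in> test_functions \<Longrightarrow> partial_deriv t \<phi> \<in> test_functions"
  by (simp add: partial_deriv_dir_deriv test_functions_dir_deriv)

lemma matrix_inv_mult:
  fixes A :: "'a::semiring_1 ^ 'n ^ 'm"
  assumes "invertible A"
  shows "A ** matrix_inv A = mat 1" "matrix_inv A ** A = mat 1"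
  using someI_ex[OF assms[unfolded invertible_def]] by (simp_all add: matrix_inv_def)

lemma matrix_inv_mult_vec:
  fixes A :: "'a::comm_ring_1 ^ 'n ^ 'm"
  assumes "invertible A"
  shows "A *v (matrix_inv A *v x) = x" "matrix_inv A *v (A *v y) = y"
  using assms by (simp_all add: matrix_vector_mul_assoc matrix_inv_mult)

lemma test_functions_compose_affine:
  fixes A :: "real ^ 'n::finite ^ 'n"
  assumes "\<phi> \<in> test_functions" "invertible A"
  shows "(\<lambda>x. \<phi> (A *v x + y)) \<in> test_functions"
proof -
  obtain R where R: "R > 0" "\<And>x. norm x > R \<Longrightarrow> \<phi> x = 0"
    using test_functions_support[OF assms(1)] by blast
  have "bounded_linear ((*v) (matrix_inv A))" by simp
  then obtain K where K: "K > 0" "\<And>x. norm (matrix_inv A *v x) \<le> norm x * K"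
    using bounded_linear.pos_bounded by blast
  \<comment> \<open>If \<open>A *v x + y\<close> has norm at most \<open>R\<close>, then
    \<open>A *v x\<close> has norm at most \<open>R + norm y\<close>, and \<open>K\<close> bounds
    the inverse matrix.\<close>
  have "\<phi> (A *v x + y) = 0" if x: "norm x > (R + norm y) * K" for x
  proof (rule R(2))
    have "x = matrix_inv A *v (A *v x)"
      using assms(2) by (simp add: matrix_inv_mult_vec)
    then have "norm x \<le> norm (A *v x) * K" using K(2) by metis
    then have "R + norm y < norm (A *v x)" using x K(1)
      by (meson less_le_trans mult_less_cancel_right_pos)
    moreover have "norm (A *v x) \<le> norm (A *v x + y) + norm y"
      using norm_triangle_ineq4[of "A *v x + y" y] by simp
    ultimately show "norm (A *v x + y) > R" by simp
  qed
  then have "compact (closure {x. \<phi> (A *v x + y) \<noteq> 0})"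
    by (rule compact_closure_if_zero_outside)
  with assms show ?thesis
    by (auto simp: test_functions_iff intro: diff_upto_compose_affine simp del: compact_closure)
qed

lemma test_functions_translate:
  assumes "\<phi> \<in> test_functions"
  shows "(\<lambda>x. \<phi> (x + y)) \<in> test_functions"
  using test_functions_compose_affine[OF assms, of "mat 1" y] by (simp add: invertible_det_nz)

lemma dir_deriv_translate:
  assumes "\<phi> \<in> test_functions"
  shows "dir_deriv v (\<lambda>x. \<phi> (x + y)) x = dir_deriv v \<phi> (x + y)"
  using dir_deriv_compose_affine[of \<phi> "mat 1" x y v] assms
  by (simp add: test_functions_differentiable)

lemma test_functions_bounded:
  assumes "\<phi> \<in> test_functions"
  obtains B where "B \<ge> 0" "\<And>x. norm (\<phi> x) \<le> B"
proof -
  obtain R where R: "R > 0" "\<And>x. norm x > R \<Longrightarrow> \<phi> x = 0"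
    using test_functions_support[OF assms] by blast
  have "compact (\<phi> ` cball 0 R)"
    by (intro compact_continuous_image test_functions_continuous assms) simp
  then obtain B where B: "\<And>x. x \<in> cball 0 R \<Longrightarrow> norm (\<phi> x) \<le> B"
    by (metis compact_imp_bounded bounded_iff image_eqI)
  show ?thesis
  proof (rule that[of "max 0 B"])
    fix x show "norm (\<phi> x) \<le> max 0 B"
      using B[of x] R(2)[of x] by (cases "norm x > R") auto
  qed simp
qed

lemma test_functions_borel: "\<phi> \<in> test_functions \<Longrightarrow> \<phi> \<in> borel_measurable borel"
  using test_functions_continuous[of \<phi> UNIV] borel_measurable_continuous_onI by blast

text \<open>For \<open>P = 1\<close> this is the smooth cutoff \<open>exp (- 1 / s)\<close>; the family is closed under
  differentiation.\<close>

definition cutoff :: "real poly \<Rightarrow> real \<Rightarrow> real"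
  where "cutoff P s = (if s > 0 then poly P (1 / s) * exp (- (1 / s)) else 0)"

lemma poly_mult_exp_tendsto_0: "((\<lambda>u::real. poly P u * exp (- u)) \<longlongrightarrow> 0) at_top"
proof -
  have "((\<lambda>u::real. \<Sum>i\<le>degree P. coeff P i * (u ^ i / exp u)) \<longlongrightarrow> (\<Sum>i\<le>degree P. coeff P i * 0)) at_top"
    by (intro tendsto_intros tendsto_power_div_exp_0)
  then show ?thesis
    by (simp add: poly_altdef exp_minus field_simps sum_distrib_right sum_distrib_left)
qed

text \<open>In the variable u = 1/s one has d/ds = -u^2 d/du, and differentiating P(u) exp(-u) gives
  (P' - P)(u) exp(-u); hence the new polynomial u^2 (P - P'). At 0 the right difference quotient is
  u P(u) exp(-u), which tends to 0 as u tends to infinity.\<close>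

lemma cutoff_has_derivative:
  "(cutoff P has_real_derivative cutoff ([:0, 0, 1:] * (P - pderiv P)) s) (at s)"
proof -
  consider "s < 0" | "s > 0" | "s = 0" by linarith
  then show ?thesis
  proof cases
    case 1
    have "(cutoff P has_real_derivative 0) (at s)"
      by (rule has_field_derivative_transform_within[of "\<lambda>_. 0" _ _ _ "-s"]) (use 1 in \<open>auto simp: cutoff_def dist_real_def\<close>)
    with 1 show ?thesis by (simp add: cutoff_def)
  next
    case 2
    have "((\<lambda>s. poly P (1 / s) * exp (- (1 / s))) has_real_derivative
        (poly (pderiv P) (1 / s) * (- 1 / s ^ 2)) * exp (- (1 / s)) + poly P (1 / s) * (exp (- (1 / s)) * (1 / s ^ 2))) (at s)"
      using 2 by (auto intro!: derivative_eq_intros DERIV_chain2[OF poly_DERIV] simp: power2_eq_square field_simps)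
    moreover have "(poly (pderiv P) (1 / s) * (- 1 / s ^ 2)) * exp (- (1 / s)) + poly P (1 / s) * (exp (- (1 / s)) * (1 / s ^ 2))
        = cutoff ([:0, 0, 1:] * (P - pderiv P)) s"
      using 2 by (simp add: cutoff_def power2_eq_square field_simps)
    ultimately have "((\<lambda>s. poly P (1 / s) * exp (- (1 / s))) has_real_derivative
        cutoff ([:0, 0, 1:] * (P - pderiv P)) s) (at s)" by simp
    then show ?thesis
      by (rule has_field_derivative_transform_within[of _ _ _ _ s]) (use 2 in \<open>auto simp: cutoff_def dist_real_def\<close>)
  next
    case 3
    have "((\<lambda>s. cutoff P s / s) \<longlongrightarrow> 0) (at_left 0)"
      by (rule tendsto_eventually) (auto simp: eventually_at_left_field cutoff_def intro: exI[of _ "-1"])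
    moreover have "((\<lambda>s. cutoff P s / s) \<longlongrightarrow> 0) (at_right 0)"
    proof (rule Lim_transform_eventually)
      show "((\<lambda>s::real. poly (pCons 0 P) (inverse s) * exp (- inverse s)) \<longlongrightarrow> 0) (at_right 0)"
        by (rule filterlim_compose[OF poly_mult_exp_tendsto_0 filterlim_inverse_at_top_right])
      show "\<forall>\<^sub>F s in at_right 0. poly (pCons 0 P) (inverse s) * exp (- inverse s) = cutoff P s / s"
        unfolding eventually_at_right_field
        by (intro exI[of _ 1]) (auto simp: cutoff_def field_simps)
    qed
    ultimately have "((\<lambda>s. cutoff P s / s) \<longlongrightarrow> 0) (at 0)"
      by (simp add: filterlim_split_at)
    then show ?thesis
      using 3 by (simp add: has_field_derivative_iff cutoff_def)
  qed
qed

lemma diff_upto_cutoff_coordinate: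
  "diff_upto n (\<lambda>x::real^'n::finite. complex_of_real (cutoff P (r * (x $ t) + c)))"
proof (induction n arbitrary: P)
  case (Suc n)
  let ?Q = "[:0, 0, 1:] * (P - pderiv P)"
  have d: "((\<lambda>x::real^'n. complex_of_real (cutoff P (r * (x $ t) + c))) has_derivative
     (\<lambda>h. complex_of_real (cutoff ?Q (r * (x $ t) + c) * (r * (h $ t))))) (at x)" for x
  proof -
    have "((\<lambda>x::real^'n. r * (x $ t) + c) has_derivative (\<lambda>h. r * (h $ t) + 0)) (at x)"
      by (intro has_derivative_add has_derivative_const has_derivative_mult_right
          bounded_linear_imp_has_derivative bounded_linear_vec_nth)
    then have "((\<lambda>x::real^'n. r * (x $ t) + c) has_derivative (\<lambda>h. r * (h $ t))) (at x)"
      by simp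
    from diff_chain_at[OF this cutoff_has_derivative[unfolded has_field_derivative_def]]
    have "((\<lambda>x::real^'n. cutoff P (r * (x $ t) + c)) has_derivative
      (\<lambda>h. cutoff ?Q (r * (x $ t) + c) * (r * (h $ t)))) (at x)"
      by (simp add: o_def)
    then show ?thesis by (rule has_derivative_of_real)
  qed
  have p: "partial_deriv s (\<lambda>x::real^'n. complex_of_real (cutoff P (r * (x $ t) + c)))
      = (\<lambda>x. complex_of_real (cutoff ?Q (r * (x $ t) + c)) * complex_of_real (r * (axis s 1 $ t)))" for s
    using dir_deriv_eq[OF d] by (simp add: partial_deriv_dir_deriv fun_eq_iff)
  have "\<forall>x. (\<lambda>x::real^'n. complex_of_real (cutoff P (r * (x $ t) + c))) differentiable at x"
    using d by (auto simp: differentiable_def)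
  with Suc show ?case
    unfolding diff_upto.simps p by (intro conjI allI diff_upto_mult diff_upto_const) auto
qed simp

text \<open>A smooth function supported in the box. Since \<open>cutoff 1 s\<close> = exp(-1/s)
  tends to 1 as s grows, the factors at n (x_t - a_t) and n (b_t - x_t) turn into the indicator of
  the open box as n grows. The arguments are expanded to the form treated in
  \<open>diff_upto_cutoff_coordinate\<close>.\<close>

definition box_bump :: "real ^ 'n \<Rightarrow> real ^ 'n \<Rightarrow> nat \<Rightarrow> real ^ 'n::finite \<Rightarrow> complex"
  where "box_bump a b n x = (\<Prod>t\<in>UNIV. complex_of_real (cutoff 1 (real n * (x $ t) + - real n * (a $ t)))
    * complex_of_real (cutoff 1 (- real n * (x $ t) + real n * (b $ t))))"

lemma cutoff_1_bounds: "0 \<le> cutoff 1 s" "cutoff 1 s \<le> 1"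
  by (auto simp: cutoff_def)

lemma box_bump_zero:
  assumes "x \<notin> box a b"
  shows "box_bump a b n x = 0"
proof -
  obtain t where "x $ t \<le> a $ t \<or> b $ t \<le> x $ t"
    using assms by (auto simp: mem_box_cart not_less)
  then have "real n * (x $ t) \<le> real n * (a $ t) \<or> real n * (b $ t) \<le> real n * (x $ t)"
    by (auto intro: mult_left_mono)
  then show ?thesis
    unfolding box_bump_def by (intro prod_zero bexI[of _ t]) (auto simp: cutoff_def)
qed

lemma box_bump_test_function: "box_bump (a :: real ^ 'n::finite) b n \<in> test_functions"
proof -
  obtain R where R: "box a b \<subseteq> ball 0 R"
    using bounded_subset_ballD[OF bounded_box] by blast
  have "compact (closure {x. box_bump a b n x \<noteq> 0})"
  proof (rule compact_closure_if_zero_outside)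
    fix x :: "real ^ 'n" assume "norm x > R"
    then have "x \<notin> box a b" using R by force
    then show "box_bump a b n x = 0" by (rule box_bump_zero)
  qed
  moreover have "diff_upto k (box_bump a b n)" for k
    unfolding box_bump_def[abs_def]
    by (intro diff_upto_prod diff_upto_mult diff_upto_cutoff_coordinate)
  ultimately show ?thesis by (simp add: test_functions_iff del: compact_closure)
qed

lemma box_bump_le_1: "norm (box_bump a b n x) \<le> 1"
  unfolding box_bump_def
  by (auto simp: prod_norm[symmetric] norm_mult cutoff_1_bounds intro!: prod_le_1 mult_le_one)

lemma box_bump_tendsto: "(\<lambda>n. box_bump a b n x) \<longlonglongrightarrow> indicator (box a b) x"
proof (cases "x \<in> box a b")
  case True
  have *: "(\<lambda>n. cutoff 1 (real n * d)) \<longlonglongrightarrow> 1" if "d > 0" for d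
  proof (rule Lim_transform_eventually)
    have "filterlim (\<lambda>n. real n * d) at_top sequentially"
      using that filterlim_tendsto_pos_mult_at_top[OF tendsto_const _ filterlim_real_sequentially, of d]
      by (simp add: mult.commute)
    then have "(\<lambda>n. inverse (real n * d)) \<longlonglongrightarrow> 0"
      by (rule filterlim_compose[OF tendsto_inverse_0_at_top[OF filterlim_ident]])
    then have "(\<lambda>n. exp (- inverse (real n * d))) \<longlonglongrightarrow> exp (- 0)"
      by (intro tendsto_intros)
    then show "(\<lambda>n. exp (- inverse (real n * d))) \<longlonglongrightarrow> 1" by simp
    show "\<forall>\<^sub>F n in sequentially. exp (- inverse (real n * d)) = cutoff 1 (real n * d)"
      using eventually_gt_at_top[of 0]
      by eventually_elim (use that in \<open>auto simp: cutoff_def inverse_eq_divide\<close>)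
  qed
  have "(\<lambda>n. box_bump a b n x) \<longlonglongrightarrow> (\<Prod>t\<in>(UNIV::'a set). complex_of_real 1 * complex_of_real 1)"
    unfolding box_bump_def
  proof (intro tendsto_prod tendsto_mult tendsto_of_real)
    fix t
    have "x $ t - a $ t > 0" "b $ t - x $ t > 0" using True by (auto simp: mem_box_cart)
    from this[THEN *]
    show "(\<lambda>n. cutoff 1 (real n * (x $ t) + - real n * (a $ t))) \<longlonglongrightarrow> 1"
      "(\<lambda>n. cutoff 1 (- real n * (x $ t) + real n * (b $ t))) \<longlonglongrightarrow> 1"
      by (simp_all add: right_diff_distrib)
  qed
  with True show ?thesis by simp
qed (simp add: box_bump_zero)

section \<open>The fundamental lemma of the calculus of variations\<close>

text \<open>Open boxes are stable under intersection, generate the Borel sets and exhaust the space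
  by sets of finite mass, so the measures with densities \<open>f\<close> and \<open>g\<close>
  coincide; densities over a sigma-finite measure are unique almost everywhere.\<close>

lemma AE_eq_if_box_integrals_eq:
  fixes f g :: "'a::euclidean_space \<Rightarrow> ennreal"
  assumes [measurable]: "f \<in> borel_measurable borel" "g \<in> borel_measurable borel"
    and eq: "\<And>a b. (\<integral>\<^sup>+x\<in>box a b. f x \<partial>lborel) = (\<integral>\<^sup>+x\<in>box a b. g x \<partial>lborel)"
    and fin: "\<And>a b. (\<integral>\<^sup>+x\<in>box a b. f x \<partial>lborel) < \<infinity>"
  shows "AE x in lborel. f x = g x"
proof -
  have "density lborel f = density lborel g"
  proof (rule measure_eqI_generator_eq[of "range (\<lambda>(a, b). box a b)" UNIV _ _ "\<lambda>i. box (- (real i *\<^sub>R One)) (real i *\<^sub>R One)"])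
    show "Int_stable (range (\<lambda>(a, b). box a b :: 'a set))"
      by (auto simp: Int_stable_def box_Int_box)
    show "sets (density lborel f) = sigma_sets UNIV (range (\<lambda>(a, b). box a b))"
      "sets (density lborel g) = sigma_sets UNIV (range (\<lambda>(a, b). box a b))"
      by (simp_all add: borel_eq_box)
    show "(\<Union>i. box (- (real i *\<^sub>R One)) (real i *\<^sub>R One)) = (UNIV :: 'a set)"
      using UN_box_eq_UNIV by auto
  qed (use eq fin in \<open>auto simp: emeasure_density less_top\<close>)
  then show ?thesis using sigma_finite_measure.density_unique[OF sigma_finite_lborel, of f g] by simp
qed

text \<open>As extended nonnegative numbers \<open>f x\<close> and \<open>- f x\<close> are the
  positive and negative parts of \<open>f\<close>. Vanishing box integrals make the box integrals of
  the parts equal, so the parts agree almost everywhere, and parts that agree are both zero.\<close>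

lemma AE_zero_if_box_integrals_zero_real:
  fixes f :: "'a::euclidean_space \<Rightarrow> real"
  assumes [measurable]: "f \<in> borel_measurable borel"
    and int: "\<And>a b. set_integrable lborel (box a b) f"
    and zero: "\<And>a b. (LINT x:box a b|lborel. f x) = 0"
  shows "AE x in lborel. f x = 0"
proof -
  have "AE x in lborel. ennreal (f x) = ennreal (- f x)"
  proof (rule AE_eq_if_box_integrals_eq)
    fix a b :: 'a
    let ?h = "\<lambda>x. indicator (box a b) x * f x"
    have i: "integrable lborel ?h" using int by (simp add: set_integrable_def)
    have e: "(\<integral>\<^sup>+x\<in>box a b. ennreal (f x) \<partial>lborel) = (\<integral>\<^sup>+x. ennreal (?h x) \<partial>lborel)"
      "(\<integral>\<^sup>+x\<in>box a b. ennreal (- f x) \<partial>lborel) = (\<integral>\<^sup>+x. ennreal (- ?h x) \<partial>lborel)"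
      by (auto intro!: nn_integral_cong split: split_indicator)
    have fin: "(\<integral>\<^sup>+x. ennreal (?h x) \<partial>lborel) < \<infinity>" "(\<integral>\<^sup>+x. ennreal (- ?h x) \<partial>lborel) < \<infinity>"
      using i by (auto simp: real_integrable_def less_top)
    show "(\<integral>\<^sup>+x\<in>box a b. ennreal (f x) \<partial>lborel) < \<infinity>" using e fin by simp
    have "(LINT x|lborel. ?h x) = 0" using zero by (simp add: set_lebesgue_integral_def)
    then have "enn2real (\<integral>\<^sup>+x. ennreal (?h x) \<partial>lborel) = enn2real (\<integral>\<^sup>+x. ennreal (- ?h x) \<partial>lborel)"
      using i by (simp add: real_lebesgue_integral_def)
    then show "(\<integral>\<^sup>+x\<in>box a b. ennreal (f x) \<partial>lborel) = (\<integral>\<^sup>+x\<in>box a b. ennreal (- f x) \<partial>lborel)"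
      unfolding e using fin by (metis ennreal_enn2real infinity_ennreal_def)
  qed auto
  then show ?thesis
  proof eventually_elim
    case (elim x)
    then show ?case
      by (cases "f x" "0 :: real" rule: linorder_cases) (auto simp: ennreal_neg)
  qed
qed

text \<open>The bumps \<open>box_bump a b n\<close> are test functions bounded by 1 and supported in
  the box, so dominated convergence turns the hypothesis into vanishing integrals over boxes. Real
  and imaginary parts are then treated separately.\<close>

lemma fundamental_lemma_lborel:
  fixes f :: "real ^ 'n::finite \<Rightarrow> complex"
  assumes f[measurable]: "f \<in> borel_measurable borel"
    and int: "\<And>a b. set_integrable lborel (cbox a b) f"
    and zero: "\<And>\<phi>. \<phi> \<in> test_functions \<Longrightarrow> (LINT x|lborel. f x * \<phi> x) = 0"
  shows "AE x in lborel. f x = 0"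
proof -
  have int_box: "set_integrable lborel (box a b) f" for a b
    by (rule set_integrable_subset[OF int[of a b]]) (auto simp: box_subset_cbox)
  have box: "(LINT x:box a b|lborel. f x) = 0" for a b
  proof -
    have [measurable]: "box_bump a b n \<in> borel_measurable borel" for n
      by (intro test_functions_borel box_bump_test_function)
    have "(\<lambda>n. LINT x|lborel. f x * box_bump a b n x) \<longlonglongrightarrow> (LINT x|lborel. f x * indicator (box a b) x)"
    proof (rule integral_dominated_convergence[where w="\<lambda>x. norm (indicator (box a b) x *\<^sub>R f x)"])
      show "integrable lborel (\<lambda>x. norm (indicator (box a b) x *\<^sub>R f x))"
        by (rule integrable_norm[OF int_box[of a b, unfolded set_integrable_def]])
      show "AE x in lborel. (\<lambda>n. f x * box_bump a b n x) \<longlonglongrightarrow> f x * indicator (box a b) x"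
        by (intro AE_I2 tendsto_intros box_bump_tendsto)
      show "AE x in lborel. norm (f x * box_bump a b n x) \<le> norm (indicator (box a b) x *\<^sub>R f x)" for n
        using box_bump_le_1[of a b n]
        by (intro AE_I2) (auto simp: norm_mult box_bump_zero mult_left_le split: split_indicator)
    qed auto
    moreover have "(LINT x|lborel. f x * box_bump a b n x) = 0" for n
      by (intro zero box_bump_test_function)
    ultimately have "(LINT x|lborel. f x * indicator (box a b) x) = 0"
      by (simp add: LIMSEQ_const_iff)
    then show ?thesis
      by (simp add: set_lebesgue_integral_def scaleR_conv_of_real mult.commute of_real_indicator)
  qed
  have "AE x in lborel. Re (f x) = 0"
  proof (rule AE_zero_if_box_integrals_zero_real)
    fix a b
    have i: "integrable lborel (\<lambda>x. indicator (box a b) x *\<^sub>R f x)"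
      using int_box by (simp add: set_integrable_def)
    show "set_integrable lborel (box a b) (\<lambda>x. Re (f x))"
      using integrable_Re[OF i] by (simp add: set_integrable_def)
    show "(LINT x:box a b|lborel. Re (f x)) = 0"
      using integral_Re[OF i] box[of a b] by (simp add: set_lebesgue_integral_def)
  qed simp
  moreover have "AE x in lborel. Im (f x) = 0"
  proof (rule AE_zero_if_box_integrals_zero_real)
    fix a b
    have i: "integrable lborel (\<lambda>x. indicator (box a b) x *\<^sub>R f x)"
      using int_box by (simp add: set_integrable_def)
    show "set_integrable lborel (box a b) (\<lambda>x. Im (f x))"
      using integrable_Im[OF i] by (simp add: set_integrable_def)
    show "(LINT x:box a b|lborel. Im (f x)) = 0"
      using integral_Im[OF i] box[of a b] by (simp add: set_lebesgue_integral_def)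
  qed simp
  ultimately show ?thesis by eventually_elim (simp add: complex_eq_iff)
qed

lemma lebesgue_measurable_borel_representative:
  fixes f :: "'a::euclidean_space \<Rightarrow> complex"
  assumes "f \<in> borel_measurable lebesgue"
  obtains g where "g \<in> borel_measurable borel" "AE x in lborel. f x = g x"
proof -
  obtain r where r: "r \<in> borel_measurable lborel" "AE x in lborel. Re (f x) = r x"
    using completion_ex_borel_measurable_real[of "\<lambda>x. Re (f x)" lborel] assms by auto
  obtain i where i: "i \<in> borel_measurable lborel" "AE x in lborel. Im (f x) = i x"
    using completion_ex_borel_measurable_real[of "\<lambda>x. Im (f x)" lborel] assms by auto
  show ?thesis
  proof (rule that)
    show "(\<lambda>x. Complex (r x) (i x)) \<in> borel_measurable borel"
      using r(1) i(1) by (simp add: complex_eq_iff Complex_eq)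
    show "AE x in lborel. f x = Complex (r x) (i x)"
      using r(2) i(2) by eventually_elim (simp add: complex_eq_iff)
  qed
qed

section \<open>Inequalities for Lebesgue norms\<close>

text \<open>The sums in the definitions are unconditional sums \<open>infsum\<close>. As integrals
  over counting measure they become accessible to Tonelli's theorem and to the norm inequalities,
  which are proved for arbitrary measures.\<close>

lemma nn_integral_count_space_eq_infsum:
  fixes f :: "'a \<Rightarrow> ennreal"
  assumes "countable A"
  shows "(\<integral>\<^sup>+x. f x \<partial>count_space A) = infsum f A"
proof (rule antisym)
  have infsum: "infsum f A = (SUP F\<in>{F. finite F \<and> F \<subseteq> A}. sum f F)"
    by (rule nonneg_infsum_complete) simp
  show "(\<integral>\<^sup>+x. f x \<partial>count_space A) \<le> infsum f A"
  proof (cases "finite A")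
    case False
    have bij: "bij_betw (from_nat_into A) UNIV A"
      using assms False by (rule bij_betw_from_nat_into)
    have "(\<integral>\<^sup>+x. f x \<partial>count_space A) = (\<integral>\<^sup>+n. f (from_nat_into A n) \<partial>count_space UNIV)"
      by (rule nn_integral_bij_count_space[OF bij, symmetric])
    also have "\<dots> = (SUP N. \<Sum>n<N. f (from_nat_into A n))"
      by (simp add: nn_integral_count_space_nat suminf_eq_SUP)
    also have "\<dots> \<le> infsum f A"
    proof (rule SUP_least)
      fix N
      have "(\<Sum>n<N. f (from_nat_into A n)) = sum f (from_nat_into A ` {..<N})"
        using bij by (subst sum.reindex) (auto simp: bij_betw_def inj_on_def)
      also have "\<dots> \<le> infsum f A"
        unfolding infsum using bij by (intro SUP_upper) (auto simp: bij_betw_def)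
      finally show "(\<Sum>n<N. f (from_nat_into A n)) \<le> infsum f A" .
    qed
    finally show ?thesis .
  qed (simp add: nn_integral_count_space_finite)
  show "infsum f A \<le> (\<integral>\<^sup>+x. f x \<partial>count_space A)"
    unfolding infsum
  proof (rule SUP_least)
    fix F assume "F \<in> {F. finite F \<and> F \<subseteq> A}"
    then have F: "finite F" "F \<subseteq> A" by auto
    have "sum f F = (\<integral>\<^sup>+x. f x \<partial>count_space F)"
      using F by (simp add: nn_integral_count_space_finite)
    also have "\<dots> = (\<integral>\<^sup>+x. f x * indicator F x \<partial>count_space A)"
      using F by (simp add: nn_integral_restrict_space[symmetric] restrict_count_space Int_absorb1 Int_absorb2)
    also have "\<dots> \<le> (\<integral>\<^sup>+x. f x \<partial>count_space A)"
      by (intro nn_integral_mono) (auto split: split_indicator)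
    finally show "sum f F \<le> (\<integral>\<^sup>+x. f x \<partial>count_space A)" .
  qed
qed

section \<open>Powers, exponents and elementary properties of the norms\<close>

lemma epowr_ennreal: "0 \<le> x \<Longrightarrow> epowr (ennreal x) a = ennreal (x powr a)"
  by (simp add: epowr_def)

lemma epowr_top [simp]: "epowr top a = top"
  by (simp add: epowr_def)

lemma epowr_0 [simp]: "epowr 0 a = 0"
  by (simp add: epowr_def)

lemma epowr_1 [simp]: "epowr 1 a = 1"
  using epowr_ennreal[of 1 a] by simp

lemma epowr_one [simp]: "epowr x 1 = x"
  by (cases x) (auto simp: epowr_ennreal)

lemma epowr_mono: "x \<le> y \<Longrightarrow> 0 \<le> a \<Longrightarrow> epowr x a \<le> epowr y a"
  by (cases x; cases y) (auto simp: epowr_ennreal powr_mono2 ennreal_leI top_unique)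

lemma epowr_epowr: "epowr (epowr x a) b = epowr x (a * b)"
  by (cases x) (auto simp: epowr_ennreal powr_powr)

lemma epowr_mult: "a > 0 \<Longrightarrow> epowr (x * y) a = epowr x a * epowr y a"
  by (cases x; cases y)
    (auto simp: epowr_ennreal powr_mult ennreal_mult[symmetric] ennreal_mult_top ennreal_top_mult)

lemma epowr_eq_0_iff [simp]: "epowr x a = 0 \<longleftrightarrow> x = 0"
  by (cases x) (auto simp: epowr_ennreal)

lemma epowr_eq_top_iff [simp]: "epowr x a = top \<longleftrightarrow> x = top"
  by (cases x) (auto simp: epowr_ennreal)

lemma epowr_less_top_iff [simp]: "epowr x a < top \<longleftrightarrow> x < top"
  by (simp add: less_top[symmetric] del: epowr_eq_top_iff) (simp add: less_top)

lemma epowr_measurable [measurable]: "(\<lambda>x. epowr x a) \<in> borel_measurable borel"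
  unfolding epowr_def by measurable

lemma exponent_cases [consumes 1, case_names infinite finite]:
  assumes "1 \<le> p"
  obtains "p = \<infinity>" | q where "1 \<le> q" "p = ennreal q"
  using assms by (cases p) (auto simp: top_ennreal_def[symmetric] ennreal_ge_1)

lemma inv_exponent_ennreal: "1 \<le> q \<Longrightarrow> inv_exponent (ennreal q) = 1 / q"
proof -
  assume q: "1 \<le> q"
  have "1 / ennreal q = ennreal (1 / q)"
    using q divide_ennreal[of 1 q] by simp
  then show ?thesis using q by (simp add: inv_exponent_def)
qed

lemma inv_exponent_infinity [simp]: "inv_exponent \<infinity> = 0" "inv_exponent top = 0"
  by (simp_all add: inv_exponent_def)

lemma Lp_enorm_infinity: "Lp_enorm \<infinity> M g = esssup M g" "Lp_enorm top M g = esssup M g"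
  by (simp_all add: Lp_enorm_def)

lemma Lp_enorm_ennreal:
  "1 \<le> q \<Longrightarrow> Lp_enorm (ennreal q) M g = epowr (\<integral>\<^sup>+ x. epowr (g x) q \<partial>M) (1 / q)"
  by (simp add: Lp_enorm_def inv_exponent_ennreal)

lemma epowr_Lp_enorm:
  "1 \<le> q \<Longrightarrow> epowr (Lp_enorm (ennreal q) M g) q = (\<integral>\<^sup>+ x. epowr (g x) q \<partial>M)"
  by (simp add: Lp_enorm_ennreal epowr_epowr)

lemma Lp_enorm_leI:
  assumes "1 \<le> q" "(\<integral>\<^sup>+ x. epowr (g x) q \<partial>M) \<le> epowr C q"
  shows "Lp_enorm (ennreal q) M g \<le> C"
  using epowr_mono[OF assms(2), of "1 / q"] assms(1) by (simp add: Lp_enorm_ennreal epowr_epowr)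

lemma Lp_enorm_mono_AE:
  assumes "1 \<le> p" "f \<in> borel_measurable M" "AE x in M. f x \<le> g x"
  shows "Lp_enorm p M f \<le> Lp_enorm p M g"
  using assms(1)
proof (cases rule: exponent_cases)
  case (finite q)
  have "(\<integral>\<^sup>+ x. epowr (f x) q \<partial>M) \<le> (\<integral>\<^sup>+ x. epowr (g x) q \<partial>M)"
    using assms(3) finite by (intro nn_integral_mono_AE) (auto elim!: eventually_mono intro: epowr_mono)
  then show ?thesis using finite by (simp add: Lp_enorm_ennreal epowr_mono)
qed (use assms in \<open>auto simp: Lp_enorm_infinity intro: esssup_AE_mono\<close>)

lemma Lp_enorm_cong_AE:
  assumes "1 \<le> p" "f \<in> borel_measurable M" "g \<in> borel_measurable M" "AE x in M. f x = g x"
  shows "Lp_enorm p M f = Lp_enorm p M g"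
  using assms by (intro antisym Lp_enorm_mono_AE) (auto elim: eventually_mono)

lemma Lp_enorm_zero:
  assumes "1 \<le> p" shows "Lp_enorm p M (\<lambda>_. 0) = 0"
  using assms
proof (cases rule: exponent_cases)
  case infinite
  have "esssup M (\<lambda>_. 0 :: ennreal) \<le> 0" by (rule esssup_I) auto
  with infinite show ?thesis by (simp add: Lp_enorm_infinity)
qed (simp add: Lp_enorm_ennreal)

lemma Lp_enorm_eq_0D:
  assumes "1 \<le> p" "f \<in> borel_measurable M" "Lp_enorm p M f = 0"
  shows "AE x in M. f x = 0"
  using assms(1)
proof (cases rule: exponent_cases)
  case infinite
  have "AE x in M. f x \<le> 0"
    using esssup_AE[of f M] assms infinite by (simp add: Lp_enorm_infinity)
  then show ?thesis by simp
next
  case (finite q)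
  have "(\<integral>\<^sup>+ x. epowr (f x) q \<partial>M) = 0"
    using assms finite by (simp add: Lp_enorm_ennreal)
  then show ?thesis
    using assms(2) by (subst (asm) nn_integral_0_iff_AE) auto
qed

lemma Lp_enorm_less_top_AE:
  assumes "1 \<le> p" "f \<in> borel_measurable M" "Lp_enorm p M f < top"
  shows "AE x in M. f x < top"
  using assms(1)
proof (cases rule: exponent_cases)
  case infinite
  have "AE x in M. f x \<le> Lp_enorm p M f"
    using esssup_AE[of f M] infinite by (simp add: Lp_enorm_infinity)
  then show ?thesis using assms(3) by (auto elim!: eventually_mono)
next
  case (finite q)
  have "(\<integral>\<^sup>+ x. epowr (f x) q \<partial>M) \<noteq> \<infinity>"
    using assms finite by (simp add: Lp_enorm_ennreal less_top)
  from nn_integral_noteq_infinite[OF _ this] assms(2) show ?thesis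
    by (simp add: less_top)
qed

lemma Lp_enorm_cmult_le:
  assumes "1 \<le> p" "f \<in> borel_measurable M"
  shows "Lp_enorm p M (\<lambda>x. c * f x) \<le> c * Lp_enorm p M f"
  using assms(1)
proof (cases rule: exponent_cases)
  case infinite
  have "AE x in M. c * f x \<le> c * Lp_enorm p M f"
    using esssup_AE[of f M] infinite by (auto simp: Lp_enorm_infinity elim!: eventually_mono intro: mult_left_mono)
  then show ?thesis using assms(2) infinite by (auto simp: Lp_enorm_infinity)
next
  case (finite q)
  have "(\<integral>\<^sup>+ x. epowr (c * f x) q \<partial>M) = epowr (c * Lp_enorm p M f) q"
    using finite assms(2) by (simp add: epowr_mult epowr_Lp_enorm nn_integral_cmult)
  then show ?thesis using finite by (auto intro: Lp_enorm_leI)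
qed

text \<open>The inequality for the factor \<open>c\<close>, applied again with the factor
  \<open>1 / c\<close>, gives its converse.\<close>

lemma Lp_enorm_cmult:
  assumes "1 \<le> p" "f \<in> borel_measurable M" "c > 0"
  shows "Lp_enorm p M (\<lambda>x. ennreal c * f x) = ennreal c * Lp_enorm p M f"
proof (rule antisym)
  have inv: "ennreal (1 / c) * ennreal c = 1" "ennreal c * ennreal (1 / c) = 1"
    using assms(3) by (simp_all add: ennreal_mult[symmetric])
  have "Lp_enorm p M (\<lambda>x. ennreal (1 / c) * (ennreal c * f x))
      \<le> ennreal (1 / c) * Lp_enorm p M (\<lambda>x. ennreal c * f x)"
    using assms by (intro Lp_enorm_cmult_le) auto
  then have "Lp_enorm p M f \<le> ennreal (1 / c) * Lp_enorm p M (\<lambda>x. ennreal c * f x)"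
    by (simp add: mult.assoc[symmetric] inv)
  then have "ennreal c * Lp_enorm p M f \<le> ennreal c * (ennreal (1 / c) * Lp_enorm p M (\<lambda>x. ennreal c * f x))"
    by (intro mult_left_mono) auto
  then show "ennreal c * Lp_enorm p M f \<le> Lp_enorm p M (\<lambda>x. ennreal c * f x)"
    by (simp add: mult.assoc[symmetric] inv)
qed (use assms in \<open>auto intro: Lp_enorm_cmult_le\<close>)

text \<open>The graph of u^q lies above its tangent line at \<open>a\<close>; this follows from
  Young's inequality with weights 1/q and 1 - 1/q.\<close>

lemma powr_tangent_le:
  fixes u a q :: real
  assumes "1 \<le> q" "0 \<le> u" "0 < a"
  shows "q * a powr (q - 1) * u \<le> u powr q + (q - 1) * a powr q"
proof (cases "u = 0")
  case False
  have "(u powr q) powr (1 / q) * (a powr q) powr (1 - 1 / q) \<le> 1 / q * u powr q + (1 - 1 / q) * a powr q"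
    using assms False by (intro Youngs_inequality_0) auto
  moreover have "(u powr q) powr (1 / q) = u" "(a powr q) powr (1 - 1 / q) = a powr (q - 1)"
    using assms False by (simp_all add: powr_powr algebra_simps)
  ultimately have "u * a powr (q - 1) \<le> 1 / q * u powr q + (1 - 1 / q) * a powr q" by simp
  then have "q * (u * a powr (q - 1)) \<le> q * (1 / q * u powr q + (1 - 1 / q) * a powr q)"
    using assms by (intro mult_left_mono) auto
  also have "\<dots> = u powr q + (q - 1) * a powr q" using assms by (simp add: field_simps)
  finally show ?thesis by (simp add: mult_ac)
qed (use assms in auto)

text \<open>Makes a function whose q-th power is integrable integrable over sets of finite
  measure.\<close>

lemma le_1_plus_epowr:
  assumes "1 \<le> q"
  shows "u \<le> 1 + epowr u q"
proof (cases u)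
  case (real r)
  have "r \<le> 1 + r powr q"
  proof (cases "r \<le> 1")
    case True
    with powr_ge_zero[of r q] show ?thesis by linarith
  next
    case False
    with powr_mono[of 1 q r] assms show ?thesis by simp
  qed
  then show ?thesis using real
    by (simp add: epowr_ennreal ennreal_1[symmetric] ennreal_plus[symmetric] del: ennreal_1 ennreal_plus)
qed simp

text \<open>Jensen's inequality for a finite measure that is not normalised: the tangent inequality
  is integrated at the mean of \<open>f\<close>. This form fits the weights that occur in
  Minkowski's inequality and in the lattice sums, whose total mass is arbitrary.\<close>

lemma epowr_nn_integral_le:
  assumes q: "1 \<le> q" and f[measurable]: "f \<in> borel_measurable M"
    and fin: "emeasure M (space M) < top"
  shows "epowr (\<integral>\<^sup>+x. f x \<partial>M) q \<le> epowr (emeasure M (space M)) (q - 1) * (\<integral>\<^sup>+x. epowr (f x) q \<partial>M)"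
proof -
  define I where "I = (\<integral>\<^sup>+x. f x \<partial>M)"
  define W where "W = emeasure M (space M)"
  consider "I = 0" | "I = top" | "I \<noteq> 0" "I \<noteq> top" by blast
  then have "epowr I q \<le> epowr W (q - 1) * (\<integral>\<^sup>+x. epowr (f x) q \<partial>M)"
  proof cases
    \<comment> \<open>If the integral of \<open>f\<close> is infinite then so is that of its q-th
      power, because \<open>f\<close> is at most 1 plus that power and the mass is finite; positive
      mass keeps the product infinite.\<close>
    case 2
    have W0: "W \<noteq> 0"
    proof
      assume "W = 0"
      then have "I = (\<integral>\<^sup>+x\<in>space M. f x \<partial>M)" unfolding I_def by (simp add: nn_integral_set_ennreal[symmetric] cong: nn_integral_cong)
      also have "\<dots> = 0" using \<open>W = 0\<close> by (intro nn_integral_null_set) (auto simp: W_def)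
      finally show False using 2 by simp
    qed
    have "I \<le> (\<integral>\<^sup>+x. 1 + epowr (f x) q \<partial>M)"
      unfolding I_def by (intro nn_integral_mono le_1_plus_epowr q)
    also have "\<dots> = W + (\<integral>\<^sup>+x. epowr (f x) q \<partial>M)"
      by (subst nn_integral_add) (auto simp: W_def)
    finally have "(\<integral>\<^sup>+x. epowr (f x) q \<partial>M) = top"
      using 2 fin by (auto simp: W_def top_unique)
    then show ?thesis using 2 W0 by (simp add: ennreal_mult_top)
  next
    case 3
    obtain i where i: "I = ennreal i" "0 < i" using 3 by (cases I) (auto simp: zero_less_iff_neq_zero)
    obtain w where w: "W = ennreal w" "0 \<le> w" using fin unfolding W_def[symmetric] by (cases W) auto
    have "w \<noteq> 0"
    proof
      assume "w = 0"
      then have "I = (\<integral>\<^sup>+x\<in>space M. f x \<partial>M)" unfolding I_def by (simp add: nn_integral_set_ennreal[symmetric] cong: nn_integral_cong)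
      also have "\<dots> = 0" using \<open>w = 0\<close> w by (intro nn_integral_null_set) (auto simp: W_def)
      finally show False using 3 by simp
    qed
    then have w0: "w > 0" using w by simp
    \<comment> \<open>The mean of \<open>f\<close> is the point of tangency: the linear term then
      integrates to q a^q w, of which (q - 1) a^q w is cancelled by the constant term.\<close>
    define a where "a = i / w"
    have a: "a > 0" using i w0 by (simp add: a_def)
    have pt: "ennreal (q * a powr (q - 1)) * u \<le> epowr u q + ennreal ((q - 1) * a powr q)" for u
    proof (cases u)
      case (real r)
      then show ?thesis using powr_tangent_le[of q r a] q a
        by (simp add: epowr_ennreal ennreal_mult[symmetric] ennreal_plus[symmetric] del: ennreal_plus)
    qed simp
    have "ennreal (q * a powr (q - 1)) * I = (\<integral>\<^sup>+x. ennreal (q * a powr (q - 1)) * f x \<partial>M)"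
      by (simp add: I_def nn_integral_cmult)
    also have "\<dots> \<le> (\<integral>\<^sup>+x. epowr (f x) q + ennreal ((q - 1) * a powr q) \<partial>M)"
      by (intro nn_integral_mono pt)
    also have "\<dots> = (\<integral>\<^sup>+x. epowr (f x) q \<partial>M) + ennreal ((q - 1) * a powr q) * W"
      by (subst nn_integral_add) (auto simp: W_def)
    finally have le: "ennreal (q * a powr (q - 1) * i) \<le> (\<integral>\<^sup>+x. epowr (f x) q \<partial>M) + ennreal ((q - 1) * a powr q * w)"
      using q i w by (simp add: ennreal_mult[symmetric])
    have e: "q * a powr (q - 1) * i = a powr q * w + (q - 1) * a powr q * w"
    proof -
      have "a powr (q - 1) * a = a powr q" using a by (simp add: powr_diff)
      moreover have "i = a * w" using w0 by (simp add: a_def)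
      ultimately show ?thesis by (simp add: algebra_simps)
    qed
    have "ennreal (a powr q * w) + ennreal ((q - 1) * a powr q * w) \<le> (\<integral>\<^sup>+x. epowr (f x) q \<partial>M) + ennreal ((q - 1) * a powr q * w)"
      using le w q unfolding e by (subst ennreal_plus[symmetric]) auto
    then have "ennreal (a powr q * w) \<le> (\<integral>\<^sup>+x. epowr (f x) q \<partial>M)"
      by (simp add: ennreal_add_left_cancel_le add.commute)
    then have "epowr W (q - 1) * ennreal (a powr q * w) \<le> epowr W (q - 1) * (\<integral>\<^sup>+x. epowr (f x) q \<partial>M)"
      by (intro mult_left_mono) auto
    moreover have "epowr W (q - 1) * ennreal (a powr q * w) = epowr I q"
    proof -
      have "i powr q = w powr (q - 1) * (a powr q * w)"
        using w0 i by (simp add: a_def powr_divide powr_diff field_simps)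
      then show ?thesis using w0 i w by (simp add: epowr_ennreal ennreal_mult[symmetric])
    qed
    ultimately show ?thesis by simp
  qed simp
  then show ?thesis by (simp add: I_def W_def)
qed

text \<open>Minkowski's inequality is Jensen's inequality for the weights \<open>\<parallel>f\<^sub>j\<parallel>\<close> on the index set.\<close>

lemma Lp_enorm_suminf_le:
  fixes f :: "nat \<Rightarrow> 'a \<Rightarrow> ennreal"
  assumes p: "1 \<le> p" and [measurable]: "\<And>j. f j \<in> borel_measurable M"
  shows "Lp_enorm p M (\<lambda>x. \<Sum>j. f j x) \<le> (\<Sum>j. Lp_enorm p M (f j))"
  using p
proof (cases rule: exponent_cases)
  case infinite
  have "AE x in M. \<forall>j. f j x \<le> esssup M (f j)"
    by (simp add: AE_all_countable esssup_AE)
  then have "AE x in M. (\<Sum>j. f j x) \<le> (\<Sum>j. esssup M (f j))"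
    by eventually_elim (auto intro!: suminf_le)
  then show ?thesis unfolding infinite Lp_enorm_infinity by (intro esssup_I) auto
next
  case (finite q)
  define A where "A j = Lp_enorm p M (f j)" for j
  define W where "W = (\<Sum>j. A j)"
  show ?thesis
  proof (cases "W = top")
    case False
    have A_top: "A j \<noteq> top" for j
      using False sum_le_suminf[of A "{j}"] unfolding W_def by (auto simp: top_unique)
    \<comment> \<open>Weighting \<open>j\<close> by \<open>A j\<close> turns the sum into the
      integral of \<open>f j x / A j\<close> over \<open>j\<close>, where each quotient has norm at
      most 1 as a function of \<open>x\<close>.\<close>
    define D where "D = density (count_space UNIV) A"
    have D: "emeasure D (space D) = W"
      by (simp add: D_def emeasure_density nn_integral_count_space_nat W_def)
    have Dint: "(\<integral>\<^sup>+j. g j \<partial>D) = (\<Sum>j. A j * g j)" for g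
      by (simp add: D_def nn_integral_density nn_integral_count_space_nat)
    \<comment> \<open>Indices with \<open>A j = 0\<close> need separate care: there
      \<open>f j\<close> vanishes almost everywhere, so \<open>A j * (f j x / A j)\<close> still
      equals \<open>f j x\<close>.\<close>
    have "AE x in M. \<forall>j. A j = 0 \<longrightarrow> f j x = 0"
      unfolding AE_all_countable
    proof
      fix j
      show "AE x in M. A j = 0 \<longrightarrow> f j x = 0"
        using Lp_enorm_eq_0D[OF p, of "f j" M] by (cases "A j = 0") (auto simp: A_def)
    qed
    then have AE1: "AE x in M. epowr (\<Sum>j. f j x) q \<le> epowr W (q - 1) * (\<Sum>j. A j * epowr (f j x / A j) q)"
    proof eventually_elim
      case (elim x)
      have "A j * (f j x / A j) = f j x" for j
        using elim A_top[of j] by (cases "A j = 0") (auto simp: ennreal_times_divide ennreal_mult_divide_eq mult.commute[of "A j"])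
      then have "(\<Sum>j. f j x) = (\<integral>\<^sup>+j. f j x / A j \<partial>D)" by (simp add: Dint)
      then show ?case
        using epowr_nn_integral_le[OF finite(1), of "\<lambda>j. f j x / A j" D] False
        by (simp add: D Dint less_top[symmetric]) (simp add: D_def)
    qed
    have "(\<integral>\<^sup>+x. epowr (\<Sum>j. f j x) q \<partial>M) \<le> (\<integral>\<^sup>+x. epowr W (q - 1) * (\<Sum>j. A j * epowr (f j x / A j) q) \<partial>M)"
      by (rule nn_integral_mono_AE[OF AE1])
    also have "\<dots> = epowr W (q - 1) * (\<Sum>j. A j * (\<integral>\<^sup>+x. epowr (f j x / A j) q \<partial>M))"
      by (simp add: nn_integral_cmult nn_integral_suminf)
    also have "\<dots> \<le> epowr W (q - 1) * (\<Sum>j. A j)"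
    proof (intro mult_left_mono suminf_le)
      fix j
      have "(\<integral>\<^sup>+x. epowr (f j x / A j) q \<partial>M) = epowr (inverse (A j)) q * epowr (A j) q"
        using finite by (simp add: divide_ennreal_def epowr_mult nn_integral_multc A_def epowr_Lp_enorm mult.commute)
      also have "\<dots> = epowr (inverse (A j) * A j) q"
        using finite by (simp add: epowr_mult)
      also have "\<dots> \<le> 1"
        using A_top[of j] by (cases "A j = 0") (auto simp: ennreal_inverse_mult less_top[symmetric] mult.commute ennreal_divide_self[unfolded divide_ennreal_def])
      finally show "A j * (\<integral>\<^sup>+x. epowr (f j x / A j) q \<partial>M) \<le> A j"
        using mult_left_mono[of _ 1 "A j"] by simp
    qed auto
    also have "\<dots> = epowr W q"
    proof -
      obtain w where "W = ennreal w" "w \<ge> 0" using False by (cases W) auto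
      then show ?thesis
        by (cases "w = 0") (auto simp: W_def[symmetric] epowr_ennreal ennreal_mult[symmetric] powr_diff)
    qed
    finally show ?thesis
      using finite Lp_enorm_leI[OF finite(1)] unfolding W_def A_def by simp
  qed (simp add: W_def A_def)
qed

lemma Lp_enorm_add_le:
  assumes "1 \<le> p" "f \<in> borel_measurable M" "g \<in> borel_measurable M"
  shows "Lp_enorm p M (\<lambda>x. f x + g x) \<le> Lp_enorm p M f + Lp_enorm p M g"
proof -
  define h where "h j = (if j = 0 then f else if j = Suc 0 then g else (\<lambda>_. 0))" for j :: nat
  have [measurable]: "h j \<in> borel_measurable M" for j using assms by (simp add: h_def)
  have "(\<Sum>j. h j x) = f x + g x" for x
    by (subst suminf_finite[of "{0, Suc 0}"]) (auto simp: h_def)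
  moreover have "(\<Sum>j. Lp_enorm p M (h j)) = Lp_enorm p M f + Lp_enorm p M g"
    by (subst suminf_finite[of "{0, Suc 0}"]) (auto simp: h_def Lp_enorm_zero assms(1))
  ultimately show ?thesis
    using Lp_enorm_suminf_le[OF assms(1), of h M] by simp
qed

text \<open>Borel rather than Lebesgue measurability, because these functions are integrated along
  translates against measures that may be singular to Lebesgue measure. \<open>Lp_norm_eq\<close>
  leads back to \<open>Lp_space\<close>.\<close>

definition borel_Lp :: "ennreal \<Rightarrow> ('a::euclidean_space \<Rightarrow> complex) \<Rightarrow> bool"
  where "borel_Lp p f \<longleftrightarrow> f \<in> borel_measurable borel \<and> Lp_enorm p lborel (\<lambda>x. ennreal (norm (f x))) < \<infinity>"

abbreviation Lp_borel_norm :: "ennreal \<Rightarrow> ('a::euclidean_space \<Rightarrow> complex) \<Rightarrow> ennreal"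
  where "Lp_borel_norm p f \<equiv> Lp_enorm p lborel (\<lambda>x. ennreal (norm (f x)))"

lemma borel_Lp_measurable [measurable_dest]: "borel_Lp p f \<Longrightarrow> f \<in> borel_measurable borel"
  by (simp add: borel_Lp_def)

lemma Lp_borel_norm_add_le:
  assumes "1 \<le> p" "f \<in> borel_measurable borel" "g \<in> borel_measurable borel"
  shows "Lp_borel_norm p (\<lambda>x. f x + g x) \<le> Lp_borel_norm p f + Lp_borel_norm p g"
proof -
  have "Lp_borel_norm p (\<lambda>x. f x + g x) \<le> Lp_enorm p lborel (\<lambda>x. ennreal (norm (f x)) + ennreal (norm (g x)))"
    using assms by (intro Lp_enorm_mono_AE AE_I2)
      (auto simp: ennreal_plus[symmetric] norm_triangle_ineq simp del: ennreal_plus intro!: ennreal_leI)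
  also have "\<dots> \<le> Lp_borel_norm p f + Lp_borel_norm p g"
    using assms by (intro Lp_enorm_add_le) auto
  finally show ?thesis .
qed

lemma Lp_borel_norm_cmult_le:
  assumes "1 \<le> p" "f \<in> borel_measurable borel"
  shows "Lp_borel_norm p (\<lambda>x. z * f x) \<le> ennreal (norm z) * Lp_borel_norm p f"
  using Lp_enorm_cmult_le[of p "\<lambda>x. ennreal (norm (f x))" lborel "ennreal (norm z)"] assms
  by (simp add: norm_mult ennreal_mult')

lemma borel_Lp_add:
  assumes "1 \<le> p" "borel_Lp p f" "borel_Lp p g"
  shows "borel_Lp p (\<lambda>x. f x + g x)"
proof -
  have "Lp_borel_norm p f + Lp_borel_norm p g < \<infinity>"
    using assms by (simp add: borel_Lp_def ennreal_add_eq_top less_top[symmetric])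
  from le_less_trans[OF Lp_borel_norm_add_le this] assms show ?thesis
    by (auto simp: borel_Lp_def)
qed

lemma borel_Lp_cmult:
  assumes "1 \<le> p" "borel_Lp p f"
  shows "borel_Lp p (\<lambda>x. z * f x)"
proof -
  have "ennreal (norm z) * Lp_borel_norm p f < \<infinity>"
    using assms by (simp add: borel_Lp_def ennreal_mult_less_top)
  from le_less_trans[OF Lp_borel_norm_cmult_le this] assms show ?thesis
    by (auto simp: borel_Lp_def)
qed

lemma borel_Lp_diff:
  assumes "1 \<le> p" "borel_Lp p f" "borel_Lp p g"
  shows "borel_Lp p (\<lambda>x. f x - g x)"
  using borel_Lp_add[OF assms(1,2) borel_Lp_cmult[OF assms(1,3), of "-1"]] by simp

lemma borel_Lp_zero: "1 \<le> p \<Longrightarrow> borel_Lp p (\<lambda>x. 0)"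
  by (simp add: borel_Lp_def Lp_enorm_zero)

section \<open>Changes of variables\<close>

lemma nn_integral_lborel_translate:
  fixes y :: "'a::euclidean_space"
  assumes [measurable]: "f \<in> borel_measurable borel"
  shows "(\<integral>\<^sup>+x. f (x + y) \<partial>lborel) = (\<integral>\<^sup>+x. f x \<partial>lborel)"
proof -
  have "(\<integral>\<^sup>+x. f x \<partial>lborel) = (\<integral>\<^sup>+x. f x \<partial>distr lborel borel ((+) y))"
    by (simp add: lborel_distr_plus)
  also have "\<dots> = (\<integral>\<^sup>+x. f (x + y) \<partial>lborel)"
    by (simp add: nn_integral_distr add.commute)
  finally show ?thesis ..
qed

lemma integral_lborel_translate:
  fixes f :: "'a::euclidean_space \<Rightarrow> complex"
  assumes [measurable]: "f \<in> borel_measurable borel"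
  shows "(LINT x|lborel. f (x + y)) = (LINT x|lborel. f x)"
proof -
  have "(LINT x|lborel. f x) = (LINT x|distr lborel borel ((+) y). f x)"
    by (simp add: lborel_distr_plus)
  also have "\<dots> = (LINT x|lborel. f (x + y))"
    by (simp add: integral_distr add.commute)
  finally show ?thesis ..
qed

lemma AE_lborel_translate:
  fixes y :: "'a::euclidean_space"
  assumes "AE x in lborel. P x"
  shows "AE x in lborel. P (x + y)"
proof -
  have "AE x in lborel. P (y + x)"
  proof (rule AE_distrD[of "(+) y" lborel borel])
    show "AE x in distr lborel borel ((+) y). P x"
      by (subst lborel_distr_plus) (rule assms)
  qed simp
  then show ?thesis by (simp add: add.commute)
qed

text \<open>A translation does not increase the norm; applying this to the inverse translation gives
  equality.\<close>

lemma Lp_enorm_translate: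
  fixes y :: "'a::euclidean_space"
  assumes p: "1 \<le> p" and [measurable]: "g \<in> borel_measurable borel"
  shows "Lp_enorm p lborel (\<lambda>x. g (x + y)) = Lp_enorm p lborel g"
proof -
  have le: "Lp_enorm p lborel (\<lambda>x. h (x + z)) \<le> Lp_enorm p lborel h"
    if [measurable]: "h \<in> borel_measurable borel" for h :: "'a \<Rightarrow> ennreal" and z
    using p
  proof (cases rule: exponent_cases)
    case infinite
    have "AE x in lborel. h (x + z) \<le> esssup lborel h"
      by (intro AE_lborel_translate esssup_AE)
    then show ?thesis by (auto simp: infinite Lp_enorm_infinity)
  next
    case (finite q)
    then show ?thesis
      using nn_integral_lborel_translate[of "\<lambda>x. epowr (h x) q" z] by (simp add: Lp_enorm_ennreal)
  qed
  have "Lp_enorm p lborel g = Lp_enorm p lborel (\<lambda>x. g (x + - y + y))" by simp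
  also have "\<dots> \<le> Lp_enorm p lborel (\<lambda>x. g (x + y))"
    by (rule le[of "\<lambda>x. g (x + y)"]) measurable
  finally show ?thesis using le[of g y] by (intro antisym) auto
qed

lemma borel_Lp_translate:
  assumes "1 \<le> p" "borel_Lp p f"
  shows "borel_Lp p (\<lambda>x. f (x - v))"
proof -
  have [measurable]: "f \<in> borel_measurable borel" using assms by (simp add: borel_Lp_def)
  show ?thesis
    using Lp_enorm_translate[of p "\<lambda>x. ennreal (norm (f x))" "- v"] assms by (simp add: borel_Lp_def)
qed

text \<open>Exchanging \<open>s\<close> with the coordinate \<open>y $ t\<close> preserves Lebesgue measure on \<open>\<real> \<times> \<real>\<^sup>n\<close>, being a
  reflection followed by three shears. This replaces Fubini's theorem for a single coordinate
  of \<open>\<real>\<^sup>n\<close>.\<close>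

lemma nn_integral_exchange_coordinate:
  fixes F :: "real \<times> (real ^ 'n::finite) \<Rightarrow> ennreal"
  assumes F: "F \<in> borel_measurable (borel \<Otimes>\<^sub>M borel)"
  shows "(\<integral>\<^sup>+s. \<integral>\<^sup>+y. F (s, y) \<partial>lborel \<partial>lborel)
    = (\<integral>\<^sup>+s. \<integral>\<^sup>+y. F (y $ t, y + (s - y $ t) *\<^sub>R axis t 1) \<partial>lborel \<partial>lborel)"
proof -
  interpret lborel_pair: pair_sigma_finite "lborel :: real measure" "lborel :: (real ^ 'n) measure" ..
  let ?e = "axis t 1 :: real ^ 'n"
  note [measurable] = F
  have [measurable]: "(\<lambda>y :: real ^ 'n. y $ t) \<in> borel_measurable borel"
    by (intro borel_measurable_continuous_onI continuous_intros)
  have "(\<integral>\<^sup>+s. \<integral>\<^sup>+y. F (s, y) \<partial>lborel \<partial>lborel) = (\<integral>\<^sup>+s. \<integral>\<^sup>+y. F (- s, y) \<partial>lborel \<partial>lborel)"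
    by (subst nn_integral_real_affine[where c = "-1" and t = 0]) simp_all
  also have "\<dots> = (\<integral>\<^sup>+s. \<integral>\<^sup>+y. F (- s, y + s *\<^sub>R ?e) \<partial>lborel \<partial>lborel)"
    by (intro nn_integral_cong nn_integral_lborel_translate[symmetric]) simp
  also have "\<dots> = (\<integral>\<^sup>+y. \<integral>\<^sup>+s. F (- s, y + s *\<^sub>R ?e) \<partial>lborel \<partial>lborel)"
    by (rule lborel_pair.Fubini'[symmetric]) simp
  \<comment> \<open>For fixed \<open>y\<close> the variable \<open>s\<close> is moved by
    \<open>y $ t\<close>, which is why the order of integration was exchanged.\<close>
  also have "\<dots> = (\<integral>\<^sup>+y. \<integral>\<^sup>+s. F (- (s + - (y $ t)), y + (s + - (y $ t)) *\<^sub>R ?e) \<partial>lborel \<partial>lborel)"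
    by (intro nn_integral_cong nn_integral_lborel_translate[symmetric]) simp
  also have "\<dots> = (\<integral>\<^sup>+s. \<integral>\<^sup>+y. F (- (s + - (y $ t)), y + (s + - (y $ t)) *\<^sub>R ?e) \<partial>lborel \<partial>lborel)"
    by (rule lborel_pair.Fubini') simp
  also have "\<dots> = (\<integral>\<^sup>+s. \<integral>\<^sup>+y. F (- (s + - ((y + s *\<^sub>R ?e) $ t)), (y + s *\<^sub>R ?e) + (s + - ((y + s *\<^sub>R ?e) $ t)) *\<^sub>R ?e) \<partial>lborel \<partial>lborel)"
    by (intro nn_integral_cong nn_integral_lborel_translate[symmetric]) simp
  also have "\<dots> = (\<integral>\<^sup>+s. \<integral>\<^sup>+y. F (y $ t, y + (s - y $ t) *\<^sub>R ?e) \<partial>lborel \<partial>lborel)"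
    by (simp add: algebra_simps)
  finally show ?thesis .
qed

text \<open>On a line in direction \<open>m\<close> the coordinate \<open>x $ n\<close> is constant,
  so the shear acts there as a translation. Integrals are reduced to such lines by inserting a dummy
  variable in [0,1) and exchanging it with the coordinate \<open>m\<close>.\<close>

lemma nn_integral_shear:
  fixes f :: "real ^ 'n::finite \<Rightarrow> ennreal"
  assumes [measurable]: "f \<in> borel_measurable borel" and mn: "m \<noteq> n"
  shows "(\<integral>\<^sup>+x. f (x + (c * x $ n) *\<^sub>R axis m 1) \<partial>lborel) = (\<integral>\<^sup>+x. f x \<partial>lborel)"
proof -
  interpret lborel_pair: pair_sigma_finite "lborel :: real measure" "lborel :: (real ^ 'n) measure" ..
  let ?e = "axis m 1 :: real ^ 'n"
  have coord[measurable]: "(\<lambda>y :: real ^ 'n. y $ k) \<in> borel_measurable borel" for k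
    by (intro borel_measurable_continuous_onI continuous_intros)
  have slice: "(\<integral>\<^sup>+x. g x \<partial>lborel) = (\<integral>\<^sup>+y. indicator {0..<1} (y $ m) * (\<integral>\<^sup>+s. g (y + (s - y $ m) *\<^sub>R ?e) \<partial>lborel) \<partial>lborel)"
    if [measurable]: "g \<in> borel_measurable borel" for g :: "real ^ 'n \<Rightarrow> ennreal"
  proof -
    have "(\<integral>\<^sup>+x. g x \<partial>lborel) = (\<integral>\<^sup>+s. \<integral>\<^sup>+y. indicator {0..<1} s * g y \<partial>lborel \<partial>(lborel :: real measure))"
      by (simp add: nn_integral_cmult nn_integral_multc)
    also have "\<dots> = (\<integral>\<^sup>+s. \<integral>\<^sup>+y. indicator {0..<1} (y $ m) * g (y + (s - y $ m) *\<^sub>R ?e) \<partial>lborel \<partial>(lborel :: real measure))"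
      using nn_integral_exchange_coordinate[of "\<lambda>(s, y). indicator {0..<1} s * g y" m] by simp
    also have "\<dots> = (\<integral>\<^sup>+y. \<integral>\<^sup>+s. indicator {0..<1} (y $ m) * g (y + (s - y $ m) *\<^sub>R ?e) \<partial>(lborel :: real measure) \<partial>lborel)"
      by (rule lborel_pair.Fubini'[symmetric]) simp
    finally show ?thesis by (simp add: nn_integral_cmult)
  qed
  have "(\<integral>\<^sup>+s. f (y + (s - y $ m) *\<^sub>R ?e + (c * (y + (s - y $ m) *\<^sub>R ?e) $ n) *\<^sub>R ?e) \<partial>lborel)
      = (\<integral>\<^sup>+s. f (y + (s - y $ m) *\<^sub>R ?e) \<partial>lborel)" for y
  proof -
    have "(\<integral>\<^sup>+s. f (y + (s - y $ m) *\<^sub>R ?e) \<partial>lborel) = (\<integral>\<^sup>+s. f (y + (s + c * y $ n - y $ m) *\<^sub>R ?e) \<partial>lborel)"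
      by (rule nn_integral_lborel_translate[symmetric]) simp
    also have "\<dots> = (\<integral>\<^sup>+s. f (y + (s - y $ m) *\<^sub>R ?e + (c * (y + (s - y $ m) *\<^sub>R ?e) $ n) *\<^sub>R ?e) \<partial>lborel)"
      using mn by (intro nn_integral_cong arg_cong[of _ _ f]) (simp add: axis_def algebra_simps)
    finally show ?thesis ..
  qed
  then show ?thesis
    by (subst (1 2) slice) simp_all
qed

section \<open>Lebesgue measure under invertible matrices\<close>

lemma measurable_matrix_vector_mult [measurable]: "(*v) (A :: real ^ 'n ^ 'm::finite) \<in> borel_measurable borel"
  by (intro borel_measurable_continuous_onI matrix_vector_mult_linear_continuous_on)

lemma measurable_vec_nth [measurable]: "(\<lambda>y :: real ^ 'n. y $ k) \<in> borel_measurable borel"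
  by (intro borel_measurable_continuous_onI continuous_intros)

lemma prod_Basis_vec: "(\<Prod>b\<in>Basis. f b) = (\<Prod>i\<in>UNIV. f (axis i (1::real)))" for f :: "real ^ 'n \<Rightarrow> 'b::comm_monoid_mult"
  by (simp add: Basis_vec_def axis_eq_axis prod.UNION_disjoint)

lemma nn_integral_diagonal:
  fixes A :: "real ^ 'n::finite ^ 'n"
  assumes [measurable]: "f \<in> borel_measurable borel" and A: "invertible A" and diag: "\<And>i j. i \<noteq> j \<Longrightarrow> A $ i $ j = 0"
  shows "(\<integral>\<^sup>+x. f x \<partial>lborel) = ennreal \<bar>det A\<bar> * (\<integral>\<^sup>+x. f (A *v x) \<partial>lborel)"
proof -
  \<comment> \<open>\<open>lborel_affine_euclidean\<close> indexes the scaling factors by basis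
    vectors; on \<open>axis i 1\<close> this linear form returns the entry
    \<open>A $ i $ i\<close>.\<close>
  define c where "c j = (\<Sum>i\<in>UNIV. j $ i * A $ i $ i)" for j :: "real ^ 'n"
  have c: "c (axis i 1) = A $ i $ i" for i
  proof -
    have "c (axis i 1) = (\<Sum>k\<in>UNIV. if k = i then A $ k $ k else 0)"
      unfolding c_def by (intro sum.cong) (auto simp: axis_def)
    then show ?thesis by simp
  qed
  have det: "det A = (\<Prod>i\<in>UNIV. A $ i $ i)" using diag by (intro det_diagonal) auto
  have c0: "c j \<noteq> 0" if "j \<in> Basis" for j
    using that A c by (auto simp: Basis_vec_def invertible_det_nz det)
  have Av: "0 + (\<Sum>j\<in>Basis. (c j * (x \<bullet> j)) *\<^sub>R j) = A *v x" for x
  proof -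
    have "(\<Sum>j\<in>Basis. (c j * (x \<bullet> j)) *\<^sub>R j) = (\<Sum>i\<in>UNIV. (A $ i $ i * x $ i) *\<^sub>R axis i 1)"
      by (simp add: Basis_vec_def axis_eq_axis sum.UNION_disjoint c inner_axis)
    also have "\<dots> = A *v x"
    proof -
      have "(A *v x) $ k = A $ k $ k * x $ k" for k
      proof -
        have "(A *v x) $ k = (\<Sum>j\<in>UNIV. if j = k then A $ k $ j * x $ j else 0)"
          unfolding matrix_vector_mult_def vec_lambda_beta using diag by (intro sum.cong) auto
        then show ?thesis by simp
      qed
      moreover have "(\<Sum>i\<in>UNIV. (A $ i $ i * x $ i) *\<^sub>R axis i 1) $ k = A $ k $ k * x $ k" for k
      proof -
        have "(\<Sum>i\<in>UNIV. (A $ i $ i * x $ i) *\<^sub>R axis i 1) $ k = (\<Sum>i\<in>UNIV. if i = k then A $ i $ i * x $ i else 0)"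
          unfolding sum_component by (intro sum.cong) (auto simp: axis_def)
        then show ?thesis by simp
      qed
      ultimately show ?thesis by (simp add: vec_eq_iff)
    qed
    finally show ?thesis by simp
  qed
  have "(lborel :: (real ^ 'n) measure) = density (distr lborel borel ((*v) A)) (\<lambda>_. (\<Prod>j\<in>Basis. \<bar>c j\<bar>))"
    using lborel_affine_euclidean[of c 0] c0 unfolding Av by simp
  also have "(\<Prod>j\<in>Basis. \<bar>c j\<bar>) = \<bar>det A\<bar>"
    by (simp add: prod_Basis_vec c det abs_prod)
  finally have "(\<integral>\<^sup>+x. f x \<partial>lborel) = (\<integral>\<^sup>+x. f x \<partial>density (distr lborel borel ((*v) A)) (\<lambda>_. \<bar>det A\<bar>))"
    by simp
  then show ?thesis by (simp add: nn_integral_density nn_integral_distr nn_integral_cmult)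
qed

text \<open>Lebesgue measure is determined by its values on boxes, and the product of the side
  lengths does not depend on their order.\<close>

lemma nn_integral_transpose_coordinates:
  fixes m n :: "'n::finite" and f :: "real ^ 'n \<Rightarrow> ennreal"
  assumes [measurable]: "f \<in> borel_measurable borel"
  shows "(\<integral>\<^sup>+x. f (\<chi> i. x $ Transposition.transpose m n i) \<partial>lborel) = (\<integral>\<^sup>+x. f x \<partial>lborel)"
proof -
  let ?h = "\<lambda>x :: real ^ 'n. \<chi> i. x $ Transposition.transpose m n i"
  have [measurable]: "?h \<in> borel_measurable borel"
    by (intro borel_measurable_continuous_onI continuous_intros)
  have "lborel = distr lborel borel ?h"
  proof (rule lborel_eqI)
    fix l u :: "real ^ 'n" assume le: "\<And>b. b \<in> Basis \<Longrightarrow> l \<bullet> b \<le> u \<bullet> b"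
    have lu: "l $ i \<le> u $ i" for i
      using le[of "axis i 1"] by (auto simp: Basis_vec_def inner_axis)
    have pre: "?h -` box l u = box (?h l) (?h u)"
      by (auto simp: mem_box_cart) (metis transpose_involutory)+
    have "emeasure lborel (box (?h l) (?h u)) = ennreal (\<Prod>b\<in>Basis. (?h u - ?h l) \<bullet> b)"
      using lu by (intro emeasure_lborel_box) (auto simp: Basis_vec_def inner_axis)
    also have "(\<Prod>b\<in>Basis. (?h u - ?h l) \<bullet> b) = (\<Prod>i\<in>UNIV. (u - l) $ Transposition.transpose m n i)"
      by (simp add: prod_Basis_vec inner_axis)
    also have "\<dots> = (\<Prod>i\<in>UNIV. (u - l) $ i)"
      using prod.permute[OF permutes_swap_id, of m UNIV n "\<lambda>i. (u - l) $ i"] by (simp add: o_def)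
    also have "\<dots> = (\<Prod>b\<in>Basis. (u - l) \<bullet> b)"
      by (simp add: prod_Basis_vec inner_axis)
    finally show "emeasure (distr lborel borel ?h) (box l u) = (\<Prod>b\<in>Basis. (u - l) \<bullet> b)"
      by (simp add: emeasure_distr pre)
  qed simp
  then have "(\<integral>\<^sup>+x. f x \<partial>lborel) = (\<integral>\<^sup>+x. f x \<partial>distr lborel borel ?h)" by simp
  then show ?thesis by (simp add: nn_integral_distr)
qed

text \<open>The library proves the change of variables formula only for well-ordered index types.\<close>

lemma nn_integral_matrix:
  fixes A :: "real ^ 'n::finite ^ 'n"
  assumes "invertible A" "f \<in> borel_measurable borel"
  shows "(\<integral>\<^sup>+x. f x \<partial>lborel) = ennreal \<bar>det A\<bar> * (\<integral>\<^sup>+x. f (A *v x) \<partial>lborel)"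
proof -
  \<comment> \<open>All integrands are quantified inside the induction: for a product
    \<open>A ** B\<close> the formula for \<open>B\<close> is used with the integrand
    \<open>f (A *v x)\<close>.\<close>
  let ?P = "\<lambda>A :: real ^ 'n ^ 'n. invertible A \<longrightarrow> (\<forall>f\<in>borel_measurable borel.
    (\<integral>\<^sup>+x. f x \<partial>lborel) = ennreal \<bar>det A\<bar> * (\<integral>\<^sup>+x. f (A *v x) \<partial>lborel))"
  have "?P A"
  proof (rule induct_matrix_elementary)
    fix A B :: "real ^ 'n ^ 'n"
    assume A: "?P A" and B: "?P B"
    show "?P (A ** B)"
    proof (intro impI ballI)
      fix f :: "real ^ 'n \<Rightarrow> ennreal"
      assume "invertible (A ** B)" and [measurable]: "f \<in> borel_measurable borel"
      then have inv: "invertible A" "invertible B" by (auto simp: invertible_det_nz det_mul)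
      have "(\<integral>\<^sup>+x. f x \<partial>lborel) = ennreal \<bar>det A\<bar> * (\<integral>\<^sup>+x. f (A *v x) \<partial>lborel)"
        by (rule A[rule_format, OF inv(1)]) measurable
      also have "(\<integral>\<^sup>+x. f (A *v x) \<partial>lborel) = ennreal \<bar>det B\<bar> * (\<integral>\<^sup>+x. f (A *v (B *v x)) \<partial>lborel)"
        by (rule B[rule_format, OF inv(2)]) measurable
      finally show "(\<integral>\<^sup>+x. f x \<partial>lborel) = ennreal \<bar>det (A ** B)\<bar> * (\<integral>\<^sup>+x. f ((A ** B) *v x) \<partial>lborel)"
        by (simp add: det_mul abs_mult ennreal_mult mult.assoc matrix_vector_mul_assoc)
    qed
  next
    fix A :: "real ^ 'n ^ 'n" and i
    assume "row i A = 0"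
    then have "det A = 0" by (rule det_zero_row)
    then show "?P A" by (simp add: invertible_det_nz)
  next
    fix A :: "real ^ 'n ^ 'n"
    assume "\<And>i j. i \<noteq> j \<Longrightarrow> A $ i $ j = 0"
    then show "?P A" by (intro impI ballI nn_integral_diagonal)
  next
    fix m n :: 'n assume "m \<noteq> n"
    let ?A = "\<chi> i j. mat 1 $ i $ Transposition.transpose m n j :: real ^ 'n ^ 'n"
    have "?A *v x = (\<chi> i. x $ Transposition.transpose m n i)" for x
    proof -
      have "(?A *v x) $ i = x $ Transposition.transpose m n i" for i
      proof -
        have "(?A *v x) $ i = (\<Sum>j\<in>UNIV. (if j = Transposition.transpose m n i then x $ j else 0))"
        proof -
          have "i = Transposition.transpose m n j \<longleftrightarrow> j = Transposition.transpose m n i" for j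
            by (metis transpose_involutory)
          then show ?thesis
            unfolding matrix_vector_mult_def vec_lambda_beta mat_def by (intro sum.cong) auto
        qed
        then show ?thesis by simp
      qed
      then show ?thesis by (simp add: vec_eq_iff)
    qed
    moreover have "\<bar>det ?A\<bar> = 1"
      by (simp add: det_permute_columns permutes_swap_id sign_swap_id abs_mult)
    ultimately show "?P ?A" by (simp add: nn_integral_transpose_coordinates)
  next
    fix m n :: 'n and c :: real assume mn: "m \<noteq> n"
    let ?A = "\<chi> i j. if i = m \<and> j = n then c else of_bool (i = j) :: real ^ 'n ^ 'n"
    have "?A *v x = x + (c * x $ n) *\<^sub>R axis m 1" for x
    proof -
      have "(?A *v x) $ i = x $ i + (if i = m then c * x $ n else 0)" for i
      proof -
        have "(?A *v x) $ i = (\<Sum>j\<in>UNIV. (if j = i then x $ j else 0) + (if j = n then (if i = m then c * x $ j else 0) else 0))"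
          unfolding matrix_vector_mult_def vec_lambda_beta using mn by (intro sum.cong) auto
        then show ?thesis by (simp add: sum.distrib)
      qed
      then show ?thesis by (simp add: vec_eq_iff axis_def)
    qed
    moreover have "det ?A = 1"
    proof -
      have "?A = (\<chi> k. if k = m then row m (mat 1) + c *s row n (mat 1) else row k (mat 1))"
        using mn by (auto simp: vec_eq_iff row_def mat_def)
      then show ?thesis using det_row_operation[OF mn, of "mat 1 :: real ^ 'n ^ 'n" c] by simp
    qed
    ultimately show "?P ?A" using mn by (simp add: nn_integral_shear)
  qed
  from this[rule_format, OF assms] show ?thesis .
qed

section \<open>Averages of translates and weak derivatives\<close>

text \<open>On the ball that carries \<open>w\<close> the function \<open>g\<close> is integrable:
  it is bounded almost everywhere if \<open>p\<close> is infinite, and otherwise at most 1 plus an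
  integrable power.\<close>

lemma Lp_local_nn_integral:
  fixes g w :: "'a::euclidean_space \<Rightarrow> ennreal"
  assumes p: "1 \<le> p" and [measurable]: "g \<in> borel_measurable borel"
    and fin: "Lp_enorm p lborel g < \<infinity>"
    and w: "\<And>x. w x \<le> ennreal B" "\<And>x. norm x > R \<Longrightarrow> w x = 0"
  shows "(\<integral>\<^sup>+x. g x * w x \<partial>lborel) < \<infinity>"
proof -
  have w': "w x \<le> ennreal B * indicator (cball 0 R) x" for x
    using w[of x] by (cases "norm x > R") (auto simp: indicator_def)
  have [measurable]: "cball 0 R \<in> sets (borel :: 'a measure)" by simp
  have ball: "emeasure lborel (cball 0 R :: 'a set) < \<infinity>"
    by (rule emeasure_compact_finite) simp
  from p show ?thesis
  proof (cases rule: exponent_cases)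
    case infinite
    have "AE x in lborel. g x * w x \<le> Lp_enorm p lborel g * (ennreal B * indicator (cball 0 R) x)"
      using esssup_AE[of g lborel] by (auto simp: infinite Lp_enorm_infinity elim!: eventually_mono intro!: mult_mono w')
    then have "(\<integral>\<^sup>+x. g x * w x \<partial>lborel) \<le> (\<integral>\<^sup>+x. Lp_enorm p lborel g * (ennreal B * indicator (cball 0 R) x) \<partial>(lborel :: 'a measure))"
      by (rule nn_integral_mono_AE)
    also have "\<dots> = Lp_enorm p lborel g * (ennreal B * emeasure lborel (cball 0 R :: 'a set))"
      unfolding mult.assoc[symmetric] by (rule nn_integral_cmult_indicator) simp
    also have "\<dots> < \<infinity>" using fin ball by (simp add: ennreal_mult_less_top)
    finally show ?thesis .
  next
    case (finite q)
    have I: "(\<integral>\<^sup>+x. epowr (g x) q \<partial>lborel) < \<infinity>"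
      using fin finite by (simp add: Lp_enorm_ennreal)
    have "(\<integral>\<^sup>+x. g x * w x \<partial>lborel) \<le> (\<integral>\<^sup>+x. ennreal B * (indicator (cball 0 R) x + epowr (g x) q) \<partial>lborel)"
    proof (rule nn_integral_mono)
      fix x
      have "g x * w x \<le> (1 + epowr (g x) q) * (ennreal B * indicator (cball 0 R) x)"
        by (intro mult_mono w' le_1_plus_epowr finite) auto
      also have "\<dots> \<le> ennreal B * (indicator (cball 0 R) x + epowr (g x) q)"
        by (auto simp: mult.commute split: split_indicator)
      finally show "g x * w x \<le> ennreal B * (indicator (cball 0 R) x + epowr (g x) q)" .
    qed
    also have "\<dots> = ennreal B * (emeasure lborel (cball 0 R :: 'a set) + (\<integral>\<^sup>+x. epowr (g x) q \<partial>lborel))"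
      by (simp add: nn_integral_cmult nn_integral_add)
    also have "\<dots> < \<infinity>" using I ball by (simp add: ennreal_mult_eq_top_iff ennreal_add_eq_top less_top[symmetric])
    finally show ?thesis .
  qed
qed

text \<open>A class of weights against which every L^p function is integrable; besides test
  functions it contains the indicators of compact sets.\<close>

definition compactly_bounded :: "('a::euclidean_space \<Rightarrow> complex) \<Rightarrow> bool"
  where "compactly_bounded w \<longleftrightarrow> w \<in> borel_measurable borel \<and>
    (\<exists>B R. \<forall>x. norm (w x) \<le> B \<and> (norm x > R \<longrightarrow> w x = 0))"

lemma test_functions_compactly_bounded:
  assumes "\<phi> \<in> test_functions"
  shows "compactly_bounded \<phi>"
proof -
  obtain R where "\<And>x. norm x > R \<Longrightarrow> \<phi> x = 0"
    using test_functions_support[OF assms] by blast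
  moreover obtain B where "\<And>x. norm (\<phi> x) \<le> B"
    using test_functions_bounded[OF assms] by blast
  ultimately show ?thesis
    using test_functions_borel[OF assms] by (auto simp: compactly_bounded_def)
qed

lemma compactly_bounded_nn_integral:
  assumes "1 \<le> p" "g \<in> borel_measurable borel" "Lp_enorm p lborel g < \<infinity>" "compactly_bounded w"
  shows "(\<integral>\<^sup>+x. g x * ennreal (norm (w x)) \<partial>lborel) < \<infinity>"
proof -
  obtain B R where "\<And>x. norm (w x) \<le> B" "\<And>x. norm x > R \<Longrightarrow> w x = 0"
    using assms(4) by (auto simp: compactly_bounded_def)
  then show ?thesis
    by (intro Lp_local_nn_integral[OF assms(1-3), of _ B R]) (auto intro: ennreal_leI)
qed

lemma compactly_bounded_integrable:
  assumes "1 \<le> p" "borel_Lp p f" "compactly_bounded w"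
  shows "integrable lborel (\<lambda>x. f x * w x)"
proof (rule integrableI_bounded)
  have [measurable]: "f \<in> borel_measurable borel" "w \<in> borel_measurable borel"
    using assms by (auto simp: borel_Lp_def compactly_bounded_def)
  show "(\<lambda>x. f x * w x) \<in> borel_measurable lborel" by measurable
  show "(\<integral>\<^sup>+x. ennreal (norm (f x * w x)) \<partial>lborel) < \<infinity>"
    using compactly_bounded_nn_integral[of p "\<lambda>x. ennreal (norm (f x))" w] assms
    by (simp add: norm_mult ennreal_mult borel_Lp_def)
qed

text \<open>Convolution of \<open>f\<close> with the measure \<open>\<mu>\<close>. A measure takes
  the place of a kernel because averages over faces have no density. Where the integral does not
  converge the value is 0.\<close>

definition avg :: "'a::euclidean_space measure \<Rightarrow> ('a \<Rightarrow> complex) \<Rightarrow> 'a \<Rightarrow> complex"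
  where "avg \<mu> f x = (LINT y|\<mu>. f (x - y))"

definition nn_avg :: "'a::euclidean_space measure \<Rightarrow> ('a \<Rightarrow> ennreal) \<Rightarrow> 'a \<Rightarrow> ennreal"
  where "nn_avg \<mu> g x = (\<integral>\<^sup>+y. g (x - y) \<partial>\<mu>)"

locale borel_prob_space = prob_space \<mu> for \<mu> :: "'a::euclidean_space measure" +
  assumes sets_eq_borel [measurable_cong, simp]: "sets \<mu> = sets borel"
begin

sublocale lborel_pair: pair_sigma_finite lborel \<mu> ..

lemma space_eq_UNIV [simp]: "space \<mu> = UNIV"
  using sets_eq_imp_space_eq[OF sets_eq_borel] by simp

lemma avg_measurable [measurable]:
  assumes [measurable]: "f \<in> borel_measurable borel"
  shows "avg \<mu> f \<in> borel_measurable borel"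
  unfolding avg_def[abs_def] by measurable

lemma nn_avg_measurable [measurable]:
  assumes [measurable]: "g \<in> borel_measurable borel"
  shows "nn_avg \<mu> g \<in> borel_measurable borel"
  unfolding nn_avg_def[abs_def] by measurable

lemma norm_avg_le: "ennreal (norm (avg \<mu> f x)) \<le> nn_avg \<mu> (\<lambda>x. ennreal (norm (f x))) x"
proof (cases "integrable \<mu> (\<lambda>y. f (x - y))")
  case True
  then show ?thesis unfolding avg_def nn_avg_def by (rule integral_norm_bound_ennreal)
qed (simp add: avg_def not_integrable_integral_eq)

lemma nn_integral_nn_avg:
  assumes [measurable]: "g \<in> borel_measurable borel"
  shows "(\<integral>\<^sup>+x. nn_avg \<mu> g x \<partial>lborel) = (\<integral>\<^sup>+x. g x \<partial>lborel)"
proof -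
  have "(\<integral>\<^sup>+x. nn_avg \<mu> g x \<partial>lborel) = (\<integral>\<^sup>+y. \<integral>\<^sup>+x. g (x - y) \<partial>lborel \<partial>\<mu>)"
    unfolding nn_avg_def by (rule lborel_pair.Fubini'[symmetric]) measurable
  also have "\<dots> = (\<integral>\<^sup>+y. \<integral>\<^sup>+x. g x \<partial>lborel \<partial>\<mu>)"
    using nn_integral_lborel_translate[of g "- y" for y] by simp
  finally show ?thesis by (simp add: emeasure_space_1[simplified])
qed

text \<open>By Tonelli, the \<open>\<mu>\<close>-measure of the set of \<open>y\<close> with
  \<open>x - y\<close> in a given null set has integral 0 over \<open>x\<close>. Hence averages
  respect almost everywhere equality even when \<open>\<mu>\<close> is singular.\<close>

lemma AE_nn_avg:
  assumes "AE x in lborel. P x"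
  shows "AE x in lborel. AE y in \<mu>. P (x - y)"
proof -
  obtain N where N: "N \<in> null_sets lborel" "{x. \<not> P x} \<subseteq> N"
    using assms by (auto simp: eventually_ae_filter)
  then have [measurable]: "N \<in> sets borel" by auto
  have "(\<integral>\<^sup>+x. nn_avg \<mu> (indicator N) x \<partial>lborel) = 0"
    using N by (subst nn_integral_nn_avg) auto
  then have "AE x in lborel. nn_avg \<mu> (indicator N) x = 0"
    by (subst (asm) nn_integral_0_iff_AE) auto
  then show ?thesis
  proof eventually_elim
    case (elim x)
    then have "AE y in \<mu>. indicator N (x - y) = (0 :: ennreal)"
      unfolding nn_avg_def by (subst (asm) nn_integral_0_iff_AE) auto
    then show ?case
      by eventually_elim (use N in \<open>auto simp: indicator_def split: if_splits\<close>)
  qed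
qed

text \<open>Jensen's inequality under \<open>\<mu>\<close> at each point, followed by Tonelli; for
  infinite \<open>p\<close> the essential bound is inherited by \<open>\<mu>\<close>-almost all
  translates.\<close>

lemma Lp_enorm_nn_avg_le:
  assumes p: "1 \<le> p" and [measurable]: "g \<in> borel_measurable borel"
  shows "Lp_enorm p lborel (nn_avg \<mu> g) \<le> Lp_enorm p lborel g"
  using p
proof (cases rule: exponent_cases)
  case infinite
  have "AE x in lborel. AE y in \<mu>. g (x - y) \<le> esssup lborel g"
    by (intro AE_nn_avg esssup_AE)
  then have "AE x in lborel. nn_avg \<mu> g x \<le> esssup lborel g"
  proof eventually_elim
    case (elim x)
    then have "nn_avg \<mu> g x \<le> (\<integral>\<^sup>+y. esssup lborel g \<partial>\<mu>)"
      unfolding nn_avg_def by (rule nn_integral_mono_AE)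
    then show ?case by (simp add: emeasure_space_1[simplified])
  qed
  then show ?thesis by (auto simp: infinite Lp_enorm_infinity)
next
  case (finite q)
  have "(\<integral>\<^sup>+x. epowr (nn_avg \<mu> g x) q \<partial>lborel) \<le> (\<integral>\<^sup>+x. nn_avg \<mu> (\<lambda>x. epowr (g x) q) x \<partial>lborel)"
  proof (rule nn_integral_mono)
    fix x
    show "epowr (nn_avg \<mu> g x) q \<le> nn_avg \<mu> (\<lambda>x. epowr (g x) q) x"
      using epowr_nn_integral_le[of q "\<lambda>y. g (x - y)" \<mu>] finite
      by (simp add: nn_avg_def emeasure_space_1[simplified])
  qed
  also have "\<dots> = epowr (Lp_enorm p lborel g) q"
    using finite by (simp add: nn_integral_nn_avg epowr_Lp_enorm)
  finally show ?thesis using finite Lp_enorm_leI by blast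
qed

lemma Lp_borel_norm_avg_le:
  assumes "1 \<le> p" "f \<in> borel_measurable borel"
  shows "Lp_borel_norm p (avg \<mu> f) \<le> Lp_borel_norm p f"
proof -
  have "Lp_borel_norm p (avg \<mu> f) \<le> Lp_enorm p lborel (nn_avg \<mu> (\<lambda>x. ennreal (norm (f x))))"
    using assms by (intro Lp_enorm_mono_AE AE_I2 norm_avg_le) auto
  also have "\<dots> \<le> Lp_borel_norm p f" using assms by (intro Lp_enorm_nn_avg_le) auto
  finally show ?thesis .
qed

lemma borel_Lp_avg:
  assumes "1 \<le> p" "borel_Lp p f"
  shows "borel_Lp p (avg \<mu> f)"
  using le_less_trans[OF Lp_borel_norm_avg_le, of p f] assms by (auto simp: borel_Lp_def)

lemma AE_integrable_avg:
  assumes "1 \<le> p" "borel_Lp p f"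
  shows "AE x in lborel. integrable \<mu> (\<lambda>y. f (x - y))"
proof -
  have [measurable]: "f \<in> borel_measurable borel" using assms by (simp add: borel_Lp_def)
  have "Lp_enorm p lborel (nn_avg \<mu> (\<lambda>x. ennreal (norm (f x)))) < top"
    using le_less_trans[OF Lp_enorm_nn_avg_le] assms by (auto simp: borel_Lp_def)
  then have "AE x in lborel. nn_avg \<mu> (\<lambda>x. ennreal (norm (f x))) x < top"
    using assms by (intro Lp_enorm_less_top_AE) auto
  then show ?thesis
    by eventually_elim (auto simp: nn_avg_def intro!: integrableI_bounded)
qed

lemma avg_cong_AE:
  assumes [measurable]: "f \<in> borel_measurable borel" "g \<in> borel_measurable borel"
    and "AE x in lborel. f x = g x"
  shows "AE x in lborel. avg \<mu> f x = avg \<mu> g x"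
  using AE_nn_avg[OF assms(3)]
  by eventually_elim (auto simp: avg_def intro!: integral_cong_AE)

text \<open>An identity almost everywhere, since both averages have to converge at the
  point.\<close>

lemma avg_diff:
  assumes "1 \<le> p" "borel_Lp p f" "borel_Lp p g"
  shows "AE x in lborel. avg \<mu> (\<lambda>x. f x - g x) x = avg \<mu> f x - avg \<mu> g x"
  using AE_integrable_avg[OF assms(1,2)] AE_integrable_avg[OF assms(1,3)]
  by eventually_elim (simp add: avg_def)

lemma avg_translate: "avg \<mu> (\<lambda>x. f (x - v)) x = avg \<mu> f (x - v)"
  by (simp add: avg_def algebra_simps)

text \<open>The average of |f| is again in L^p, so its product with |w| is integrable, which is the
  double integral in the first form. Translating \<open>x\<close> by \<open>y\<close> gives the
  second.\<close>

lemma integrable_pair_avg: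
  assumes "1 \<le> p" "borel_Lp p f" "compactly_bounded w"
  shows "integrable (lborel \<Otimes>\<^sub>M \<mu>) (\<lambda>(x, y). f (x - y) * w x)"
    and "integrable (lborel \<Otimes>\<^sub>M \<mu>) (\<lambda>(x, y). f x * w (x + y))"
proof -
  have [measurable]: "f \<in> borel_measurable borel" "w \<in> borel_measurable borel"
    using assms by (auto simp: borel_Lp_def compactly_bounded_def)
  have "Lp_enorm p lborel (nn_avg \<mu> (\<lambda>x. ennreal (norm (f x)))) < \<infinity>"
    using le_less_trans[OF Lp_enorm_nn_avg_le] assms by (auto simp: borel_Lp_def)
  then have "(\<integral>\<^sup>+x. nn_avg \<mu> (\<lambda>x. ennreal (norm (f x))) x * ennreal (norm (w x)) \<partial>lborel) < \<infinity>"
    using assms by (intro compactly_bounded_nn_integral[of p]) auto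
  also have "(\<integral>\<^sup>+x. nn_avg \<mu> (\<lambda>x. ennreal (norm (f x))) x * ennreal (norm (w x)) \<partial>lborel)
      = (\<integral>\<^sup>+x. \<integral>\<^sup>+y. ennreal (norm (f (x - y) * w x)) \<partial>\<mu> \<partial>lborel)"
    by (simp add: nn_avg_def nn_integral_multc[symmetric] norm_mult ennreal_mult)
  finally have fin: "(\<integral>\<^sup>+x. \<integral>\<^sup>+y. ennreal (norm (f (x - y) * w x)) \<partial>\<mu> \<partial>lborel) < \<infinity>" .
  show "integrable (lborel \<Otimes>\<^sub>M \<mu>) (\<lambda>(x, y). f (x - y) * w x)"
  proof (rule integrableI_bounded)
    show "(\<integral>\<^sup>+z. ennreal (norm (case z of (x, y) \<Rightarrow> f (x - y) * w x)) \<partial>(lborel \<Otimes>\<^sub>M \<mu>)) < \<infinity>"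
      using fin by (subst nn_integral_fst[symmetric]) simp_all
  qed measurable
  have "(\<integral>\<^sup>+x. \<integral>\<^sup>+y. ennreal (norm (f x * w (x + y))) \<partial>\<mu> \<partial>lborel) = (\<integral>\<^sup>+y. \<integral>\<^sup>+x. ennreal (norm (f x * w (x + y))) \<partial>lborel \<partial>\<mu>)"
    by (rule lborel_pair.Fubini'[symmetric]) measurable
  also have "\<dots> = (\<integral>\<^sup>+y. \<integral>\<^sup>+x. ennreal (norm (f (x - y) * w x)) \<partial>lborel \<partial>\<mu>)"
  proof (rule nn_integral_cong)
    fix y
    show "(\<integral>\<^sup>+x. ennreal (norm (f x * w (x + y))) \<partial>lborel) = (\<integral>\<^sup>+x. ennreal (norm (f (x - y) * w x)) \<partial>lborel)"
      using nn_integral_lborel_translate[of "\<lambda>x. ennreal (norm (f (x - y) * w x))" y] by simp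
  qed
  also have "\<dots> = (\<integral>\<^sup>+x. \<integral>\<^sup>+y. ennreal (norm (f (x - y) * w x)) \<partial>\<mu> \<partial>lborel)"
    by (rule lborel_pair.Fubini') measurable
  finally have fin2: "(\<integral>\<^sup>+x. \<integral>\<^sup>+y. ennreal (norm (f x * w (x + y))) \<partial>\<mu> \<partial>lborel) < \<infinity>"
    using fin by simp
  show "integrable (lborel \<Otimes>\<^sub>M \<mu>) (\<lambda>(x, y). f x * w (x + y))"
  proof (rule integrableI_bounded)
    show "(\<integral>\<^sup>+z. ennreal (norm (case z of (x, y) \<Rightarrow> f x * w (x + y))) \<partial>(lborel \<Otimes>\<^sub>M \<mu>)) < \<infinity>"
      using fin2 by (subst nn_integral_fst[symmetric]) simp_all
  qed measurable
qed

text \<open>Averaging is moved from \<open>f\<close> to the weight. The first form keeps the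
  translates of \<open>w\<close> separate, so that a weak derivative can be tested with each of
  them; the second collects them into an average of \<open>w\<close>, which can be evaluated when
  \<open>w\<close> is a derivative.\<close>

lemma integral_avg_mult:
  assumes "1 \<le> p" "borel_Lp p f" "compactly_bounded w"
  shows "(LINT x|lborel. avg \<mu> f x * w x) = (LINT y|\<mu>. LINT x|lborel. f x * w (x + y))"
    and "(LINT x|lborel. avg \<mu> f x * w x) = (LINT x|lborel. f x * (LINT y|\<mu>. w (x + y)))"
proof -
  have [measurable]: "f \<in> borel_measurable borel" "w \<in> borel_measurable borel"
    using assms by (auto simp: borel_Lp_def compactly_bounded_def)
  have "(LINT x|lborel. avg \<mu> f x * w x) = (LINT x|lborel. LINT y|\<mu>. f (x - y) * w x)"
    by (simp add: avg_def)
  also have "\<dots> = (LINT y|\<mu>. LINT x|lborel. f (x - y) * w x)"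
    by (rule lborel_pair.Fubini_integral[symmetric]) (rule integrable_pair_avg(1)[OF assms])
  also have "\<dots> = (LINT y|\<mu>. LINT x|lborel. f x * w (x + y))"
  proof (rule Bochner_Integration.integral_cong[OF refl])
    fix y
    show "(LINT x|lborel. f (x - y) * w x) = (LINT x|lborel. f x * w (x + y))"
      using integral_lborel_translate[of "\<lambda>x. f (x - y) * w x" y] by simp
  qed
  finally show 1: "(LINT x|lborel. avg \<mu> f x * w x) = (LINT y|\<mu>. LINT x|lborel. f x * w (x + y))" .
  also have "\<dots> = (LINT x|lborel. LINT y|\<mu>. f x * w (x + y))"
    by (rule lborel_pair.Fubini_integral) (rule integrable_pair_avg(2)[OF assms])
  finally show "(LINT x|lborel. avg \<mu> f x * w x) = (LINT x|lborel. f x * (LINT y|\<mu>. w (x + y)))"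
    by simp
qed

end

definition weak_dir_deriv :: "real ^ 'n::finite \<Rightarrow> (real ^ 'n \<Rightarrow> complex) \<Rightarrow> (real ^ 'n \<Rightarrow> complex) \<Rightarrow> bool"
  where "weak_dir_deriv v f g \<longleftrightarrow>
    (\<forall>\<phi>\<in>test_functions. (LINT x|lborel. f x * dir_deriv v \<phi> x) = - (LINT x|lborel. g x * \<phi> x))"

text \<open>By duality the average falls on the test function as a family of translates, each of
  which is again a test function.\<close>

lemma weak_dir_deriv_avg:
  fixes \<mu> :: "(real ^ 'n::finite) measure"
  assumes "borel_prob_space \<mu>"
    and p: "1 \<le> p" "borel_Lp p f" "borel_Lp p g" and fg: "weak_dir_deriv v f g"
  shows "weak_dir_deriv v (avg \<mu> f) (avg \<mu> g)"
  unfolding weak_dir_deriv_def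
proof
  interpret borel_prob_space \<mu> by fact
  fix \<phi> :: "real ^ 'n \<Rightarrow> complex" assume \<phi>: "\<phi> \<in> test_functions"
  have "(LINT x|lborel. avg \<mu> f x * dir_deriv v \<phi> x) = (LINT y|\<mu>. LINT x|lborel. f x * dir_deriv v \<phi> (x + y))"
    using p \<phi> by (intro integral_avg_mult test_functions_compactly_bounded test_functions_dir_deriv)
  also have "\<dots> = (LINT y|\<mu>. - (LINT x|lborel. g x * \<phi> (x + y)))"
  proof (intro Bochner_Integration.integral_cong refl)
    fix y
    have "(LINT x|lborel. f x * dir_deriv v (\<lambda>x. \<phi> (x + y)) x) = - (LINT x|lborel. g x * \<phi> (x + y))"
      using fg test_functions_translate[OF \<phi>] unfolding weak_dir_deriv_def by blast
    then show "(LINT x|lborel. f x * dir_deriv v \<phi> (x + y)) = - (LINT x|lborel. g x * \<phi> (x + y))"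
      by (simp add: dir_deriv_translate[OF \<phi>])
  qed
  also have "\<dots> = - (LINT x|lborel. avg \<mu> g x * \<phi> x)"
    using p \<phi> by (simp add: integral_avg_mult(1)[OF p(1,3)] test_functions_compactly_bounded)
  finally show "(LINT x|lborel. avg \<mu> f x * dir_deriv v \<phi> x) = - (LINT x|lborel. avg \<mu> g x * \<phi> x)" .
qed

section \<open>Averages over cells and faces\<close>

definition unit_cube :: "(real ^ 'n::finite) set"
  where "unit_cube = {x. \<forall>i. 0 \<le> x $ i \<and> x $ i < 1}"

lemma unit_cube_borel [measurable]: "unit_cube \<in> sets (borel :: (real ^ 'n::finite) measure)"
proof -
  have "unit_cube = (\<Inter>i. {x :: real ^ 'n. 0 \<le> x $ i} \<inter> {x. x $ i < 1})"
    by (auto simp: unit_cube_def)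
  also have "\<dots> \<in> sets borel"
    by (intro sets.finite_INT sets.Int) (auto simp: closed_halfspace_component_ge_cart[unfolded atLeast_def] borel_measurable_less)
  finally show ?thesis .
qed

lemma emeasure_unit_cube: "emeasure lborel (unit_cube :: (real ^ 'n::finite) set) = 1"
proof (rule antisym)
  have 1: "(\<Prod>b\<in>Basis. ((\<chi> i. 1) - (0 :: real ^ 'n)) \<bullet> b) = 1"
    by (simp add: prod_Basis_vec inner_axis)
  have le: "0 \<bullet> b \<le> ((\<chi> i. 1) :: real ^ 'n) \<bullet> b" if "b \<in> Basis" for b
    using that by (auto simp: Basis_vec_def inner_axis)
  have "emeasure lborel (unit_cube :: (real ^ 'n) set) \<le> emeasure lborel (cbox 0 (\<chi> i. 1) :: (real ^ 'n) set)"
    by (intro emeasure_mono) (auto simp: unit_cube_def mem_box_cart less_imp_le)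
  also have "\<dots> = 1" using emeasure_lborel_cbox[of 0 "(\<chi> i. 1) :: real ^ 'n", OF le] 1 by simp
  finally show "emeasure lborel (unit_cube :: (real ^ 'n) set) \<le> 1" .
  have "1 = emeasure lborel (box 0 (\<chi> i. 1) :: (real ^ 'n) set)"
    using emeasure_lborel_box[of 0 "(\<chi> i. 1) :: real ^ 'n", OF le] 1 by simp
  also have "\<dots> \<le> emeasure lborel (unit_cube :: (real ^ 'n) set)"
    by (intro emeasure_mono) (auto simp: unit_cube_def mem_box_cart less_imp_le)
  finally show "1 \<le> emeasure lborel (unit_cube :: (real ^ 'n) set)" .
qed

definition cube_measure :: "(real ^ 'n::finite) measure"
  where "cube_measure = density lborel (indicator unit_cube)"

definition unit_interval_measure :: "real measure"
  where "unit_interval_measure = density lborel (indicator {0..<1})"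

lemma sets_cube_measure [simp, measurable_cong]: "sets cube_measure = sets borel"
  by (simp add: cube_measure_def)

lemma sets_unit_interval_measure [simp, measurable_cong]: "sets unit_interval_measure = sets borel"
  by (simp add: unit_interval_measure_def)

lemma prob_space_cube_measure: "prob_space cube_measure"
  by (rule prob_spaceI) (simp add: cube_measure_def emeasure_density emeasure_unit_cube)

lemma prob_space_unit_interval_measure: "prob_space unit_interval_measure"
  by (rule prob_spaceI) (simp add: unit_interval_measure_def emeasure_density)

lemma borel_prob_space_distr_cube:
  assumes "h \<in> borel_measurable borel"
  shows "borel_prob_space (distr cube_measure borel h)"
proof -
  interpret prob_space "cube_measure :: (real ^ 'a) measure" by (rule prob_space_cube_measure)
  interpret P: prob_space "distr cube_measure borel h"
    using assms by (intro prob_space_distr) simp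
  show ?thesis by unfold_locales simp
qed

text \<open>The coordinate \<open>t\<close> of \<open>y\<close> is replaced by an independent
  uniform variable \<open>s\<close>: exchanging the two preserves Lebesgue measure and the product
  of [0,1) with the cube.\<close>

lemma nn_integral_cube_slice:
  fixes g :: "real ^ 'n::finite \<Rightarrow> ennreal"
  assumes [measurable]: "g \<in> borel_measurable borel"
  shows "(\<integral>\<^sup>+y. g y \<partial>cube_measure)
    = (\<integral>\<^sup>+s. \<integral>\<^sup>+y. g (y + (s - y $ t) *\<^sub>R axis t 1) \<partial>cube_measure \<partial>unit_interval_measure)"
proof -
  let ?F = "\<lambda>(s :: real, y). indicator {0..<1} s * (indicator unit_cube y * g (y + (s - y $ t) *\<^sub>R axis t 1))"
  have ind: "indicator {0..<1} (y $ t) * indicator unit_cube (y + (s - y $ t) *\<^sub>R axis t 1)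
      = (indicator {0..<1} s * indicator unit_cube y :: ennreal)" for s y
  proof -
    have "y $ t \<in> {0..<1} \<and> y + (s - y $ t) *\<^sub>R axis t 1 \<in> unit_cube \<longleftrightarrow> s \<in> {0..<1} \<and> y \<in> unit_cube"
      unfolding unit_cube_def by (auto simp: axis_def split: if_splits)
    then show ?thesis by (auto simp: indicator_def)
  qed
  have "(\<integral>\<^sup>+s. \<integral>\<^sup>+y. g (y + (s - y $ t) *\<^sub>R axis t 1) \<partial>cube_measure \<partial>unit_interval_measure)
    = (\<integral>\<^sup>+s. \<integral>\<^sup>+y. ?F (s, y) \<partial>lborel \<partial>lborel)"
    unfolding cube_measure_def unit_interval_measure_def
    by (simp add: nn_integral_density nn_integral_cmult)
  also have "\<dots> = (\<integral>\<^sup>+s. \<integral>\<^sup>+y. ?F (y $ t, y + (s - y $ t) *\<^sub>R axis t 1) \<partial>lborel \<partial>lborel)"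
    by (rule nn_integral_exchange_coordinate) measurable
  also have "\<dots> = (\<integral>\<^sup>+(s :: real). \<integral>\<^sup>+y. indicator {0..<1} s * (indicator unit_cube y * g y) \<partial>lborel \<partial>lborel)"
  proof (intro nn_integral_cong)
    fix s :: real and y :: "real ^ 'n"
    have "y + (s - y $ t) *\<^sub>R axis t 1 + (y $ t - (y + (s - y $ t) *\<^sub>R axis t 1) $ t) *\<^sub>R axis t 1 = y"
      by (simp add: scaleR_left_distrib[symmetric] add.assoc)
    then show "?F (y $ t, y + (s - y $ t) *\<^sub>R axis t 1) = indicator {0..<1} s * (indicator unit_cube y * g y)"
      using ind[of y s] by (simp only: prod.case mult.assoc[symmetric])
  qed
  also have "\<dots> = (\<integral>\<^sup>+y. g y \<partial>cube_measure)"
    by (simp add: nn_integral_cmult nn_integral_multc cube_measure_def nn_integral_density)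
  finally show ?thesis ..
qed

lemma cube_measure_eq_distr:
  "cube_measure = distr (unit_interval_measure \<Otimes>\<^sub>M cube_measure) borel
    (\<lambda>(s, y). y + (s - y $ t) *\<^sub>R axis t 1)" (is "_ = distr ?M borel ?h")
proof (rule measure_eqI)
  interpret C: prob_space "cube_measure :: (real ^ 'a) measure" by (rule prob_space_cube_measure)
  fix A :: "(real ^ 'a) set" assume "A \<in> sets cube_measure"
  then have [measurable]: "A \<in> sets borel" by simp
  have "emeasure (distr ?M borel ?h) A = (\<integral>\<^sup>+z. indicator A z \<partial>distr ?M borel ?h)"
    by simp
  also have "\<dots> = (\<integral>\<^sup>+z. indicator A (?h z) \<partial>?M)"
    by (rule nn_integral_distr) measurable
  also have "\<dots> = (\<integral>\<^sup>+s. \<integral>\<^sup>+y. indicator A (y + (s - y $ t) *\<^sub>R axis t 1) \<partial>cube_measure \<partial>unit_interval_measure)"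
    by (subst C.nn_integral_fst[symmetric]) simp_all
  also have "\<dots> = (\<integral>\<^sup>+y. indicator A y \<partial>cube_measure)"
    by (rule nn_integral_cube_slice[symmetric]) measurable
  finally show "emeasure cube_measure A = emeasure (distr ?M borel ?h) A" by simp
qed simp

lemma integral_cube_slice:
  fixes w :: "real ^ 'n::finite \<Rightarrow> complex"
  assumes [measurable]: "w \<in> borel_measurable borel" and bd: "\<And>x. norm (w x) \<le> B"
  shows "(LINT y|cube_measure. w y)
    = (LINT y|cube_measure. LINT s|unit_interval_measure. w (y + (s - y $ t) *\<^sub>R axis t 1))"
proof -
  interpret C: prob_space "cube_measure :: (real ^ 'n) measure" by (rule prob_space_cube_measure)
  interpret I: prob_space unit_interval_measure by (rule prob_space_unit_interval_measure)
  interpret pair_prob_space unit_interval_measure "cube_measure :: (real ^ 'n) measure" ..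
  have "(LINT y|cube_measure. w y) = (LINT z|(unit_interval_measure \<Otimes>\<^sub>M cube_measure). w ((\<lambda>(s, y). y + (s - y $ t) *\<^sub>R axis t 1) z))"
    by (subst cube_measure_eq_distr[of t]) (rule integral_distr; measurable)
  also have "\<dots> = (LINT z|(unit_interval_measure \<Otimes>\<^sub>M cube_measure). (\<lambda>(s, y). w (y + (s - y $ t) *\<^sub>R axis t 1)) z)"
    by (simp add: case_prod_beta)
  also have "\<dots> = (LINT y|cube_measure. LINT s|unit_interval_measure. w (y + (s - y $ t) *\<^sub>R axis t 1))"
    by (rule integral_snd[symmetric], rule P.integrable_const_bound[of _ B]) (auto simp: bd)
  finally show ?thesis .
qed

lemma integral_unit_interval_FTC:
  fixes F :: "real \<Rightarrow> complex"
  assumes deriv: "\<And>s. (F has_vector_derivative f s) (at s)" and cont: "continuous_on UNIV f"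
  shows "(LINT s|unit_interval_measure. f s) = F 1 - F 0"
proof -
  have [measurable]: "f \<in> borel_measurable borel" using cont by (rule borel_measurable_continuous_onI)
  have "(LINT s|unit_interval_measure. f s) = (LINT s|lborel. indicator {0..<1} s *\<^sub>R f s)"
    unfolding unit_interval_measure_def
    by (subst integral_density[of f lborel "indicator {0..<1}", symmetric]) (auto simp: ennreal_indicator)
  \<comment> \<open>The endpoint 1 is a null set; this passes from the half-open interval of the
    cell to the closed one of the fundamental theorem.\<close>
  also have "\<dots> = (LINT s|lborel. indicator {0..1} s *\<^sub>R f s)"
    using AE_lborel_singleton[of "1 :: real"]
    by (intro integral_cong_AE) (auto elim!: eventually_mono simp: indicator_def)
  also have "\<dots> = F 1 - F 0"
    using deriv cont
    by (intro integral_FTC_atLeastAtMost)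
      (auto intro: has_vector_derivative_at_within continuous_on_subset)
  finally show ?thesis .
qed

definition cell_measure :: "real ^ 'n ^ 'n::finite \<Rightarrow> (real ^ 'n) measure"
  where "cell_measure b = distr cube_measure borel ((*v) b)"

text \<open>The image under \<open>b\<close> of the uniform distribution on the face y_t = 0 of the
  cube. Written as a projection of the cube that forgets \<open>y $ t\<close>, it avoids surface
  measure; in one dimension it is the point mass at 0.\<close>

definition face_measure :: "real ^ 'n ^ 'n::finite \<Rightarrow> 'n \<Rightarrow> (real ^ 'n) measure"
  where "face_measure b t = distr cube_measure borel (\<lambda>y. b *v (y - y $ t *\<^sub>R axis t 1))"

lemma borel_prob_space_cell_measure: "borel_prob_space (cell_measure b)"
  unfolding cell_measure_def by (rule borel_prob_space_distr_cube) measurable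

lemma borel_prob_space_face_measure: "borel_prob_space (face_measure b t)"
  unfolding face_measure_def by (rule borel_prob_space_distr_cube) measurable

text \<open>The fundamental theorem of calculus on each segment of the cell parallel to
  \<open>b *v axis t 1\<close>; the endpoints run through two opposite faces.\<close>

lemma integral_cell_dir_deriv:
  fixes b :: "real ^ 'n ^ 'n::finite"
  assumes \<phi>: "\<phi> \<in> test_functions"
  shows "(LINT y|cell_measure b. dir_deriv (b *v axis t 1) \<phi> (x + y))
    = (LINT y|face_measure b t. \<phi> (x + b *v axis t 1 + y)) - (LINT y|face_measure b t. \<phi> (x + y))"
proof -
  interpret C: prob_space "cube_measure :: (real ^ 'n) measure" by (rule prob_space_cube_measure)
  let ?v = "b *v axis t 1" and ?P = "\<lambda>y. b *v (y - y $ t *\<^sub>R axis t 1)"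
  have d\<phi>: "dir_deriv ?v \<phi> \<in> test_functions" using \<phi> by (rule test_functions_dir_deriv)
  note [measurable] = test_functions_borel[OF \<phi>] test_functions_borel[OF d\<phi>]
  obtain B where B: "\<And>x. norm (\<phi> x) \<le> B" using test_functions_bounded[OF \<phi>] by blast
  obtain B' where B': "\<And>x. norm (dir_deriv ?v \<phi> x) \<le> B'" using test_functions_bounded[OF d\<phi>] by blast
  have inner: "(LINT s|unit_interval_measure. dir_deriv ?v \<phi> (x + b *v (y + (s - y $ t) *\<^sub>R axis t 1)))
      = \<phi> (x + ?v + ?P y) - \<phi> (x + ?P y)" for y
  proof -
    \<comment> \<open>The term in \<open>y $ t\<close> is absorbed: the point lies at parameter
      \<open>s\<close> on the segment that starts at the projection \<open>?P y\<close>, translated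
      by \<open>x\<close>.\<close>
    have eq: "x + b *v (y + (s - y $ t) *\<^sub>R axis t 1) = (x + ?P y) + s *\<^sub>R ?v" for s
      by (simp add: algebra_simps matrix_vector_right_distrib matrix_vector_mult_diff_distrib
          matrix_vector_mult_scaleR)
    have "(LINT s|unit_interval_measure. dir_deriv ?v \<phi> ((x + ?P y) + s *\<^sub>R ?v))
        = \<phi> ((x + ?P y) + 1 *\<^sub>R ?v) - \<phi> ((x + ?P y) + 0 *\<^sub>R ?v)"
    proof (rule integral_unit_interval_FTC)
      fix s
      have lin: "((\<lambda>s. (x + ?P y) + s *\<^sub>R ?v) has_derivative (\<lambda>h. h *\<^sub>R ?v)) (at s)"
        by (auto intro!: derivative_eq_intros)
      have "(\<phi> has_derivative frechet_derivative \<phi> (at ((x + ?P y) + s *\<^sub>R ?v))) (at ((x + ?P y) + s *\<^sub>R ?v))"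
        using test_functions_differentiable[OF \<phi>] by (simp add: frechet_derivative_works)
      from diff_chain_at[OF lin this]
      have "((\<lambda>s. \<phi> ((x + ?P y) + s *\<^sub>R ?v)) has_derivative
          (\<lambda>h. frechet_derivative \<phi> (at ((x + ?P y) + s *\<^sub>R ?v)) (h *\<^sub>R ?v))) (at s)"
        by (simp add: o_def)
      then show "((\<lambda>s. \<phi> ((x + ?P y) + s *\<^sub>R ?v)) has_vector_derivative dir_deriv ?v \<phi> ((x + ?P y) + s *\<^sub>R ?v)) (at s)"
        using linear_frechet_derivative[OF test_functions_differentiable[OF \<phi>]]
        by (simp add: has_vector_derivative_def dir_deriv_def linear_scale)
    next
      show "continuous_on UNIV (\<lambda>s. dir_deriv ?v \<phi> ((x + ?P y) + s *\<^sub>R ?v))"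
        by (intro continuous_on_compose2[OF test_functions_continuous[OF d\<phi>, of UNIV]] continuous_intros) auto
    qed
    then show ?thesis unfolding eq by (simp add: algebra_simps)
  qed
  have "(LINT y|cell_measure b. dir_deriv ?v \<phi> (x + y)) = (LINT y|cube_measure. dir_deriv ?v \<phi> (x + b *v y))"
    unfolding cell_measure_def by (rule integral_distr) measurable
  also have "\<dots> = (LINT y|cube_measure. LINT s|unit_interval_measure. dir_deriv ?v \<phi> (x + b *v (y + (s - y $ t) *\<^sub>R axis t 1)))"
    by (rule integral_cube_slice[of _ B']) (measurable, rule B')
  also have "\<dots> = (LINT y|cube_measure. \<phi> (x + ?v + ?P y) - \<phi> (x + ?P y))"
    by (simp add: inner)
  also have "\<dots> = (LINT y|cube_measure. \<phi> (x + ?v + ?P y)) - (LINT y|cube_measure. \<phi> (x + ?P y))"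
    by (intro Bochner_Integration.integral_diff C.integrable_const_bound[of _ B]) (auto simp: B)
  also have "(LINT y|cube_measure. \<phi> (x + ?v + ?P y)) = (LINT y|face_measure b t. \<phi> (x + ?v + y))"
    unfolding face_measure_def by (rule integral_distr[symmetric]) measurable
  also have "(LINT y|cube_measure. \<phi> (x + ?P y)) = (LINT y|face_measure b t. \<phi> (x + y))"
    unfolding face_measure_def by (rule integral_distr[symmetric]) measurable
  finally show ?thesis .
qed

text \<open>The dual form of \<open>integral_cell_dir_deriv\<close>. Moving the face average of the
  translated test function back to \<open>f\<close> shifts by the opposite vector, and the sign in
  the weak derivative makes the result a backward difference.\<close>

lemma weak_dir_deriv_avg_cell:
  fixes b :: "real ^ 'n ^ 'n::finite"
  assumes p: "1 \<le> p" "borel_Lp p f"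
  shows "weak_dir_deriv (b *v axis t 1) (avg (cell_measure b) f)
    (\<lambda>x. avg (face_measure b t) f x - avg (face_measure b t) f (x - b *v axis t 1))"
  unfolding weak_dir_deriv_def
proof
  interpret C: borel_prob_space "cell_measure b" by (rule borel_prob_space_cell_measure)
  interpret F: borel_prob_space "face_measure b t" by (rule borel_prob_space_face_measure)
  let ?v = "b *v axis t 1"
  have [measurable]: "f \<in> borel_measurable borel" using p by (simp add: borel_Lp_def)
  fix \<phi> :: "real ^ 'n \<Rightarrow> complex" assume \<phi>: "\<phi> \<in> test_functions"
  note [measurable] = test_functions_borel[OF \<phi>]
  have \<phi>v: "(\<lambda>x. \<phi> (x + ?v)) \<in> test_functions" using \<phi> by (rule test_functions_translate)
  have cb: "compactly_bounded \<phi>" "compactly_bounded (\<lambda>x. \<phi> (x + ?v))" "compactly_bounded (dir_deriv ?v \<phi>)"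
    using \<phi> \<phi>v test_functions_dir_deriv by (auto intro: test_functions_compactly_bounded)
  have Ff: "borel_Lp p (avg (face_measure b t) f)" using p by (rule F.borel_Lp_avg)
  note [measurable] = borel_Lp_measurable[OF Ff]
  have int: "integrable lborel (\<lambda>x. f x * (LINT y|face_measure b t. \<phi> (x + ?v + y)))"
    "integrable lborel (\<lambda>x. f x * (LINT y|face_measure b t. \<phi> (x + y)))"
    using F.lborel_pair.integrable_fst[OF F.integrable_pair_avg(2)[OF p cb(2)]]
      F.lborel_pair.integrable_fst[OF F.integrable_pair_avg(2)[OF p cb(1)]]
    by (simp_all add: add.assoc add.commute[of ?v])
  have "(LINT x|lborel. avg (cell_measure b) f x * dir_deriv ?v \<phi> x)
      = (LINT x|lborel. f x * (LINT y|face_measure b t. \<phi> (x + ?v + y)) - f x * (LINT y|face_measure b t. \<phi> (x + y)))"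
    using p cb by (simp add: C.integral_avg_mult(2) integral_cell_dir_deriv[OF \<phi>] right_diff_distrib)
  also have "\<dots> = (LINT x|lborel. f x * (LINT y|face_measure b t. \<phi> (x + ?v + y))) - (LINT x|lborel. f x * (LINT y|face_measure b t. \<phi> (x + y)))"
    using int by simp
  also have "(LINT x|lborel. f x * (LINT y|face_measure b t. \<phi> (x + ?v + y))) = (LINT x|lborel. avg (face_measure b t) f x * \<phi> (x + ?v))"
    using F.integral_avg_mult(2)[OF p cb(2)] by (simp add: add.assoc add.commute[of ?v])
  also have "\<dots> = (LINT x|lborel. avg (face_measure b t) f (x - ?v) * \<phi> x)"
    using integral_lborel_translate[of "\<lambda>x. avg (face_measure b t) f (x - ?v) * \<phi> x" ?v] by simp
  also have "(LINT x|lborel. f x * (LINT y|face_measure b t. \<phi> (x + y))) = (LINT x|lborel. avg (face_measure b t) f x * \<phi> x)"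
    using F.integral_avg_mult(2)[OF p cb(1)] by simp
  also have "(LINT x|lborel. avg (face_measure b t) f (x - ?v) * \<phi> x) - (LINT x|lborel. avg (face_measure b t) f x * \<phi> x)
      = - (LINT x|lborel. (avg (face_measure b t) f x - avg (face_measure b t) f (x - ?v)) * \<phi> x)"
  proof -
    have "integrable lborel (\<lambda>x. avg (face_measure b t) f x * \<phi> x)"
      using p(1) Ff cb(1) by (rule compactly_bounded_integrable)
    moreover have "integrable lborel (\<lambda>x. avg (face_measure b t) f (x - ?v) * \<phi> x)"
    proof -
      \<comment> \<open>Translation commutes with the average, so the translated average is the
        average of a translated L^p function.\<close>
      have "borel_Lp p (avg (face_measure b t) (\<lambda>x. f (x - ?v)))"
        using p by (intro F.borel_Lp_avg borel_Lp_translate)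
      then show ?thesis
        using p(1) cb(1) by (simp add: F.avg_translate[abs_def] compactly_bounded_integrable)
    qed
    ultimately show ?thesis by (simp add: left_diff_distrib)
  qed
  finally show "(LINT x|lborel. avg (cell_measure b) f x * dir_deriv ?v \<phi> x)
      = - (LINT x|lborel. (avg (face_measure b t) f x - avg (face_measure b t) f (x - ?v)) * \<phi> x)" .
qed

section \<open>Directional Sobolev bounds\<close>

text \<open>\<open>dir_sobolev p n \<kappa> f\<close>: all weak directional derivatives of \<open>f\<close> along lists \<open>vs\<close> of at most \<open>n\<close>
  vectors exist, with \<open>L\<^sup>p\<close> norm at most \<open>\<kappa> vs\<close>. Since arbitrary directions are
  allowed, the notion transforms well under linear changes of variables.\<close>

fun dir_sobolev :: "ennreal \<Rightarrow> nat \<Rightarrow> ((real ^ 'n::finite) list \<Rightarrow> ennreal) \<Rightarrow> (real ^ 'n \<Rightarrow> complex) \<Rightarrow> bool" where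
  "dir_sobolev p 0 \<kappa> f \<longleftrightarrow> borel_Lp p f \<and> Lp_borel_norm p f \<le> \<kappa> []"
| "dir_sobolev p (Suc n) \<kappa> f \<longleftrightarrow> borel_Lp p f \<and> Lp_borel_norm p f \<le> \<kappa> [] \<and>
    (\<forall>v. \<exists>g. weak_dir_deriv v f g \<and> dir_sobolev p n (\<lambda>vs. \<kappa> (v # vs)) g)"

lemma dir_sobolevD:
  assumes "dir_sobolev p n \<kappa> f"
  shows "borel_Lp p f" "Lp_borel_norm p f \<le> \<kappa> []"
  using assms by (cases n; simp)+

section \<open>Stability of directional bounds under linear combinations and averages\<close>

lemma weak_dir_deriv_cong_AE:
  assumes fg: "weak_dir_deriv v f g"
    and [measurable]: "f \<in> borel_measurable borel" "f' \<in> borel_measurable borel"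
      "g \<in> borel_measurable borel" "g' \<in> borel_measurable borel"
    and f: "AE x in lborel. f x = f' x" and g: "AE x in lborel. g x = g' x"
  shows "weak_dir_deriv v f' g'"
  unfolding weak_dir_deriv_def
proof
  fix \<phi> :: "real ^ 'a \<Rightarrow> complex" assume \<phi>: "\<phi> \<in> test_functions"
  note [measurable] = test_functions_borel[OF \<phi>] test_functions_borel[OF test_functions_dir_deriv[OF \<phi>]]
  have "(LINT x|lborel. f' x * dir_deriv v \<phi> x) = (LINT x|lborel. f x * dir_deriv v \<phi> x)"
    using f by (intro integral_cong_AE) auto
  moreover have "(LINT x|lborel. g' x * \<phi> x) = (LINT x|lborel. g x * \<phi> x)"
    using g by (intro integral_cong_AE) auto
  ultimately show "(LINT x|lborel. f' x * dir_deriv v \<phi> x) = - (LINT x|lborel. g' x * \<phi> x)"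
    using fg \<phi> by (simp add: weak_dir_deriv_def)
qed

lemma borel_Lp_cong_AE:
  assumes "1 \<le> p" "borel_Lp p f" "f' \<in> borel_measurable borel" "AE x in lborel. f x = f' x"
  shows "borel_Lp p f'" "Lp_borel_norm p f' = Lp_borel_norm p f"
proof -
  have [measurable]: "f \<in> borel_measurable borel" using assms by (simp add: borel_Lp_def)
  show "Lp_borel_norm p f' = Lp_borel_norm p f"
    using assms by (intro Lp_enorm_cong_AE) auto
  then show "borel_Lp p f'" using assms by (simp add: borel_Lp_def)
qed

lemma weak_dir_deriv_cmult:
  assumes "weak_dir_deriv v f g"
  shows "weak_dir_deriv v (\<lambda>x. z * f x) (\<lambda>x. z * g x)"
  using assms by (simp add: weak_dir_deriv_def mult.assoc)

lemma weak_dir_deriv_add: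
  assumes "1 \<le> p" "borel_Lp p f" "borel_Lp p f'" "borel_Lp p g" "borel_Lp p g'"
    and "weak_dir_deriv v f g" "weak_dir_deriv v f' g'"
  shows "weak_dir_deriv v (\<lambda>x. f x + f' x) (\<lambda>x. g x + g' x)"
  unfolding weak_dir_deriv_def
proof
  fix \<phi> :: "real ^ 'a \<Rightarrow> complex" assume \<phi>: "\<phi> \<in> test_functions"
  have cb: "compactly_bounded \<phi>" "compactly_bounded (dir_deriv v \<phi>)"
    using \<phi> test_functions_dir_deriv by (auto intro: test_functions_compactly_bounded)
  show "(LINT x|lborel. (f x + f' x) * dir_deriv v \<phi> x) = - (LINT x|lborel. (g x + g' x) * \<phi> x)"
    using assms cb \<phi> by (simp add: distrib_right compactly_bounded_integrable weak_dir_deriv_def)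
qed

lemma dir_sobolev_zero:
  assumes p: "1 \<le> p"
  shows "dir_sobolev p n (\<lambda>vs. 0) (\<lambda>x. 0)"
proof (induction n)
  case (Suc n)
  have "weak_dir_deriv v (\<lambda>x. 0) (\<lambda>x. 0)" for v :: "real ^ 'a"
    by (simp add: weak_dir_deriv_def)
  with Suc show ?case
    using p by (simp add: borel_Lp_zero Lp_enorm_zero) blast
qed (simp add: p borel_Lp_zero Lp_enorm_zero)

lemma dir_sobolev_cmult:
  assumes p: "1 \<le> p"
  shows "dir_sobolev p n \<kappa> f \<Longrightarrow> dir_sobolev p n (\<lambda>vs. ennreal (norm z) * \<kappa> vs) (\<lambda>x. z * f x)"
proof (induction n arbitrary: \<kappa> f)
  case 0
  then show ?case
    using p order_trans[OF Lp_borel_norm_cmult_le[OF p, of f z] mult_left_mono]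
    by (auto simp: borel_Lp_cmult borel_Lp_measurable)
next
  case (Suc n)
  have Lp: "borel_Lp p f" "Lp_borel_norm p f \<le> \<kappa> []" using Suc.prems by auto
  show ?case unfolding dir_sobolev.simps
  proof (intro conjI allI)
    show "borel_Lp p (\<lambda>x. z * f x)" using p Lp(1) by (rule borel_Lp_cmult)
    show "Lp_borel_norm p (\<lambda>x. z * f x) \<le> ennreal (norm z) * \<kappa> []"
      by (rule order_trans[OF Lp_borel_norm_cmult_le[OF p borel_Lp_measurable[OF Lp(1)], of z] mult_left_mono[OF Lp(2)]]) simp
    fix v
    obtain g where "weak_dir_deriv v f g" "dir_sobolev p n (\<lambda>vs. \<kappa> (v # vs)) g"
      using Suc.prems by auto
    then show "\<exists>g. weak_dir_deriv v (\<lambda>x. z * f x) g \<and> dir_sobolev p n (\<lambda>vs. ennreal (norm z) * \<kappa> (v # vs)) g"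
      using Suc.IH weak_dir_deriv_cmult by blast
  qed
qed

lemma dir_sobolev_add:
  assumes p: "1 \<le> p"
  shows "dir_sobolev p n \<kappa> f \<Longrightarrow> dir_sobolev p n \<kappa>' f' \<Longrightarrow> dir_sobolev p n (\<lambda>vs. \<kappa> vs + \<kappa>' vs) (\<lambda>x. f x + f' x)"
proof (induction n arbitrary: \<kappa> \<kappa>' f f')
  case 0
  then show ?case
    using p Lp_borel_norm_add_le[OF p, of f f']
    by (auto simp: borel_Lp_add borel_Lp_measurable intro: order_trans add_mono)
next
  case (Suc n)
  have Lp: "borel_Lp p f" "Lp_borel_norm p f \<le> \<kappa> []" "borel_Lp p f'" "Lp_borel_norm p f' \<le> \<kappa>' []"
    using Suc.prems by auto
  show ?case unfolding dir_sobolev.simps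
  proof (intro conjI allI)
    show "borel_Lp p (\<lambda>x. f x + f' x)" using p Lp(1,3) by (rule borel_Lp_add)
    show "Lp_borel_norm p (\<lambda>x. f x + f' x) \<le> \<kappa> [] + \<kappa>' []"
      using Lp_borel_norm_add_le[OF p borel_Lp_measurable[OF Lp(1)] borel_Lp_measurable[OF Lp(3)]] Lp(2,4)
      by (auto intro: order_trans add_mono)
    fix v
    obtain g where g: "weak_dir_deriv v f g" "dir_sobolev p n (\<lambda>vs. \<kappa> (v # vs)) g"
      using Suc.prems by auto
    obtain g' where g': "weak_dir_deriv v f' g'" "dir_sobolev p n (\<lambda>vs. \<kappa>' (v # vs)) g'"
      using Suc.prems by auto
    have "weak_dir_deriv v (\<lambda>x. f x + f' x) (\<lambda>x. g x + g' x)"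
      using p Lp(1,3) dir_sobolevD(1)[OF g(2)] dir_sobolevD(1)[OF g'(2)] g(1) g'(1)
      by (rule weak_dir_deriv_add)
    then show "\<exists>g. weak_dir_deriv v (\<lambda>x. f x + f' x) g \<and> dir_sobolev p n (\<lambda>vs. \<kappa> (v # vs) + \<kappa>' (v # vs)) g"
      using Suc.IH[OF g(2) g'(2)] by blast
  qed
qed

lemma dir_sobolev_sum:
  assumes "1 \<le> p" "\<And>i. i \<in> I \<Longrightarrow> dir_sobolev p n (\<kappa> i) (f i)"
  shows "dir_sobolev p n (\<lambda>vs. \<Sum>i\<in>I. \<kappa> i vs) (\<lambda>x. \<Sum>i\<in>I. f i x)"
  using assms(2)
  by (induction I rule: infinite_finite_induct) (auto simp: dir_sobolev_zero dir_sobolev_add assms(1))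

text \<open>Averages commute with weak derivatives and do not increase norms, so the bounds survive
  unchanged.\<close>

lemma dir_sobolev_avg:
  assumes p: "1 \<le> p" and \<mu>: "borel_prob_space \<mu>"
  shows "dir_sobolev p n \<kappa> f \<Longrightarrow> dir_sobolev p n \<kappa> (avg \<mu> f)"
proof (induction n arbitrary: \<kappa> f)
  case 0
  interpret borel_prob_space \<mu> by (rule \<mu>)
  from 0 show ?case
    using p Lp_borel_norm_avg_le[OF p, of f]
    by (auto simp: borel_Lp_avg borel_Lp_measurable intro: order_trans)
next
  case (Suc n)
  interpret borel_prob_space \<mu> by (rule \<mu>)
  have Lp: "borel_Lp p f" "Lp_borel_norm p f \<le> \<kappa> []" using Suc.prems by auto
  show ?case unfolding dir_sobolev.simps
  proof (intro conjI allI)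
    show "borel_Lp p (avg \<mu> f)" using p Lp(1) by (rule borel_Lp_avg)
    show "Lp_borel_norm p (avg \<mu> f) \<le> \<kappa> []"
      using Lp_borel_norm_avg_le[OF p borel_Lp_measurable[OF Lp(1)]] Lp(2) by (rule order_trans)
    fix v
    obtain g where g: "weak_dir_deriv v f g" "dir_sobolev p n (\<lambda>vs. \<kappa> (v # vs)) g"
      using Suc.prems by auto
    have "weak_dir_deriv v (avg \<mu> f) (avg \<mu> g)"
      using \<mu> p Lp(1) dir_sobolevD(1)[OF g(2)] g(1) by (rule weak_dir_deriv_avg)
    then show "\<exists>g. weak_dir_deriv v (avg \<mu> f) g \<and> dir_sobolev p n (\<lambda>vs. \<kappa> (v # vs)) g"
      using Suc.IH[OF g(2)] by blast
  qed
qed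

section \<open>Directional bounds under linear changes of variables\<close>

lemma lborel_eq_density_matrix:
  fixes A :: "real ^ 'n::finite ^ 'n"
  assumes "invertible A"
  shows "lborel = density (distr lborel borel ((*v) A)) (\<lambda>_. ennreal \<bar>det A\<bar>)"
proof (rule measure_eqI)
  fix X :: "(real ^ 'n) set" assume "X \<in> sets lborel"
  then have [measurable]: "X \<in> sets borel" by simp
  have "emeasure lborel X = (\<integral>\<^sup>+x. indicator X x \<partial>lborel)" by simp
  also have "\<dots> = ennreal \<bar>det A\<bar> * (\<integral>\<^sup>+x. indicator X (A *v x) \<partial>lborel)"
    by (rule nn_integral_matrix[OF assms]) simp
  also have "\<dots> = emeasure (density (distr lborel borel ((*v) A)) (\<lambda>_. ennreal \<bar>det A\<bar>)) X"
    by (simp add: emeasure_density nn_integral_cmult nn_integral_distr del: nn_integral_indicator)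
  finally show "emeasure lborel X = emeasure (density (distr lborel borel ((*v) A)) (\<lambda>_. ennreal \<bar>det A\<bar>)) X" .
qed simp

lemma integral_lborel_matrix:
  fixes A :: "real ^ 'n::finite ^ 'n" and f :: "real ^ 'n \<Rightarrow> complex"
  assumes "invertible A" and [measurable]: "f \<in> borel_measurable borel"
  shows "(LINT x|lborel. f x) = \<bar>det A\<bar> * (LINT x|lborel. f (A *v x))"
proof -
  have "(LINT x|lborel. f x) = (LINT x|density (distr lborel borel ((*v) A)) (\<lambda>_. ennreal \<bar>det A\<bar>). f x)"
    using lborel_eq_density_matrix[OF assms(1)] by simp
  also have "\<dots> = (LINT x|lborel. \<bar>det A\<bar> *\<^sub>R f (A *v x))"
    by (subst integral_density) (simp_all add: integral_distr)
  finally show ?thesis by (simp add: scaleR_conv_of_real)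
qed

lemma AE_lborel_matrix:
  fixes A :: "real ^ 'n::finite ^ 'n"
  assumes A: "invertible A" and P: "AE x in lborel. P x"
  shows "AE x in lborel. P (A *v x)"
proof -
  obtain N where N: "N \<in> null_sets lborel" "{x. \<not> P x} \<subseteq> N"
    using P by (auto simp: eventually_ae_filter)
  then have [measurable]: "N \<in> sets borel" by auto
  have "ennreal \<bar>det A\<bar> * (\<integral>\<^sup>+x. indicator N (A *v x) \<partial>lborel) = 0"
    using nn_integral_matrix[OF A, of "indicator N"] null_setsD1[OF N(1)] by simp
  then have "(\<integral>\<^sup>+x. indicator N (A *v x) \<partial>lborel) = 0"
    using A by (simp add: invertible_det_nz)
  then have "AE x in lborel. indicator N (A *v x) = (0 :: ennreal)"
    by (subst (asm) nn_integral_0_iff_AE) auto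
  then show ?thesis
    by eventually_elim (use N in \<open>auto simp: indicator_def split: if_splits\<close>)
qed

lemma Lp_enorm_matrix_le:
  fixes A :: "real ^ 'n::finite ^ 'n"
  assumes p: "1 \<le> p" and A: "invertible A" and [measurable]: "g \<in> borel_measurable borel"
  shows "Lp_enorm p lborel (\<lambda>x. g (A *v x)) \<le> ennreal (\<bar>det A\<bar> powr - inv_exponent p) * Lp_enorm p lborel g"
  using p
proof (cases rule: exponent_cases)
  case infinite
  have "AE x in lborel. g (A *v x) \<le> esssup lborel g"
    by (intro AE_lborel_matrix A esssup_AE)
  \<comment> \<open>The exponent is 0 here, and the factor is 1 because the determinant is
    nonzero.\<close>
  then show ?thesis using A by (auto simp: infinite Lp_enorm_infinity invertible_det_nz)
next
  case (finite q)
  have d: "\<bar>det A\<bar> > 0" using A by (simp add: invertible_det_nz)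
  have "(\<integral>\<^sup>+x. epowr (g (A *v x)) q \<partial>lborel) = ennreal (1 / \<bar>det A\<bar>) * (ennreal \<bar>det A\<bar> * (\<integral>\<^sup>+x. epowr (g (A *v x)) q \<partial>lborel))"
    using d by (simp add: mult.assoc[symmetric] ennreal_mult[symmetric])
  also have "\<dots> = ennreal (1 / \<bar>det A\<bar>) * (\<integral>\<^sup>+x. epowr (g x) q \<partial>lborel)"
    using nn_integral_matrix[OF A, of "\<lambda>x. epowr (g x) q"] by simp
  also have "\<dots> = epowr (ennreal (\<bar>det A\<bar> powr - inv_exponent p) * Lp_enorm p lborel g) q"
    using finite d
    by (simp add: epowr_mult epowr_Lp_enorm epowr_ennreal powr_powr powr_divide inv_exponent_ennreal powr_minus_divide)
  finally show ?thesis using finite by (auto intro: Lp_enorm_leI)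
qed

text \<open>Tested with \<open>\<phi>\<close> composed with the inverse matrix, whose derivative
  along \<open>A *v v\<close> at \<open>A *v x\<close> is the derivative of \<open>\<phi>\<close>
  along \<open>v\<close> at \<open>x\<close>. The determinants from the two substitutions agree and
  cancel.\<close>

lemma weak_dir_deriv_matrix:
  fixes A :: "real ^ 'n::finite ^ 'n"
  assumes A: "invertible A" and [measurable]: "f \<in> borel_measurable borel" "g \<in> borel_measurable borel"
    and fg: "weak_dir_deriv (A *v v) f g"
  shows "weak_dir_deriv v (\<lambda>x. f (A *v x)) (\<lambda>x. g (A *v x))"
  unfolding weak_dir_deriv_def
proof
  fix \<phi> :: "real ^ 'n \<Rightarrow> complex" assume \<phi>: "\<phi> \<in> test_functions"
  let ?B = "matrix_inv A"
  have invB: "invertible ?B"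
    using matrix_inv_mult[OF A] unfolding invertible_def by blast
  define \<theta> where "\<theta> x = \<phi> (?B *v x + 0)" for x
  have \<theta>: "\<theta> \<in> test_functions"
    unfolding \<theta>_def[abs_def] using \<phi> invB by (rule test_functions_compose_affine)
  note [measurable] = test_functions_borel[OF \<theta>] test_functions_borel[OF test_functions_dir_deriv[OF \<theta>]]
  have d: "dir_deriv (A *v v) \<theta> (A *v x) = dir_deriv v \<phi> x" for x
    using dir_deriv_compose_affine[OF test_functions_differentiable[OF \<phi>], where A = ?B and x = "A *v x" and y = 0 and v = "A *v v"] A
    by (simp add: \<theta>_def[abs_def] matrix_inv_mult_vec)
  have "(LINT x|lborel. f x * dir_deriv (A *v v) \<theta> x) = \<bar>det A\<bar> * (LINT x|lborel. f (A *v x) * dir_deriv v \<phi> x)"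
    using integral_lborel_matrix[OF A, of "\<lambda>x. f x * dir_deriv (A *v v) \<theta> x"] by (simp add: d)
  moreover have "(LINT x|lborel. g x * \<theta> x) = \<bar>det A\<bar> * (LINT x|lborel. g (A *v x) * \<phi> x)"
  proof -
    have "(\<lambda>x. g x * \<theta> x) \<in> borel_measurable borel" by measurable
    from integral_lborel_matrix[OF A this] show ?thesis
      using A by (simp add: \<theta>_def matrix_inv_mult_vec)
  qed
  ultimately show "(LINT x|lborel. f (A *v x) * dir_deriv v \<phi> x) = - (LINT x|lborel. g (A *v x) * \<phi> x)"
    using fg \<theta> A unfolding weak_dir_deriv_def
    by (metis (no_types, lifting) invertible_det_nz abs_eq_0 mult_left_cancel mult_minus_right of_real_eq_0_iff)
qed

text \<open>Each derivative along \<open>v\<close> becomes one along \<open>A *v v\<close>, hence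
  the mapped list; the substitution itself contributes |det A|^(-1/p).\<close>

lemma dir_sobolev_matrix:
  fixes A :: "real ^ 'n::finite ^ 'n"
  assumes p: "1 \<le> p" and A: "invertible A"
  shows "dir_sobolev p n \<kappa> f \<Longrightarrow>
    dir_sobolev p n (\<lambda>vs. ennreal (\<bar>det A\<bar> powr - inv_exponent p) * \<kappa> (map ((*v) A) vs)) (\<lambda>x. f (A *v x))"
proof -
  have Lp: "borel_Lp p (\<lambda>x. f (A *v x)) \<and> Lp_borel_norm p (\<lambda>x. f (A *v x)) \<le> ennreal (\<bar>det A\<bar> powr - inv_exponent p) * K"
    if f: "borel_Lp p f" "Lp_borel_norm p f \<le> K" for f :: "real ^ 'n \<Rightarrow> complex" and K
  proof -
    have [measurable]: "f \<in> borel_measurable borel" using f by (simp add: borel_Lp_def)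
    have le: "Lp_borel_norm p (\<lambda>x. f (A *v x)) \<le> ennreal (\<bar>det A\<bar> powr - inv_exponent p) * Lp_borel_norm p f"
      using Lp_enorm_matrix_le[OF p A, of "\<lambda>x. ennreal (norm (f x))"] by simp
    also have "\<dots> < \<infinity>" using f(1) by (simp add: borel_Lp_def ennreal_mult_less_top)
    finally show ?thesis
      using order_trans[OF le mult_left_mono[OF f(2)]] by (simp add: borel_Lp_def)
  qed
  show "dir_sobolev p n \<kappa> f \<Longrightarrow>
    dir_sobolev p n (\<lambda>vs. ennreal (\<bar>det A\<bar> powr - inv_exponent p) * \<kappa> (map ((*v) A) vs)) (\<lambda>x. f (A *v x))"
  proof (induction n arbitrary: \<kappa> f)
  case 0
  then show ?case using Lp[of f "\<kappa> []"] by simp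
  next
  case (Suc n)
  show ?case unfolding dir_sobolev.simps
  proof (intro conjI allI)
    show "borel_Lp p (\<lambda>x. f (A *v x))"
      "Lp_borel_norm p (\<lambda>x. f (A *v x)) \<le> ennreal (\<bar>det A\<bar> powr - inv_exponent p) * \<kappa> (map ((*v) A) [])"
      using Lp[of f "\<kappa> []"] Suc.prems by auto
    fix v
    obtain g where g: "weak_dir_deriv (A *v v) f g" "dir_sobolev p n (\<lambda>vs. \<kappa> (A *v v # vs)) g"
      using Suc.prems by auto
    have "weak_dir_deriv v (\<lambda>x. f (A *v x)) (\<lambda>x. g (A *v x))"
      using A _ _ g(1) by (rule weak_dir_deriv_matrix)
        (use dir_sobolevD(1)[OF g(2)] Suc.prems in \<open>auto simp: borel_Lp_def\<close>)
    moreover have "dir_sobolev p n (\<lambda>vs. ennreal (\<bar>det A\<bar> powr - inv_exponent p) * \<kappa> (map ((*v) A) (v # vs))) (\<lambda>x. g (A *v x))"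
      using Suc.IH[OF g(2)] by simp
    ultimately show "\<exists>g. weak_dir_deriv v (\<lambda>x. f (A *v x)) g \<and>
        dir_sobolev p n (\<lambda>vs. ennreal (\<bar>det A\<bar> powr - inv_exponent p) * \<kappa> (map ((*v) A) (v # vs))) g"
      by blast
  qed
  qed
qed

section \<open>Directional bounds for series\<close>

lemma Lp_enorm_suminf_finite:
  fixes f :: "nat \<Rightarrow> 'a::euclidean_space \<Rightarrow> complex"
  assumes p: "1 \<le> p" and [measurable]: "\<And>j. f j \<in> borel_measurable borel"
    and fin: "(\<Sum>j. Lp_borel_norm p (f j)) < \<infinity>"
  shows "Lp_enorm p lborel (\<lambda>x. \<Sum>j. ennreal (norm (f j x))) < \<infinity>"
  by (rule le_less_trans[OF Lp_enorm_suminf_le[OF p] fin]) measurable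

lemma AE_summable_of_Lp:
  fixes f :: "nat \<Rightarrow> 'a::euclidean_space \<Rightarrow> complex"
  assumes p: "1 \<le> p" and [measurable]: "\<And>j. f j \<in> borel_measurable borel"
    and fin: "(\<Sum>j. Lp_borel_norm p (f j)) < \<infinity>"
  shows "AE x in lborel. summable (\<lambda>j. norm (f j x))"
proof -
  have "AE x in lborel. (\<Sum>j. ennreal (norm (f j x))) < top"
    using Lp_enorm_suminf_finite[OF assms] by (intro Lp_enorm_less_top_AE[OF p]) auto
  then show ?thesis
    by eventually_elim (auto intro!: summable_suminf_not_top)
qed

lemma borel_Lp_suminf:
  fixes f :: "nat \<Rightarrow> 'a::euclidean_space \<Rightarrow> complex"
  assumes p: "1 \<le> p" and [measurable]: "\<And>j. f j \<in> borel_measurable borel"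
    and fin: "(\<Sum>j. Lp_borel_norm p (f j)) < \<infinity>"
  shows "borel_Lp p (\<lambda>x. \<Sum>j. f j x)" "Lp_borel_norm p (\<lambda>x. \<Sum>j. f j x) \<le> (\<Sum>j. Lp_borel_norm p (f j))"
proof -
  have "AE x in lborel. ennreal (norm (\<Sum>j. f j x)) \<le> (\<Sum>j. ennreal (norm (f j x)))"
    using AE_summable_of_Lp[OF assms]
  proof eventually_elim
    case (elim x)
    then have "ennreal (norm (\<Sum>j. f j x)) \<le> ennreal (\<Sum>j. norm (f j x))"
      by (intro ennreal_leI summable_norm)
    then show ?case using elim by (simp add: suminf_ennreal2)
  qed
  then have "Lp_borel_norm p (\<lambda>x. \<Sum>j. f j x) \<le> Lp_enorm p lborel (\<lambda>x. \<Sum>j. ennreal (norm (f j x)))"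
    using p by (intro Lp_enorm_mono_AE) auto
  also have "\<dots> \<le> (\<Sum>j. Lp_borel_norm p (f j))"
    using p by (intro Lp_enorm_suminf_le) auto
  finally show le: "Lp_borel_norm p (\<lambda>x. \<Sum>j. f j x) \<le> (\<Sum>j. Lp_borel_norm p (f j))" .
  show "borel_Lp p (\<lambda>x. \<Sum>j. f j x)"
    using le_less_trans[OF le fin] by (simp add: borel_Lp_def)
qed

text \<open>The sum of the |f_j| has finite L^p norm by Minkowski's inequality, so its product with
  |w| is integrable and dominates all partial sums.\<close>

lemma integral_suminf_mult:
  fixes f :: "nat \<Rightarrow> 'a::euclidean_space \<Rightarrow> complex"
  assumes p: "1 \<le> p" and f: "\<And>j. borel_Lp p (f j)"
    and fin: "(\<Sum>j. Lp_borel_norm p (f j)) < \<infinity>" and w: "compactly_bounded w"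
  shows "(LINT x|lborel. (\<Sum>j. f j x) * w x) = (\<Sum>j. LINT x|lborel. f j x * w x)"
    and "summable (\<lambda>j. LINT x|lborel. f j x * w x)"
proof -
  have [measurable]: "f j \<in> borel_measurable borel" "w \<in> borel_measurable borel" for j
    using f w by (auto simp: borel_Lp_def compactly_bounded_def)
  have int: "integrable lborel (\<lambda>x. f j x * w x)" for j
    using p f w by (rule compactly_bounded_integrable)
  have AE: "AE x in lborel. summable (\<lambda>j. norm (f j x))"
    using p _ fin by (rule AE_summable_of_Lp) simp
  have "(\<integral>\<^sup>+x. (\<Sum>j. ennreal (norm (f j x))) * ennreal (norm (w x)) \<partial>lborel) < \<infinity>"
    by (rule compactly_bounded_nn_integral[OF p _ Lp_enorm_suminf_finite[OF p _ fin] w]) measurable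
  also have "(\<integral>\<^sup>+x. (\<Sum>j. ennreal (norm (f j x))) * ennreal (norm (w x)) \<partial>lborel)
      = (\<Sum>j. \<integral>\<^sup>+x. ennreal (norm (f j x * w x)) \<partial>lborel)"
    by (subst nn_integral_suminf[symmetric]) (auto simp: norm_mult ennreal_mult)
  also have "\<dots> = (\<Sum>j. ennreal (LINT x|lborel. norm (f j x * w x)))"
    by (intro suminf_cong nn_integral_eq_integral integrable_norm int) auto
  finally have sum: "summable (\<lambda>j. LINT x|lborel. norm (f j x * w x))"
    by (intro summable_suminf_not_top) auto
  have "(LINT x|lborel. (\<Sum>j. f j x) * w x) = (LINT x|lborel. (\<Sum>j. f j x * w x))"
    using AE by (intro integral_cong_AE) (auto elim!: eventually_mono intro!: suminf_mult2 summable_norm_cancel)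
  also have "\<dots> = (\<Sum>j. LINT x|lborel. f j x * w x)"
    using AE by (intro integral_suminf int sum) (auto elim!: eventually_mono simp: norm_mult intro: summable_mult2)
  finally show "(LINT x|lborel. (\<Sum>j. f j x) * w x) = (\<Sum>j. LINT x|lborel. f j x * w x)" .
  show "summable (\<lambda>j. LINT x|lborel. f j x * w x)"
    by (rule summable_comparison_test[OF _ sum]) (auto intro: integral_norm_bound)
qed

text \<open>A weak derivative is an identity between integrals, and these may be summed termwise.
  Derivatives of the summands are chosen for all \<open>j\<close> at once; the bounds for lists
  beginning with \<open>v\<close> make them summable again.\<close>

lemma dir_sobolev_suminf:
  fixes f :: "nat \<Rightarrow> real ^ 'n::finite \<Rightarrow> complex"
  assumes p: "1 \<le> p"
  shows "(\<And>j. dir_sobolev p n (\<kappa> j) (f j)) \<Longrightarrow> (\<And>vs. length vs \<le> n \<Longrightarrow> (\<Sum>j. \<kappa> j vs) < \<infinity>) \<Longrightarrow>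
    dir_sobolev p n (\<lambda>vs. \<Sum>j. \<kappa> j vs) (\<lambda>x. \<Sum>j. f j x)"
proof -
  have Lp: "borel_Lp p (\<lambda>x. \<Sum>j. f j x)" "Lp_borel_norm p (\<lambda>x. \<Sum>j. f j x) \<le> (\<Sum>j. K j)" "(\<Sum>j. Lp_borel_norm p (f j)) < \<infinity>"
    if f: "\<And>j. borel_Lp p (f j)" "\<And>j. Lp_borel_norm p (f j) \<le> K j" and K: "(\<Sum>j. K j) < \<infinity>"
    for f :: "nat \<Rightarrow> real ^ 'n \<Rightarrow> complex" and K :: "nat \<Rightarrow> ennreal"
  proof -
    have le: "(\<Sum>j. Lp_borel_norm p (f j)) \<le> (\<Sum>j. K j)" using f(2) by (intro suminf_le) auto
    show fin: "(\<Sum>j. Lp_borel_norm p (f j)) < \<infinity>" using le K by (rule le_less_trans)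
    have [measurable]: "f j \<in> borel_measurable borel" for j using f by (auto simp: borel_Lp_def)
    show "borel_Lp p (\<lambda>x. \<Sum>j. f j x)" "Lp_borel_norm p (\<lambda>x. \<Sum>j. f j x) \<le> (\<Sum>j. K j)"
      using borel_Lp_suminf[OF p _ fin] le by auto
  qed
  show "(\<And>j. dir_sobolev p n (\<kappa> j) (f j)) \<Longrightarrow> (\<And>vs. length vs \<le> n \<Longrightarrow> (\<Sum>j. \<kappa> j vs) < \<infinity>) \<Longrightarrow>
    dir_sobolev p n (\<lambda>vs. \<Sum>j. \<kappa> j vs) (\<lambda>x. \<Sum>j. f j x)"
  proof (induction n arbitrary: \<kappa> f)
  case 0
  then show ?case using Lp[of f "\<lambda>j. \<kappa> j []"] by simp
  next
  case (Suc n)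
  have f: "borel_Lp p (f j)" "Lp_borel_norm p (f j) \<le> \<kappa> j []" for j using Suc.prems(1)[of j] by auto
  have K: "(\<Sum>j. \<kappa> j []) < \<infinity>" using Suc.prems(2) by auto
  show ?case unfolding dir_sobolev.simps
  proof (intro conjI allI)
    show "borel_Lp p (\<lambda>x. \<Sum>j. f j x)" "Lp_borel_norm p (\<lambda>x. \<Sum>j. f j x) \<le> (\<Sum>j. \<kappa> j [])"
      using Lp[OF f K] by auto
    fix v
    have "\<exists>g. \<forall>j. weak_dir_deriv v (f j) (g j) \<and> dir_sobolev p n (\<lambda>vs. \<kappa> j (v # vs)) (g j)"
      using Suc.prems(1) by (intro choice) auto
    then obtain g where g: "\<And>j. weak_dir_deriv v (f j) (g j)" "\<And>j. dir_sobolev p n (\<lambda>vs. \<kappa> j (v # vs)) (g j)"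
      by blast
    have gL: "borel_Lp p (g j)" "Lp_borel_norm p (g j) \<le> \<kappa> j [v]" for j
      using dir_sobolevD[OF g(2)] by auto
    have Kv: "(\<Sum>j. \<kappa> j [v]) < \<infinity>"
    proof (cases n)
      case 0 with Suc.prems(2)[of "[v]"] show ?thesis by simp
    next
      case (Suc k) with Suc.prems(2)[of "[v]"] show ?thesis by simp
    qed
    have "weak_dir_deriv v (\<lambda>x. \<Sum>j. f j x) (\<lambda>x. \<Sum>j. g j x)"
      unfolding weak_dir_deriv_def
    proof
      fix \<phi> :: "real ^ 'n \<Rightarrow> complex" assume \<phi>: "\<phi> \<in> test_functions"
      have cb: "compactly_bounded \<phi>" "compactly_bounded (dir_deriv v \<phi>)"
        using \<phi> test_functions_dir_deriv by (auto intro: test_functions_compactly_bounded)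
      have "(LINT x|lborel. (\<Sum>j. f j x) * dir_deriv v \<phi> x) = (\<Sum>j. LINT x|lborel. f j x * dir_deriv v \<phi> x)"
        by (rule integral_suminf_mult(1)[OF p f(1) Lp(3)[OF f K] cb(2)])
      also have "\<dots> = (\<Sum>j. - (LINT x|lborel. g j x * \<phi> x))"
        using g(1) \<phi> by (simp add: weak_dir_deriv_def)
      also have "\<dots> = - (\<Sum>j. (LINT x|lborel. g j x * \<phi> x))"
        by (rule suminf_minus[OF integral_suminf_mult(2)[OF p gL(1) Lp(3)[OF gL Kv] cb(1)]])
      also have "(\<Sum>j. (LINT x|lborel. g j x * \<phi> x)) = (LINT x|lborel. (\<Sum>j. g j x) * \<phi> x)"
        by (rule integral_suminf_mult(1)[OF p gL(1) Lp(3)[OF gL Kv] cb(1), symmetric])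
      finally show "(LINT x|lborel. (\<Sum>j. f j x) * dir_deriv v \<phi> x) = - (LINT x|lborel. (\<Sum>j. g j x) * \<phi> x)" .
    qed
    moreover have "dir_sobolev p n (\<lambda>vs. \<Sum>j. \<kappa> j (v # vs)) (\<lambda>x. \<Sum>j. g j x)"
      by (rule Suc.IH[OF g(2)]) (rule Suc.prems(2), simp)
    ultimately show "\<exists>g. weak_dir_deriv v (\<lambda>x. \<Sum>j. f j x) g \<and> dir_sobolev p n (\<lambda>vs. \<Sum>j. \<kappa> j (v # vs)) g"
      by blast
  qed
  qed
qed

section \<open>Lattice differences of functions and iterated cell averages\<close>

definition cell_diff :: "real ^ 'n ^ 'n::finite \<Rightarrow> 'n \<Rightarrow> (real ^ 'n \<Rightarrow> complex) \<Rightarrow> real ^ 'n \<Rightarrow> complex"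
  where "cell_diff b t f = (\<lambda>x. f x - f (x - b *v axis t 1))"

text \<open>The derivative bounds of a cell average: each derivative along a vector \<open>v\<close> with coordinates
  \<open>b\<inverse> v\<close> in the lattice basis turns into a combination of lattice differences.\<close>

fun cell_bound :: "ennreal \<Rightarrow> real ^ 'n ^ 'n::finite \<Rightarrow> (real ^ 'n \<Rightarrow> complex) \<Rightarrow> (real ^ 'n) list \<Rightarrow> ennreal" where
  "cell_bound p b f [] = Lp_borel_norm p f"
| "cell_bound p b f (v # vs) =
    (\<Sum>t\<in>UNIV. ennreal \<bar>(matrix_inv b *v v) $ t\<bar> * cell_bound p b (cell_diff b t f) vs)"

lemma borel_Lp_cell_diff: "1 \<le> p \<Longrightarrow> borel_Lp p f \<Longrightarrow> borel_Lp p (cell_diff b t f)"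
  unfolding cell_diff_def by (intro borel_Lp_diff borel_Lp_translate)

lemma cell_diff_measurable [measurable]:
  assumes [measurable]: "f \<in> borel_measurable borel"
  shows "cell_diff b t f \<in> borel_measurable borel"
proof -
  have "(\<lambda>x. f x - f (x - v)) \<in> borel_measurable borel" for v by measurable
  then show ?thesis by (simp add: cell_diff_def)
qed

lemma cell_diff_cong_AE:
  assumes "AE x in lborel. f x = g x"
  shows "AE x in lborel. cell_diff b t f x = cell_diff b t g x"
  using assms AE_lborel_translate[OF assms, of "- (b *v axis t 1)"]
  by eventually_elim (simp add: cell_diff_def)

lemma avg_cell_diff:
  assumes "borel_prob_space \<mu>" "1 \<le> p" "borel_Lp p f"
  shows "AE x in lborel. avg \<mu> (cell_diff b t f) x = cell_diff b t (avg \<mu> f) x"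
proof -
  interpret borel_prob_space \<mu> by fact
  show ?thesis
    using avg_diff[OF assms(2,3) borel_Lp_translate[OF assms(2,3)], of "b *v axis t 1"]
    by (simp add: cell_diff_def avg_translate)
qed

lemma avg_pow_borel_Lp:
  assumes "borel_prob_space \<mu>" "1 \<le> p" "borel_Lp p f"
  shows "borel_Lp p ((avg \<mu> ^^ n) f)" "Lp_borel_norm p ((avg \<mu> ^^ n) f) \<le> Lp_borel_norm p f"
proof -
  interpret borel_prob_space \<mu> by fact
  have "borel_Lp p ((avg \<mu> ^^ n) f) \<and> Lp_borel_norm p ((avg \<mu> ^^ n) f) \<le> Lp_borel_norm p f"
  proof (induction n)
    case (Suc n)
    then show ?case
      using assms(2) Lp_borel_norm_avg_le[OF assms(2), of "(avg \<mu> ^^ n) f"]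
      by (auto simp: borel_Lp_avg borel_Lp_measurable intro: order_trans)
  qed (use assms in simp)
  then show "borel_Lp p ((avg \<mu> ^^ n) f)" "Lp_borel_norm p ((avg \<mu> ^^ n) f) \<le> Lp_borel_norm p f"
    by auto
qed

text \<open>An exchange of difference and average that holds almost everywhere survives a further
  average by \<open>avg_cong_AE\<close>, so it can be iterated.\<close>

lemma avg_pow_cell_diff:
  assumes \<mu>: "borel_prob_space \<mu>" and p: "1 \<le> p" "borel_Lp p f"
  shows "AE x in lborel. (avg \<mu> ^^ n) (cell_diff b t f) x = cell_diff b t ((avg \<mu> ^^ n) f) x"
proof (induction n)
  case (Suc n)
  interpret borel_prob_space \<mu> by (rule \<mu>)
  let ?G = "(avg \<mu> ^^ n) f"
  have G: "borel_Lp p ?G" using \<mu> p by (rule avg_pow_borel_Lp)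
  have D: "borel_Lp p ((avg \<mu> ^^ n) (cell_diff b t f))"
    using \<mu> p(1) borel_Lp_cell_diff[OF p] by (rule avg_pow_borel_Lp)
  have "AE x in lborel. avg \<mu> ((avg \<mu> ^^ n) (cell_diff b t f)) x = avg \<mu> (cell_diff b t ?G) x"
    using borel_Lp_measurable[OF D] borel_Lp_measurable[OF borel_Lp_cell_diff[OF p(1) G]] Suc.IH
    by (rule avg_cong_AE)
  moreover have "AE x in lborel. avg \<mu> (cell_diff b t ?G) x = cell_diff b t (avg \<mu> ?G) x"
    using \<mu> p(1) G by (rule avg_cell_diff)
  ultimately show ?case by eventually_elim simp
qed simp

lemma weak_dir_deriv_sum_directions:
  assumes p: "1 \<le> p" "borel_Lp p f" "\<And>t. t \<in> T \<Longrightarrow> borel_Lp p (g t)"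
    and wd: "\<And>t. t \<in> T \<Longrightarrow> weak_dir_deriv (u t) f (g t)"
  shows "weak_dir_deriv (\<Sum>t\<in>T. w t *\<^sub>R u t) f (\<lambda>x. \<Sum>t\<in>T. of_real (w t) * g t x)"
  unfolding weak_dir_deriv_def
proof
  fix \<phi> :: "real ^ 'a \<Rightarrow> complex" assume \<phi>: "\<phi> \<in> test_functions"
  have cb: "compactly_bounded \<phi>" "compactly_bounded (dir_deriv v \<phi>)" for v
    using \<phi> test_functions_dir_deriv by (auto intro: test_functions_compactly_bounded)
  have lin: "dir_deriv (\<Sum>t\<in>T. w t *\<^sub>R u t) \<phi> x = (\<Sum>t\<in>T. of_real (w t) * dir_deriv (u t) \<phi> x)" for x
    using linear_frechet_derivative[OF test_functions_differentiable[OF \<phi>]]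
    by (simp add: dir_deriv_def linear_sum linear_scale) (simp add: scaleR_conv_of_real)
  have "(LINT x|lborel. f x * dir_deriv (\<Sum>t\<in>T. w t *\<^sub>R u t) \<phi> x)
      = (LINT x|lborel. (\<Sum>t\<in>T. of_real (w t) * (f x * dir_deriv (u t) \<phi> x)))"
    by (simp add: lin sum_distrib_left mult_ac)
  also have "\<dots> = (\<Sum>t\<in>T. of_real (w t) * (LINT x|lborel. f x * dir_deriv (u t) \<phi> x))"
    using compactly_bounded_integrable[OF p(1,2) cb(2)] by (subst Bochner_Integration.integral_sum) auto
  also have "\<dots> = (\<Sum>t\<in>T. of_real (w t) * - (LINT x|lborel. g t x * \<phi> x))"
    using wd \<phi> by (intro sum.cong refl) (simp add: weak_dir_deriv_def)
  also have "\<dots> = - (\<Sum>t\<in>T. of_real (w t) * (LINT x|lborel. g t x * \<phi> x))"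
    by (simp add: sum_negf)
  also have "(\<Sum>t\<in>T. of_real (w t) * (LINT x|lborel. g t x * \<phi> x)) = (LINT x|lborel. (\<Sum>t\<in>T. of_real (w t) * (g t x * \<phi> x)))"
    using compactly_bounded_integrable[OF p(1) p(3) cb(1)] by (subst Bochner_Integration.integral_sum) auto
  also have "\<dots> = (LINT x|lborel. (\<Sum>t\<in>T. of_real (w t) * g t x) * \<phi> x)"
    by (simp add: sum_distrib_right mult.assoc)
  finally show "(LINT x|lborel. f x * dir_deriv (\<Sum>t\<in>T. w t *\<^sub>R u t) \<phi> x)
      = - (LINT x|lborel. (\<Sum>t\<in>T. of_real (w t) * g t x) * \<phi> x)" .
qed

text \<open>Each derivative uses up one of the cell averages: along a lattice vector the outermost
  one turns into a face average of a lattice difference. The difference is moved inside onto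
  \<open>f\<close>, leaving one cell average fewer of \<open>cell_diff b t f\<close>, to which the
  induction hypothesis applies; the face average costs nothing.\<close>

lemma dir_sobolev_avg_cell:
  fixes b :: "real ^ 'n ^ 'n::finite"
  assumes p: "1 \<le> p" and b: "invertible b"
  shows "borel_Lp p f \<Longrightarrow> dir_sobolev p m (cell_bound p b f) ((avg (cell_measure b) ^^ m) f)"
proof (induction m arbitrary: f)
  case (Suc m)
  note C = borel_prob_space_cell_measure[of b]
  note F = borel_prob_space_face_measure[of b]
  interpret C: borel_prob_space "cell_measure b" by (rule C)
  let ?G = "\<lambda>f. (avg (cell_measure b) ^^ m) f"
  have G: "borel_Lp p (?G f)" using C p Suc.prems by (rule avg_pow_borel_Lp)
  show ?case unfolding dir_sobolev.simps
  proof (intro conjI allI)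
    show "borel_Lp p ((avg (cell_measure b) ^^ Suc m) f)"
      "Lp_borel_norm p ((avg (cell_measure b) ^^ Suc m) f) \<le> cell_bound p b f []"
      using avg_pow_borel_Lp[OF C p Suc.prems, of "Suc m"] by auto
    fix v :: "real ^ 'n"
    let ?w = "matrix_inv b *v v"
    define g where "g t = avg (face_measure b t) (?G (cell_diff b t f))" for t
    have D: "borel_Lp p (cell_diff b t f)" for t using p Suc.prems by (rule borel_Lp_cell_diff)
    have GD: "borel_Lp p (?G (cell_diff b t f))" for t using C p D by (rule avg_pow_borel_Lp)
    have g: "borel_Lp p (g t)" for t
    proof -
      interpret borel_prob_space "face_measure b t" by (rule F)
      show ?thesis unfolding g_def using p GD by (rule borel_Lp_avg)
    qed
    have wd: "weak_dir_deriv (b *v axis t 1) (avg (cell_measure b) (?G f)) (g t)" for t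
    proof -
      interpret F: borel_prob_space "face_measure b t" by (rule F)
      \<comment> \<open>The derivative first arises as a difference of averages; \<open>g t\<close>
        is almost everywhere the same function, with the difference moved onto
        \<open>f\<close>.\<close>
      have wd: "weak_dir_deriv (b *v axis t 1) (avg (cell_measure b) (?G f)) (cell_diff b t (avg (face_measure b t) (?G f)))"
        unfolding cell_diff_def using p G by (rule weak_dir_deriv_avg_cell)
      have ae: "AE x in lborel. cell_diff b t (avg (face_measure b t) (?G f)) x = g t x"
      proof -
        have "AE x in lborel. avg (face_measure b t) (?G (cell_diff b t f)) x = avg (face_measure b t) (cell_diff b t (?G f)) x"
          using borel_Lp_measurable[OF GD] borel_Lp_measurable[OF borel_Lp_cell_diff[OF p G]]
            avg_pow_cell_diff[OF C p Suc.prems]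
          by (rule F.avg_cong_AE)
        moreover have "AE x in lborel. avg (face_measure b t) (cell_diff b t (?G f)) x = cell_diff b t (avg (face_measure b t) (?G f)) x"
          using F p G by (rule avg_cell_diff)
        ultimately show ?thesis unfolding g_def by eventually_elim simp
      qed
      have m: "avg (cell_measure b) (?G f) \<in> borel_measurable borel"
        using borel_Lp_measurable[OF G] by (rule C.avg_measurable)
      have m': "cell_diff b t (avg (face_measure b t) (?G f)) \<in> borel_measurable borel"
        using borel_Lp_measurable[OF G] by (intro cell_diff_measurable F.avg_measurable)
      show ?thesis
        by (rule weak_dir_deriv_cong_AE[OF wd m m m' borel_Lp_measurable[OF g] _ ae]) simp
    qed
    \<comment> \<open>Derivatives become differences along lattice vectors, so \<open>v\<close> is
      expanded in the lattice basis, with coordinates \<open>matrix_inv b *v v\<close>.\<close>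
    have v: "v = (\<Sum>t\<in>UNIV. ?w $ t *\<^sub>R (b *v axis t 1))"
    proof -
      have "v = b *v ?w" using b by (simp add: matrix_inv_mult_vec)
      also have "\<dots> = b *v (\<Sum>t\<in>UNIV. ?w $ t *\<^sub>R axis t 1)"
        using basis_expansion[of ?w] by (simp add: scalar_mult_eq_scaleR)
      also have "\<dots> = (\<Sum>t\<in>UNIV. ?w $ t *\<^sub>R (b *v axis t 1))"
        by (simp add: linear_sum[OF matrix_vector_mul_linear] matrix_vector_mult_scaleR)
      finally show ?thesis .
    qed
    have L: "borel_Lp p (avg (cell_measure b) (?G f))" using p G by (rule C.borel_Lp_avg)
    have "weak_dir_deriv v (avg (cell_measure b) (?G f)) (\<lambda>x. \<Sum>t\<in>UNIV. of_real (?w $ t) * g t x)"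
      by (subst v) (rule weak_dir_deriv_sum_directions[OF p L g wd])
    moreover have "dir_sobolev p m (\<lambda>vs. \<Sum>t\<in>UNIV. ennreal (norm (complex_of_real (?w $ t))) * cell_bound p b (cell_diff b t f) vs)
        (\<lambda>x. \<Sum>t\<in>UNIV. of_real (?w $ t) * g t x)"
      unfolding g_def by (intro dir_sobolev_sum dir_sobolev_cmult dir_sobolev_avg p F Suc.IH D)
    ultimately show "\<exists>g. weak_dir_deriv v ((avg (cell_measure b) ^^ Suc m) f) g \<and> dir_sobolev p m (\<lambda>vs. cell_bound p b f (v # vs)) g"
      by auto
  qed
qed simp

text \<open>The bound is homogeneous of degree 1 in each vector of the list. With \<open>r\<close>
  the scale factor, this is the source of the weights in the sequence norm.\<close>

lemma cell_bound_scale: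
  "cell_bound p b f (map ((*v) (mat r)) vs) = ennreal (\<bar>r\<bar> ^ length vs) * cell_bound p b f vs"
proof (induction vs arbitrary: f)
  case (Cons v vs)
  have "mat r *v v = r *\<^sub>R v" for v :: "real ^ 'a"
    by (simp add: mat_def matrix_vector_mult_def vec_eq_iff if_distrib[of "\<lambda>x. x * _"] cong: if_cong)
  then have "(matrix_inv b *v (mat r *v v)) $ t = r * (matrix_inv b *v v) $ t" for t
    by (simp add: matrix_vector_mult_scaleR)
  then show ?case
    by (simp add: Cons.IH sum_distrib_left abs_mult ennreal_mult mult_ac)
qed simp

text \<open>The lattice coordinates of \<open>b *v axis s 1\<close> are those of
  \<open>axis s 1\<close>, so each sum over directions has a single nonzero term, with factor 1.
  This exactness gives the constant after rescaling by \<open>b\<close>.\<close>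

lemma cell_bound_lattice:
  fixes b :: "real ^ 'n ^ 'n::finite"
  assumes b: "invertible b"
  shows "cell_bound p b f (map (\<lambda>t. b *v axis t 1) ts) = Lp_borel_norm p (fold (cell_diff b) ts f)"
proof (induction ts arbitrary: f)
  case (Cons s ts)
  have eq: "ennreal \<bar>(matrix_inv b *v (b *v axis s 1)) $ t\<bar> * X = (if t = s then X else 0)" for t X
    using b by (simp add: matrix_inv_mult_vec axis_def)
  show ?case by (simp add: Cons.IH eq)
qed simp

text \<open>Expanding the sums over directions produces all lists of lattice differences of the
  given length; bounding each of them by \<open>L\<close> leaves the product of the l^1 norms of the
  lattice coordinates.\<close>

lemma cell_bound_le:
  assumes "\<And>ts. length ts = length vs \<Longrightarrow> Lp_borel_norm p (fold (cell_diff b) ts f) \<le> L"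
  shows "cell_bound p b f vs \<le> ennreal (\<Prod>v\<leftarrow>vs. \<Sum>t\<in>UNIV. \<bar>(matrix_inv b *v v) $ t\<bar>) * L"
  using assms
proof (induction vs arbitrary: f)
  case Nil
  then show ?case using Nil[of "[]"] by simp
next
  case (Cons v vs)
  let ?P = "\<Prod>v\<leftarrow>vs. \<Sum>t\<in>UNIV. \<bar>(matrix_inv b *v v) $ t\<bar>"
  have P: "0 \<le> ?P" by (induction vs) (auto intro!: mult_nonneg_nonneg sum_nonneg)
  have "cell_bound p b (cell_diff b t f) vs \<le> ennreal ?P * L" for t
  proof (rule Cons.IH)
    fix ts :: "'a list" assume "length ts = length vs"
    then show "Lp_borel_norm p (fold (cell_diff b) ts (cell_diff b t f)) \<le> L"
      using Cons.prems[of "t # ts"] by simp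
  qed
  then have "cell_bound p b f (v # vs) \<le> (\<Sum>t\<in>UNIV. ennreal \<bar>(matrix_inv b *v v) $ t\<bar> * (ennreal ?P * L))"
    by (auto intro!: sum_mono mult_left_mono)
  also have "\<dots> = ennreal ((\<Sum>t\<in>UNIV. \<bar>(matrix_inv b *v v) $ t\<bar>) * ?P) * L"
    using P by (simp add: sum_distrib_right[symmetric] ennreal_mult sum_nonneg mult.assoc)
  finally show ?case by simp
qed

section \<open>Countable sums as integrals over counting measure\<close>

lemma borel_measurable_nn_integral_count_space:
  fixes F :: "'i \<Rightarrow> 'a \<Rightarrow> ennreal"
  assumes I: "countable (UNIV :: 'i set)" and F: "\<And>k. F k \<in> borel_measurable M"
  shows "(\<lambda>x. \<integral>\<^sup>+k. F k x \<partial>count_space UNIV) \<in> borel_measurable M"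
proof -
  interpret sigma_finite_measure "count_space (UNIV :: 'i set)"
    using I by (rule sigma_finite_measure_count_space_countable)
  have "(\<lambda>(k, x). F k x) \<in> borel_measurable (count_space UNIV \<Otimes>\<^sub>M M)"
    using I F by (intro measurable_pair_measure_countable1) auto
  then have "(\<lambda>(x, k). F k x) \<in> borel_measurable (M \<Otimes>\<^sub>M count_space UNIV)"
    using measurable_pair_swap[of "\<lambda>(k, x). F k x"] by simp
  then show ?thesis by (rule borel_measurable_nn_integral)
qed

lemma borel_measurable_integral_count_space:
  fixes F :: "'i \<Rightarrow> 'a \<Rightarrow> complex"
  assumes I: "countable (UNIV :: 'i set)" and F: "\<And>k. F k \<in> borel_measurable M"
  shows "(\<lambda>x. LINT k|count_space UNIV. F k x) \<in> borel_measurable M"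
proof -
  interpret sigma_finite_measure "count_space (UNIV :: 'i set)"
    using I by (rule sigma_finite_measure_count_space_countable)
  have "(\<lambda>(k, x). F k x) \<in> borel_measurable (count_space UNIV \<Otimes>\<^sub>M M)"
    using I F by (intro measurable_pair_measure_countable1) auto
  then have "(\<lambda>(x, k). F k x) \<in> borel_measurable (M \<Otimes>\<^sub>M count_space UNIV)"
    using measurable_pair_swap[of "\<lambda>(k, x). F k x"] by simp
  then show ?thesis by (rule borel_measurable_lebesgue_integral)
qed

text \<open>For complex families summability is absolute summability, that is, integrability over
  counting measure; when it fails both sides are 0 by convention.\<close>

lemma infsum_eq_integral_count_space:
  fixes f :: "'i \<Rightarrow> complex"
  shows "infsum f UNIV = (LINT k|count_space UNIV. f k)"
proof (cases "f summable_on UNIV")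
  case True
  then have "Infinite_Set_Sum.abs_summable_on f UNIV"
    by (simp add: summable_on_iff_abs_summable_on_complex abs_summable_equivalent)
  then show ?thesis by (simp add: infsetsum_infsum[symmetric] infsetsum_def)
next
  case False
  then have "\<not> integrable (count_space UNIV) f"
    by (simp add: summable_on_iff_abs_summable_on_complex abs_summable_equivalent Infinite_Set_Sum.abs_summable_on_def)
  with False show ?thesis by (simp add: infsum_not_exists not_integrable_integral_eq)
qed

lemma norm_summable_on_iff_integrable:
  fixes f :: "'i \<Rightarrow> complex"
  shows "(\<lambda>k. norm (f k)) summable_on UNIV \<longleftrightarrow> integrable (count_space UNIV) f"
  by (simp add: abs_summable_equivalent Infinite_Set_Sum.abs_summable_on_def)

section \<open>Lattice sums\<close>

lemma cell_eq: "cell b = (\<lambda>x. b *v x) ` unit_cube"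
  by (simp add: cell_def unit_cube_def)

lemma mem_cell_iff:
  assumes "invertible b"
  shows "x \<in> cell b \<longleftrightarrow> matrix_inv b *v x \<in> unit_cube"
proof
  assume "matrix_inv b *v x \<in> unit_cube"
  then have "b *v (matrix_inv b *v x) \<in> cell b" by (simp add: cell_eq)
  then show "x \<in> cell b" using assms by (simp add: matrix_inv_mult_vec)
qed (use assms in \<open>auto simp: cell_eq matrix_inv_mult_vec\<close>)

lemma cell_borel:
  fixes b :: "real ^ 'n ^ 'n::finite"
  assumes "invertible b"
  shows "cell b \<in> sets borel"
proof -
  have "cell b = (*v) (matrix_inv b) -` unit_cube \<inter> space borel"
    using mem_cell_iff[OF assms] by auto
  also have "\<dots> \<in> sets borel" by measurable
  finally show ?thesis .
qed

lemma emeasure_cell: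
  fixes b :: "real ^ 'n ^ 'n::finite"
  assumes b: "invertible b"
  shows "emeasure lborel (cell b) = ennreal \<bar>det b\<bar>"
proof -
  have ind: "indicator (cell b) (b *v x) = (indicator unit_cube x :: ennreal)" for x
    using mem_cell_iff[OF b] b by (simp add: indicator_def matrix_inv_mult_vec)
  have "emeasure lborel (cell b) = (\<integral>\<^sup>+x. indicator (cell b) x \<partial>lborel)"
    using cell_borel[OF b] by simp
  also have "\<dots> = ennreal \<bar>det b\<bar> * (\<integral>\<^sup>+x. indicator (cell b) (b *v x) \<partial>lborel)"
    using cell_borel[OF b] by (intro nn_integral_matrix b) simp
  also have "\<dots> = ennreal \<bar>det b\<bar>"
    by (simp add: ind emeasure_unit_cube)
  finally show ?thesis .
qed

lemma lattice_point_add: "lattice_point b (k + l) = lattice_point b k + lattice_point b l"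
proof -
  have "(\<chi> i. real_of_int ((k + l) $ i)) = (\<chi> i. real_of_int (k $ i)) + (\<chi> i. real_of_int (l $ i))"
    by (simp add: vec_eq_iff)
  then show ?thesis by (simp add: lattice_point_def matrix_vector_right_distrib)
qed

lemma lattice_point_axis: "lattice_point b (axis t 1) = b *v axis t 1"
proof -
  have "(\<chi> i. real_of_int ((axis t 1 :: int ^ 'a) $ i)) = axis t 1"
    by (simp add: vec_eq_iff axis_def)
  then show ?thesis by (simp add: lattice_point_def)
qed

lemma lattice_point_diff: "lattice_point b (k - l) = lattice_point b k - lattice_point b l"
  using lattice_point_add[of b "k - l" l] by simp

lemma nn_integral_count_space_translate:
  fixes f :: "int ^ 'n \<Rightarrow> ennreal"
  shows "(\<integral>\<^sup>+k. f (k + l) \<partial>count_space UNIV) = (\<integral>\<^sup>+k. f k \<partial>count_space UNIV)"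
  by (rule nn_integral_bij_count_space) (rule bij_plus_right)

lemma nn_integral_count_space_reflect:
  fixes f :: "int ^ 'n \<Rightarrow> ennreal"
  shows "(\<integral>\<^sup>+k. f (l - k) \<partial>count_space UNIV) = (\<integral>\<^sup>+k. f k \<partial>count_space UNIV)"
  by (rule nn_integral_bij_count_space, rule bij_betw_byWitness[where f' = "\<lambda>k. l - k"]) auto

lemma cell_tiling:
  fixes b :: "real ^ 'n ^ 'n::finite"
  assumes b: "invertible b"
  shows "(\<integral>\<^sup>+k. indicator (cell b) (x - lattice_point b k) \<partial>count_space UNIV) = 1"
proof -
  \<comment> \<open>The integer parts of the lattice coordinates of \<open>x\<close> index the only
    translate of the cell that contains \<open>x\<close>.\<close>
  define k0 :: "int ^ 'n" where "k0 = (\<chi> i. \<lfloor>(matrix_inv b *v x) $ i\<rfloor>)"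
  have "x - lattice_point b k \<in> cell b \<longleftrightarrow> k = k0" for k :: "int ^ 'n"
  proof -
    have "matrix_inv b *v (x - lattice_point b k) = matrix_inv b *v x - (\<chi> i. real_of_int (k $ i))"
      using b by (simp add: lattice_point_def matrix_vector_mult_diff_distrib matrix_inv_mult_vec)
    then have "x - lattice_point b k \<in> cell b \<longleftrightarrow>
        (\<forall>i. 0 \<le> (matrix_inv b *v x) $ i - real_of_int (k $ i) \<and> (matrix_inv b *v x) $ i - real_of_int (k $ i) < 1)"
      using mem_cell_iff[OF b] by (simp add: unit_cube_def)
    also have "\<dots> \<longleftrightarrow> (\<forall>i. k $ i = \<lfloor>(matrix_inv b *v x) $ i\<rfloor>)"
      by (intro all_cong1) linarith
    finally show ?thesis by (simp add: k0_def vec_eq_iff)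
  qed
  then have "indicator (cell b) (x - lattice_point b k) = (indicator {k0} k :: ennreal)" for k :: "int ^ 'n"
    by (simp add: indicator_def)
  then show ?thesis by simp
qed

definition cell_lborel :: "real ^ 'n ^ 'n::finite \<Rightarrow> (real ^ 'n) measure"
  where "cell_lborel b = density lborel (indicator (cell b))"

lemma sets_cell_lborel [measurable_cong, simp]: "sets (cell_lborel b) = sets borel"
  by (simp add: cell_lborel_def)

text \<open>The partition of unity from \<open>cell_tiling\<close> is inserted and each translated
  cell is shifted back to the base cell.\<close>

lemma nn_integral_tiling:
  fixes b :: "real ^ 'n ^ 'n::finite"
  assumes b: "invertible b" and [measurable]: "h \<in> borel_measurable borel"
  shows "(\<integral>\<^sup>+x. h x \<partial>lborel)
    = (\<integral>\<^sup>+k. \<integral>\<^sup>+x. h (x + lattice_point b k) \<partial>cell_lborel b \<partial>count_space UNIV)"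
proof -
  note [measurable] = cell_borel[OF b]
  have cnt: "countable (UNIV :: (int ^ 'n) set)" by simp
  have "(\<integral>\<^sup>+x. h x \<partial>lborel) = (\<integral>\<^sup>+x. \<integral>\<^sup>+k. indicator (cell b) (x - lattice_point b k) * h x \<partial>count_space UNIV \<partial>lborel)"
    by (simp add: nn_integral_multc cell_tiling[OF b])
  also have "\<dots> = (\<integral>\<^sup>+k. \<integral>\<^sup>+x. indicator (cell b) (x - lattice_point b k) * h x \<partial>lborel \<partial>count_space UNIV)"
    by (rule nn_integral_count_space_nn_integral[OF cnt]) measurable
  also have "\<dots> = (\<integral>\<^sup>+k. \<integral>\<^sup>+x. h (x + lattice_point b k) \<partial>cell_lborel b \<partial>count_space UNIV)"
  proof (rule nn_integral_cong)
    fix k :: "int ^ 'n"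
    have "(\<integral>\<^sup>+x. indicator (cell b) (x - lattice_point b k) * h x \<partial>lborel)
        = (\<integral>\<^sup>+x. indicator (cell b) x * h (x + lattice_point b k) \<partial>lborel)"
      using nn_integral_lborel_translate[of "\<lambda>x. indicator (cell b) (x - lattice_point b k) * h x" "lattice_point b k"]
      by simp
    also have "\<dots> = (\<integral>\<^sup>+x. h (x + lattice_point b k) \<partial>cell_lborel b)"
      unfolding cell_lborel_def by (rule nn_integral_density[symmetric]) measurable
    finally show "(\<integral>\<^sup>+x. indicator (cell b) (x - lattice_point b k) * h x \<partial>lborel)
        = (\<integral>\<^sup>+x. h (x + lattice_point b k) \<partial>cell_lborel b)" .
  qed
  finally show ?thesis .
qed

text \<open>With \<open>s\<close> equal to 1 this is the periodization of \<open>g\<close> up to the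
  factor |det b|. With values in the extended nonnegative numbers it is defined without any question
  of convergence and serves as a majorant of \<open>syn\<close>.\<close>

definition nn_syn :: "real ^ 'n ^ 'n::finite \<Rightarrow> (int ^ 'n \<Rightarrow> ennreal) \<Rightarrow> (real ^ 'n \<Rightarrow> ennreal) \<Rightarrow> real ^ 'n \<Rightarrow> ennreal"
  where "nn_syn b s g x = (\<integral>\<^sup>+k. s k * g (x - lattice_point b k) \<partial>count_space UNIV)"

definition syn :: "real ^ 'n ^ 'n::finite \<Rightarrow> (int ^ 'n \<Rightarrow> complex) \<Rightarrow> (real ^ 'n \<Rightarrow> complex) \<Rightarrow> real ^ 'n \<Rightarrow> complex"
  where "syn b c f x = (LINT k|count_space UNIV. c k * f (x - lattice_point b k))"

lemma nn_syn_measurable [measurable]: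
  assumes [measurable]: "g \<in> borel_measurable borel"
  shows "nn_syn b s g \<in> borel_measurable borel"
  unfolding nn_syn_def[abs_def] by (rule borel_measurable_nn_integral_count_space) auto

lemma syn_measurable [measurable]:
  assumes [measurable]: "f \<in> borel_measurable borel"
  shows "syn b c f \<in> borel_measurable borel"
  unfolding syn_def[abs_def] by (rule borel_measurable_integral_count_space) auto

lemma nn_syn_norm:
  fixes c :: "int ^ 'n::finite \<Rightarrow> complex" and f :: "real ^ 'n \<Rightarrow> complex"
  shows "nn_syn b (\<lambda>k. ennreal (norm (c k))) (\<lambda>x. ennreal (norm (f x))) x
    = (\<integral>\<^sup>+k. ennreal (norm (c k * f (x - lattice_point b k))) \<partial>count_space UNIV)"
  by (simp add: nn_syn_def norm_mult ennreal_mult)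

lemma integrable_syn:
  fixes c :: "int ^ 'n::finite \<Rightarrow> complex" and f :: "real ^ 'n \<Rightarrow> complex"
  shows "nn_syn b (\<lambda>k. ennreal (norm (c k))) (\<lambda>x. ennreal (norm (f x))) x < top \<Longrightarrow>
    integrable (count_space UNIV) (\<lambda>k. c k * f (x - lattice_point b k))"
  by (rule integrableI_bounded) (simp_all add: nn_syn_norm)

lemma norm_syn_le:
  "ennreal (norm (syn b c f x)) \<le> nn_syn b (\<lambda>k. ennreal (norm (c k))) (\<lambda>x. ennreal (norm (f x))) x"
proof (cases "integrable (count_space UNIV) (\<lambda>k. c k * f (x - lattice_point b k))")
  case True
  then show ?thesis
    unfolding syn_def nn_syn_norm by (rule integral_norm_bound_ennreal)
qed (simp add: syn_def not_integrable_integral_eq)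

lemma nn_syn_1_periodic:
  "nn_syn b (\<lambda>_. 1) g (x + lattice_point b l) = nn_syn b (\<lambda>_. 1) g x"
proof -
  have "nn_syn b (\<lambda>_. 1) g (x + lattice_point b l) = (\<integral>\<^sup>+k. g (x - lattice_point b (k + - l)) \<partial>count_space UNIV)"
    by (simp add: nn_syn_def lattice_point_diff algebra_simps)
  also have "\<dots> = nn_syn b (\<lambda>_. 1) g x"
    unfolding nn_syn_def by (subst nn_integral_count_space_translate) simp
  finally show ?thesis .
qed

text \<open>The exceptional set is invariant under the lattice, so by the tiling its measure is a
  sum of copies of its measure in one cell.\<close>

lemma AE_periodic:
  fixes b :: "real ^ 'n ^ 'n::finite"
  assumes b: "invertible b" and P: "{x. \<not> P x} \<in> sets borel" "AE x in cell_lborel b. P x"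
    and per: "\<And>x l. P (x + lattice_point b l) \<longleftrightarrow> P x"
  shows "AE x in lborel. P x"
proof -
  have [measurable]: "(indicator {x. \<not> P x} :: _ \<Rightarrow> ennreal) \<in> borel_measurable borel"
    using P(1) by simp
  have "(\<integral>\<^sup>+x. indicator {x. \<not> P x} x \<partial>cell_lborel b) = 0"
    using P(2) by (subst nn_integral_0_iff_AE) (auto elim!: eventually_mono simp: indicator_def)
  moreover have "indicator {x. \<not> P x} (x + lattice_point b l) = (indicator {x. \<not> P x} x :: ennreal)" for x l
    using per by (simp add: indicator_def)
  ultimately have "(\<integral>\<^sup>+x. indicator {x. \<not> P x} x \<partial>lborel) = 0"
    by (subst nn_integral_tiling[OF b]) (simp_all del: nn_integral_indicator)
  then show ?thesis
    by (subst (asm) nn_integral_0_iff_AE) (auto elim!: eventually_mono simp: indicator_def split: if_splits)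
qed

text \<open>Counting measure has no nonempty null sets, so its essential supremum is the supremum
  over all \<open>k\<close>.\<close>

lemma lp_seq_norm_eq:
  fixes s :: "'k \<Rightarrow> complex"
  assumes "countable (UNIV :: 'k set)" "1 \<le> p"
  shows "lp_seq_norm p s = Lp_enorm p (count_space UNIV) (\<lambda>k. ennreal (norm (s k)))"
  using assms(2)
proof (cases rule: exponent_cases)
  case infinite
  have "esssup (count_space UNIV) (\<lambda>k. ennreal (norm (s k))) = (SUP k. ennreal (norm (s k)))"
  proof (rule antisym)
    show "esssup (count_space UNIV) (\<lambda>k. ennreal (norm (s k))) \<le> (SUP k. ennreal (norm (s k)))"
      by (rule esssup_I) (auto simp: AE_count_space intro: SUP_upper)
    show "(SUP k. ennreal (norm (s k))) \<le> esssup (count_space UNIV) (\<lambda>k. ennreal (norm (s k)))"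
      using esssup_AE[of "\<lambda>k. ennreal (norm (s k))" "count_space UNIV"]
      by (intro SUP_least) (simp add: AE_count_space)
  qed
  then show ?thesis by (simp add: infinite lp_seq_norm_def Lp_enorm_infinity)
next
  case (finite q)
  then show ?thesis
    by (simp add: lp_seq_norm_def Lp_enorm_def nn_integral_count_space_eq_infsum[OF assms(1)])
qed

text \<open>The size of the constant is immaterial: the bound keeps the differences of a sequence in
  l^p, so that they can be synthesized again.\<close>

lemma lp_seq_norm_diff_op_le:
  fixes s :: "int ^ 'n::finite \<Rightarrow> complex"
  assumes p: "1 \<le> p"
  shows "lp_seq_norm p (diff_op t s) \<le> lp_seq_norm p s + lp_seq_norm p s"
proof -
  have cnt: "countable (UNIV :: (int ^ 'n) set)" by simp
  let ?N = "Lp_enorm p (count_space UNIV) :: (int ^ 'n \<Rightarrow> ennreal) \<Rightarrow> ennreal"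
  have tr: "?N (\<lambda>k. ennreal (norm (s (k - axis t 1)))) = ?N (\<lambda>k. ennreal (norm (s k)))"
    using p
  proof (cases rule: exponent_cases)
    case infinite
    have "(SUP k. ennreal (norm (s (k - axis t 1)))) = (SUP k. ennreal (norm (s k)))"
    proof (rule antisym)
      show "(SUP k. ennreal (norm (s k))) \<le> (SUP k. ennreal (norm (s (k - axis t 1))))"
      proof (rule SUP_least)
        fix k
        have "ennreal (norm (s k)) = ennreal (norm (s ((k + axis t 1) - axis t 1)))" by simp
        also have "\<dots> \<le> (SUP k. ennreal (norm (s (k - axis t 1))))" by (rule SUP_upper) simp
        finally show "ennreal (norm (s k)) \<le> (SUP k. ennreal (norm (s (k - axis t 1))))" .
      qed
    qed (auto intro!: SUP_least SUP_upper)
    then show ?thesis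
      using lp_seq_norm_eq[OF cnt p, of s] lp_seq_norm_eq[OF cnt p, of "\<lambda>k. s (k - axis t 1)"]
      by (simp add: infinite lp_seq_norm_def)
  next
    case (finite q)
    then show ?thesis
      using nn_integral_count_space_translate[of "\<lambda>k. epowr (ennreal (norm (s k))) q" "- axis t 1"]
      by (simp add: Lp_enorm_ennreal)
  qed
  have "?N (\<lambda>k. ennreal (norm (diff_op t s k))) \<le> ?N (\<lambda>k. ennreal (norm (s k)) + ennreal (norm (s (k - axis t 1))))"
    using p by (intro Lp_enorm_mono_AE AE_I2)
      (auto simp: diff_op_def ennreal_plus[symmetric] norm_triangle_ineq4 simp del: ennreal_plus intro!: ennreal_leI)
  also have "\<dots> \<le> ?N (\<lambda>k. ennreal (norm (s k))) + ?N (\<lambda>k. ennreal (norm (s (k - axis t 1))))"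
    using p by (intro Lp_enorm_add_le) auto
  finally show ?thesis by (simp add: tr lp_seq_norm_eq[OF cnt p])
qed

text \<open>For finite \<open>p\<close> Jensen's inequality is applied at each point to the weights
  g(x - bk), whose total mass is a periodic function E(x). Integrating over all cells sums the
  weights over the lattice once more and gives another factor E(x), which together with E(x)^(q-1)
  makes E(x)^q on one cell. For infinite \<open>p\<close> the supremum of \<open>s\<close> is taken
  out of the sum.\<close>

lemma Lp_enorm_nn_syn_le:
  fixes b :: "real ^ 'n ^ 'n::finite"
  assumes p: "1 \<le> p" and b: "invertible b" and g[measurable]: "g \<in> borel_measurable borel"
    and fin: "Lp_enorm p (cell_lborel b) (nn_syn b (\<lambda>_. 1) g) < top"
  shows "Lp_enorm p lborel (nn_syn b s g)
    \<le> Lp_enorm p (count_space UNIV) s * Lp_enorm p (cell_lborel b) (nn_syn b (\<lambda>_. 1) g)"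
  using p
proof (cases rule: exponent_cases)
  case infinite
  let ?E = "nn_syn b (\<lambda>_. 1) g" and ?N = "esssup (cell_lborel b) (nn_syn b (\<lambda>_. 1) g)"
    and ?S = "esssup (count_space UNIV) s"
  have "AE x in lborel. ?E x \<le> ?N"
  proof (rule AE_periodic[OF b])
    show "{x. \<not> ?E x \<le> ?N} \<in> sets borel" by measurable
  qed (simp_all add: esssup_AE nn_syn_1_periodic)
  then have "AE x in lborel. nn_syn b s g x \<le> ?S * ?N"
  proof eventually_elim
    case (elim x)
    have "nn_syn b s g x \<le> (\<integral>\<^sup>+k. ?S * g (x - lattice_point b k) \<partial>count_space UNIV)"
      unfolding nn_syn_def using esssup_AE[of s "count_space UNIV"]
      by (intro nn_integral_mono mult_right_mono) (auto simp: AE_count_space)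
    also have "\<dots> = ?S * ?E x" by (simp add: nn_syn_def nn_integral_cmult)
    also have "\<dots> \<le> ?S * ?N" using elim by (intro mult_left_mono) auto
    finally show ?case .
  qed
  then show ?thesis by (auto simp: infinite Lp_enorm_infinity)
next
  case (finite q)
  let ?E = "nn_syn b (\<lambda>_. 1) g" and ?C = "cell_lborel b"
  have cnt: "countable (UNIV :: (int ^ 'n) set)" by simp
  have E: "AE x in ?C. ?E x < top"
    using p fin by (intro Lp_enorm_less_top_AE) auto
  have pt: "epowr (nn_syn b s g (x + lattice_point b n)) q
      \<le> epowr (?E x) (q - 1) * (\<integral>\<^sup>+k. epowr (s k) q * g (x + lattice_point b n - lattice_point b k) \<partial>count_space UNIV)"
    if "?E x < top" for x n
  proof -
    let ?D = "density (count_space UNIV) (\<lambda>k. g (x + lattice_point b n - lattice_point b k))"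
    have D: "(\<integral>\<^sup>+k. h k \<partial>?D) = (\<integral>\<^sup>+k. h k * g (x + lattice_point b n - lattice_point b k) \<partial>count_space UNIV)" for h
      by (subst nn_integral_density) (auto simp: mult.commute)
    \<comment> \<open>By periodicity the total weight at a point of the cell with index
      \<open>n\<close> is that at the corresponding point of the base cell.\<close>
    have W: "emeasure ?D UNIV = ?E x"
      using nn_syn_1_periodic[of b g x n] by (simp add: emeasure_density nn_syn_def)
    have "epowr (\<integral>\<^sup>+k. s k \<partial>?D) q \<le> epowr (emeasure ?D (space ?D)) (q - 1) * (\<integral>\<^sup>+k. epowr (s k) q \<partial>?D)"
      using finite that by (intro epowr_nn_integral_le) (simp_all add: W)
    then show ?thesis by (simp add: D W nn_syn_def)
  qed
  \<comment> \<open>For fixed \<open>k\<close> the sum over the cells \<open>n\<close> runs through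
    the whole lattice and so reproduces the periodic sum, whatever \<open>k\<close> is.\<close>
  have sum: "(\<integral>\<^sup>+n. \<integral>\<^sup>+k. epowr (s k) q * g (x + lattice_point b n - lattice_point b k) \<partial>count_space UNIV \<partial>count_space UNIV)
      = (\<integral>\<^sup>+k. epowr (s k) q \<partial>count_space UNIV) * ?E x" for x
  proof -
    have "(\<integral>\<^sup>+n. \<integral>\<^sup>+k. epowr (s k) q * g (x + lattice_point b n - lattice_point b k) \<partial>count_space UNIV \<partial>count_space UNIV)
        = (\<integral>\<^sup>+k. \<integral>\<^sup>+n. epowr (s k) q * g (x + lattice_point b n - lattice_point b k) \<partial>count_space UNIV \<partial>count_space UNIV)"
      by (rule nn_integral_count_space_nn_integral[OF cnt]) simp
    also have "\<dots> = (\<integral>\<^sup>+k. epowr (s k) q * ?E x \<partial>count_space UNIV)"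
    proof (rule nn_integral_cong)
      fix k :: "int ^ 'n"
      have "(\<integral>\<^sup>+n. g (x + lattice_point b n - lattice_point b k) \<partial>count_space UNIV)
          = (\<integral>\<^sup>+n. g (x - lattice_point b (k - n)) \<partial>count_space UNIV)"
        by (simp add: lattice_point_diff algebra_simps)
      also have "\<dots> = ?E x"
        unfolding nn_syn_def by (subst nn_integral_count_space_reflect) simp
      finally show "(\<integral>\<^sup>+n. epowr (s k) q * g (x + lattice_point b n - lattice_point b k) \<partial>count_space UNIV) = epowr (s k) q * ?E x"
        by (simp add: nn_integral_cmult)
    qed
    also have "\<dots> = (\<integral>\<^sup>+k. epowr (s k) q \<partial>count_space UNIV) * ?E x"
      by (simp add: nn_integral_multc)
    finally show ?thesis .
  qed
  have "(\<integral>\<^sup>+x. epowr (nn_syn b s g x) q \<partial>lborel)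
      = (\<integral>\<^sup>+n. \<integral>\<^sup>+x. epowr (nn_syn b s g (x + lattice_point b n)) q \<partial>?C \<partial>count_space UNIV)"
    by (rule nn_integral_tiling[OF b]) measurable
  also have "\<dots> \<le> (\<integral>\<^sup>+n. \<integral>\<^sup>+x. epowr (?E x) (q - 1) * (\<integral>\<^sup>+k. epowr (s k) q * g (x + lattice_point b n - lattice_point b k) \<partial>count_space UNIV) \<partial>?C \<partial>count_space UNIV)"
    using E pt by (intro nn_integral_mono nn_integral_mono_AE) (auto elim!: eventually_mono)
  also have "\<dots> = (\<integral>\<^sup>+x. \<integral>\<^sup>+n. epowr (?E x) (q - 1) * (\<integral>\<^sup>+k. epowr (s k) q * g (x + lattice_point b n - lattice_point b k) \<partial>count_space UNIV) \<partial>count_space UNIV \<partial>?C)"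
  proof (rule nn_integral_count_space_nn_integral[OF cnt, symmetric])
    fix n :: "int ^ 'n"
    have [measurable]: "(\<lambda>x. \<integral>\<^sup>+k. epowr (s k) q * g (x + lattice_point b n - lattice_point b k) \<partial>count_space UNIV) \<in> borel_measurable borel"
      by (rule borel_measurable_nn_integral_count_space[OF cnt]) measurable
    show "(\<lambda>x. epowr (?E x) (q - 1) * (\<integral>\<^sup>+k. epowr (s k) q * g (x + lattice_point b n - lattice_point b k) \<partial>count_space UNIV)) \<in> borel_measurable ?C"
      by measurable
  qed
  also have "\<dots> = (\<integral>\<^sup>+x. epowr (?E x) (q - 1) * ((\<integral>\<^sup>+k. epowr (s k) q \<partial>count_space UNIV) * ?E x) \<partial>?C)"
    by (simp add: nn_integral_cmult sum)
  also have "\<dots> = (\<integral>\<^sup>+x. (\<integral>\<^sup>+k. epowr (s k) q \<partial>count_space UNIV) * epowr (?E x) q \<partial>?C)"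
  proof (rule nn_integral_cong_AE)
    show "AE x in ?C. epowr (?E x) (q - 1) * ((\<integral>\<^sup>+k. epowr (s k) q \<partial>count_space UNIV) * ?E x)
        = (\<integral>\<^sup>+k. epowr (s k) q \<partial>count_space UNIV) * epowr (?E x) q"
      using E
    proof eventually_elim
      case (elim x)
      then obtain e where e: "?E x = ennreal e" "0 \<le> e" by (cases "?E x") auto
      have eq: "epowr (?E x) (q - 1) * ?E x = epowr (?E x) q"
        using e by (cases "e = 0") (auto simp: epowr_ennreal ennreal_mult[symmetric] powr_diff)
      have "epowr (?E x) (q - 1) * (c * ?E x) = c * (epowr (?E x) (q - 1) * ?E x)" for c
        by (simp add: mult_ac)
      then show ?case unfolding eq .
    qed
  qed
  also have "\<dots> = epowr (Lp_enorm p (count_space UNIV) s * Lp_enorm p ?C ?E) q"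
    using finite by (simp add: nn_integral_cmult epowr_mult epowr_Lp_enorm)
  finally show ?thesis using finite Lp_enorm_leI by blast
qed

section \<open>Synthesis at one scale commutes with lattice differences and averages\<close>

abbreviation norm_syn :: "real ^ 'n ^ 'n::finite \<Rightarrow> (int ^ 'n \<Rightarrow> complex) \<Rightarrow> (real ^ 'n \<Rightarrow> complex) \<Rightarrow> real ^ 'n \<Rightarrow> ennreal"
  where "norm_syn b c f \<equiv> nn_syn b (\<lambda>k. ennreal (norm (c k))) (\<lambda>x. ennreal (norm (f x)))"

text \<open>L^p control of the sum of absolute values. It justifies exchanging the lattice sum with
  averages and shifts of the index, and it is inherited by averages of \<open>f\<close>.\<close>

definition Lp_synthesizable :: "ennreal \<Rightarrow> real ^ 'n ^ 'n::finite \<Rightarrow> (int ^ 'n \<Rightarrow> complex) \<Rightarrow> (real ^ 'n \<Rightarrow> complex) \<Rightarrow> bool"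
  where "Lp_synthesizable p b c f \<longleftrightarrow> f \<in> borel_measurable borel \<and> Lp_enorm p lborel (norm_syn b c f) < top"

lemma norm_syn_measurable [measurable]:
  "f \<in> borel_measurable borel \<Longrightarrow> norm_syn b c f \<in> borel_measurable borel"
  by (rule nn_syn_measurable) measurable

lemma AE_norm_syn:
  assumes "1 \<le> p" "Lp_synthesizable p b c f"
  shows "AE x in lborel. norm_syn b c f x < top"
  using assms norm_syn_measurable[of f b c]
  by (intro Lp_enorm_less_top_AE[of p]) (auto simp: Lp_synthesizable_def)

lemma borel_Lp_syn:
  assumes "1 \<le> p" "Lp_synthesizable p b c f"
  shows "borel_Lp p (syn b c f)" "Lp_borel_norm p (syn b c f) \<le> Lp_enorm p lborel (norm_syn b c f)"
proof -
  have f: "f \<in> borel_measurable borel" using assms by (simp add: Lp_synthesizable_def)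
  have m: "(\<lambda>x. ennreal (norm (syn b c f x))) \<in> borel_measurable lborel"
    using syn_measurable[OF f] by measurable
  show le: "Lp_borel_norm p (syn b c f) \<le> Lp_enorm p lborel (norm_syn b c f)"
    by (rule Lp_enorm_mono_AE[OF assms(1) m]) (rule AE_I2, rule norm_syn_le)
  show "borel_Lp p (syn b c f)"
    using le_less_trans[OF le] assms syn_measurable[OF f] by (simp add: borel_Lp_def Lp_synthesizable_def)
qed

text \<open>Summation by parts: a translation by one lattice step is absorbed by a shift of the
  summation index, at points where both sums converge absolutely.\<close>

lemma syn_cell_diff:
  assumes p: "1 \<le> p" "Lp_synthesizable p b c f"
  shows "AE x in lborel. cell_diff b t (syn b c f) x = syn b (diff_op t c) f x"
  using AE_norm_syn[OF p] AE_lborel_translate[OF AE_norm_syn[OF p], of "- (b *v axis t 1)"]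
proof eventually_elim
  case (elim x)
  have i1: "integrable (count_space UNIV) (\<lambda>k. c k * f (x - lattice_point b k))"
    using elim(1) by (rule integrable_syn)
  have i2: "integrable (count_space UNIV) (\<lambda>k. c k * f (x - b *v axis t 1 - lattice_point b k))"
    using elim(2) by (intro integrable_syn) simp
  have bij: "bij (\<lambda>k :: int ^ 'a. k - axis t 1)"
    using bij_plus_right[of "- axis t 1 :: int ^ 'a"] by simp
  have shift: "c (k - axis t 1) * f (x - b *v axis t 1 - lattice_point b (k - axis t 1))
      = c (k - axis t 1) * f (x - lattice_point b k)" for k
    by (simp add: lattice_point_diff lattice_point_axis)
  have "syn b c f (x - b *v axis t 1) = (LINT k|count_space UNIV. c (k - axis t 1) * f (x - b *v axis t 1 - lattice_point b (k - axis t 1)))"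
    unfolding syn_def by (rule integral_bij_count_space[OF bij, symmetric])
  then have s2: "syn b c f (x - b *v axis t 1) = (LINT k|count_space UNIV. c (k - axis t 1) * f (x - lattice_point b k))"
    by (simp only: shift)
  have i3: "integrable (count_space UNIV) (\<lambda>k. c (k - axis t 1) * f (x - lattice_point b k))"
    using i2 integrable_bij_count_space[OF bij, of "\<lambda>k. c k * f (x - b *v axis t 1 - lattice_point b k)"]
    by (simp only: shift)
  have "cell_diff b t (syn b c f) x = syn b c f x - syn b c f (x - b *v axis t 1)"
    by (simp add: cell_diff_def)
  also have "\<dots> = (LINT k|count_space UNIV. c k * f (x - lattice_point b k) - c (k - axis t 1) * f (x - lattice_point b k))"
    unfolding s2 unfolding syn_def by (rule Bochner_Integration.integral_diff[OF i1 i3, symmetric])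
  also have "\<dots> = syn b (diff_op t c) f x"
    by (simp add: syn_def diff_op_def left_diff_distrib)
  finally show ?case .
qed

lemma nn_syn_mono: "(\<And>x. g x \<le> h x) \<Longrightarrow> nn_syn b s g x \<le> nn_syn b s h x"
  unfolding nn_syn_def by (intro nn_integral_mono mult_left_mono) auto

context
  fixes \<mu> :: "(real ^ 'n::finite) measure" and b :: "real ^ 'n ^ 'n"
  assumes \<mu>: "borel_prob_space \<mu>"
begin

interpretation borel_prob_space \<mu> by (rule \<mu>)

lemma nn_syn_nn_avg:
  assumes [measurable]: "g \<in> borel_measurable borel"
  shows "nn_syn b s (nn_avg \<mu> g) x = nn_avg \<mu> (nn_syn b s g) x"
proof -
  have cnt: "countable (UNIV :: (int ^ 'n) set)" by simp
  have "nn_syn b s (nn_avg \<mu> g) x = (\<integral>\<^sup>+k. \<integral>\<^sup>+y. s k * g (x - y - lattice_point b k) \<partial>\<mu> \<partial>count_space UNIV)"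
    unfolding nn_syn_def nn_avg_def by (subst nn_integral_cmult[symmetric]) (simp_all add: algebra_simps)
  also have "\<dots> = (\<integral>\<^sup>+y. \<integral>\<^sup>+k. s k * g (x - y - lattice_point b k) \<partial>count_space UNIV \<partial>\<mu>)"
    by (rule nn_integral_count_space_nn_integral[OF cnt, symmetric]) measurable
  finally show ?thesis by (simp add: nn_syn_def nn_avg_def)
qed

lemma norm_syn_avg_le:
  assumes [measurable]: "f \<in> borel_measurable borel"
  shows "norm_syn b c (avg \<mu> f) x \<le> nn_avg \<mu> (norm_syn b c f) x"
proof -
  have "norm_syn b c (avg \<mu> f) x \<le> nn_syn b (\<lambda>k. ennreal (norm (c k))) (nn_avg \<mu> (\<lambda>x. ennreal (norm (f x)))) x"
    by (intro nn_syn_mono norm_avg_le)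
  also have "\<dots> = nn_avg \<mu> (norm_syn b c f) x" by (rule nn_syn_nn_avg) measurable
  finally show ?thesis .
qed

lemma Lp_synthesizable_avg:
  assumes "1 \<le> p" "Lp_synthesizable p b c f"
  shows "Lp_synthesizable p b c (avg \<mu> f)"
proof -
  have f: "f \<in> borel_measurable borel" using assms by (simp add: Lp_synthesizable_def)
  note m = norm_syn_measurable[OF avg_measurable[OF f], of b c]
  have "Lp_enorm p lborel (norm_syn b c (avg \<mu> f)) \<le> Lp_enorm p lborel (nn_avg \<mu> (norm_syn b c f))"
    using m by (intro Lp_enorm_mono_AE[OF assms(1)] AE_I2 norm_syn_avg_le[OF f]) simp
  also have "\<dots> \<le> Lp_enorm p lborel (norm_syn b c f)"
    by (rule Lp_enorm_nn_avg_le[OF assms(1) norm_syn_measurable[OF f]])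
  also have "\<dots> < top" using assms by (simp add: Lp_synthesizable_def)
  finally show ?thesis using avg_measurable[OF f] by (simp add: Lp_synthesizable_def)
qed

text \<open>Fubini for counting measure times \<open>\<mu>\<close>, valid at each point where the
  average of the absolute sum is finite.\<close>

lemma syn_avg:
  assumes p: "1 \<le> p" "Lp_synthesizable p b c f"
  shows "AE x in lborel. syn b c (avg \<mu> f) x = avg \<mu> (syn b c f) x"
proof -
  have cnt: "countable (UNIV :: (int ^ 'n) set)" by simp
  have f[measurable]: "f \<in> borel_measurable borel" using p by (simp add: Lp_synthesizable_def)
  interpret K: sigma_finite_measure "count_space (UNIV :: (int ^ 'n) set)"
    using cnt by (rule sigma_finite_measure_count_space_countable)
  interpret KM: pair_sigma_finite "count_space (UNIV :: (int ^ 'n) set)" \<mu> ..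
  have "Lp_enorm p lborel (nn_avg \<mu> (norm_syn b c f)) < top"
    using le_less_trans[OF Lp_enorm_nn_avg_le[OF p(1) norm_syn_measurable[OF f]]] p(2)
    by (simp add: Lp_synthesizable_def)
  then have "AE x in lborel. nn_avg \<mu> (norm_syn b c f) x < top"
    using nn_avg_measurable[OF norm_syn_measurable[OF f]] by (intro Lp_enorm_less_top_AE[OF p(1)]) auto
  then show ?thesis
  proof eventually_elim
    case (elim x)
    have "(\<lambda>(k, y). c k * f (x - y - lattice_point b k)) \<in> borel_measurable (count_space UNIV \<Otimes>\<^sub>M \<mu>)"
      using cnt by (intro measurable_pair_measure_countable1) auto
    then have int: "integrable (count_space UNIV \<Otimes>\<^sub>M \<mu>) (\<lambda>(k, y). c k * f (x - y - lattice_point b k))"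
    proof (rule integrableI_bounded)
      have "(\<integral>\<^sup>+z. ennreal (norm (case z of (k, y) \<Rightarrow> c k * f (x - y - lattice_point b k))) \<partial>(count_space UNIV \<Otimes>\<^sub>M \<mu>))
          = (\<integral>\<^sup>+k. \<integral>\<^sup>+y. ennreal (norm (c k * f (x - y - lattice_point b k))) \<partial>\<mu> \<partial>count_space UNIV)"
        using cnt by (subst nn_integral_fst[symmetric]) (auto intro!: measurable_pair_measure_countable1)
      also have "\<dots> = (\<integral>\<^sup>+y. \<integral>\<^sup>+k. ennreal (norm (c k * f (x - y - lattice_point b k))) \<partial>count_space UNIV \<partial>\<mu>)"
        by (rule nn_integral_count_space_nn_integral[OF cnt, symmetric]) measurable
      also have "\<dots> = nn_avg \<mu> (norm_syn b c f) x"
        by (simp add: nn_avg_def nn_syn_norm)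
      also have "\<dots> < \<infinity>" using elim by simp
      finally show "(\<integral>\<^sup>+z. ennreal (norm (case z of (k, y) \<Rightarrow> c k * f (x - y - lattice_point b k))) \<partial>(count_space UNIV \<Otimes>\<^sub>M \<mu>)) < \<infinity>" .
    qed
    have "syn b c (avg \<mu> f) x = (LINT k|count_space UNIV. LINT y|\<mu>. c k * f (x - y - lattice_point b k))"
      by (simp add: syn_def avg_def algebra_simps)
    also have "\<dots> = (LINT y|\<mu>. LINT k|count_space UNIV. c k * f (x - y - lattice_point b k))"
      by (rule KM.Fubini_integral[symmetric]) (rule int)
    finally show ?case by (simp add: syn_def avg_def)
  qed
qed

text \<open>The smoothing of the generator is thereby transferred to the whole sum, where
  derivatives become lattice differences that fall on the coefficients.\<close>

lemma syn_avg_pow: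
  assumes p: "1 \<le> p" "Lp_synthesizable p b c f"
  shows "Lp_synthesizable p b c ((avg \<mu> ^^ n) f) \<and>
    (AE x in lborel. syn b c ((avg \<mu> ^^ n) f) x = (avg \<mu> ^^ n) (syn b c f) x)"
proof (induction n)
  case (Suc n)
  let ?G = "(avg \<mu> ^^ n) f"
  have S: "Lp_synthesizable p b c ?G" using Suc.IH by simp
  have G: "?G \<in> borel_measurable borel" using S by (simp add: Lp_synthesizable_def)
  have L: "borel_Lp p ((avg \<mu> ^^ n) (syn b c f))"
    using \<mu> p(1) borel_Lp_syn(1)[OF p] by (rule avg_pow_borel_Lp)
  have "AE x in lborel. avg \<mu> (syn b c ?G) x = avg \<mu> ((avg \<mu> ^^ n) (syn b c f)) x"
    using Suc.IH by (intro avg_cong_AE[OF syn_measurable[OF G] borel_Lp_measurable[OF L]]) simp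
  with syn_avg[OF p(1) S] have "AE x in lborel. syn b c (avg \<mu> ?G) x = avg \<mu> ((avg \<mu> ^^ n) (syn b c f)) x"
    by eventually_elim simp
  then show ?case using Lp_synthesizable_avg[OF p(1) S] by simp
qed (use p in simp)

end

section \<open>Norms of iterated lattice differences of a synthesized function\<close>

context
  fixes p :: ennreal and b :: "real ^ 'n ^ 'n::finite" and \<eta> :: "real ^ 'n \<Rightarrow> complex" and N :: ennreal
  assumes p: "1 \<le> p" and b: "invertible b" and \<eta>: "\<eta> \<in> borel_measurable borel"
    and N: "N = Lp_enorm p (cell_lborel b) (nn_syn b (\<lambda>_. 1) (\<lambda>x. ennreal (norm (\<eta> x))))"
    and N_fin: "N < top"
begin

lemma Lp_norm_syn_le: "Lp_enorm p lborel (norm_syn b c \<eta>) \<le> lp_seq_norm p c * N"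
proof -
  have "Lp_enorm p lborel (norm_syn b c \<eta>) \<le> Lp_enorm p (count_space UNIV) (\<lambda>k. ennreal (norm (c k))) * N"
    using p b \<eta> N_fin unfolding N by (intro Lp_enorm_nn_syn_le) auto
  then show ?thesis using lp_seq_norm_eq[of p c] p by simp
qed

lemma Lp_synthesizableI:
  assumes "lp_seq_norm p c < top"
  shows "Lp_synthesizable p b c \<eta>"
  using le_less_trans[OF Lp_norm_syn_le, of c] assms N_fin \<eta>
  by (simp add: Lp_synthesizable_def ennreal_mult_less_top)

text \<open>Formulated for any \<open>h\<close> that agrees almost everywhere with the synthesized
  function, because already after one difference the identification with
  \<open>syn b (diff_op t c) \<eta>\<close> holds only almost everywhere.\<close>

lemma Lp_fold_cell_diff_le:
  assumes "lp_seq_norm p c < top" "h \<in> borel_measurable borel" "AE x in lborel. h x = syn b c \<eta> x"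
  shows "Lp_borel_norm p (fold (cell_diff b) ts h) \<le> lp_seq_norm p (fold diff_op ts c) * N"
  using assms
proof (induction ts arbitrary: c h)
  case Nil
  note S = Lp_synthesizableI[OF Nil(1)]
  have "Lp_borel_norm p h = Lp_borel_norm p (syn b c \<eta>)"
    using borel_Lp_cong_AE(2)[OF p borel_Lp_syn(1)[OF p S] Nil(2)] Nil(3) by (simp add: eq_commute)
  also have "\<dots> \<le> Lp_enorm p lborel (norm_syn b c \<eta>)" using p S by (rule borel_Lp_syn)
  also have "\<dots> \<le> lp_seq_norm p c * N" by (rule Lp_norm_syn_le)
  finally show ?case by simp
next
  case (Cons t ts)
  have fin: "lp_seq_norm p (diff_op t c) < top"
    using le_less_trans[OF lp_seq_norm_diff_op_le[OF p, of t c]] Cons.prems(1) by simp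
  have ae: "AE x in lborel. cell_diff b t h x = syn b (diff_op t c) \<eta> x"
    using cell_diff_cong_AE[OF Cons.prems(3), of b t] syn_cell_diff[OF p Lp_synthesizableI[OF Cons.prems(1)], of t]
    by eventually_elim simp
  show ?case using Cons.IH[OF fin cell_diff_measurable[OF Cons.prems(2)] ae] by simp
qed

end

section \<open>From directional bounds to Sobolev norms\<close>

lemma borel_measurable_lebesgue_cong_AE:
  fixes f g :: "'a::euclidean_space \<Rightarrow> 'b::topological_space"
  assumes g: "g \<in> borel_measurable lebesgue" and ae: "AE x in lebesgue. f x = g x"
  shows "f \<in> borel_measurable lebesgue"
proof (rule measurableI)
  fix A :: "'b set" assume "A \<in> sets borel"
  then have A: "g -` A \<inter> space lebesgue \<in> sets lebesgue" using g by (rule measurable_sets[rotated])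
  show "f -` A \<inter> space lebesgue \<in> sets lebesgue"
    by (rule completion.in_sets_AE[OF _ A]) (use ae in \<open>auto elim!: eventually_mono\<close>)
qed simp

text \<open>\<open>g\<close> may fail to be Borel; completeness of Lebesgue measure makes it
  measurable, and the norm depends on its class only.\<close>

lemma Lp_enorm_lebesgue:
  assumes p: "1 \<le> p" and m: "g' \<in> borel_measurable borel" and ae: "AE x in lborel. g x = g' x"
  shows "Lp_enorm p lebesgue g = Lp_enorm p lborel g'"
proof -
  have "g \<in> borel_measurable lebesgue"
    using m ae by (intro borel_measurable_lebesgue_cong_AE[of g' g]) (auto simp: AE_completion measurable_completion)
  from p show ?thesis
  proof (cases rule: exponent_cases)
    case infinite
    have "(AE x in lborel. g x \<le> z) \<longleftrightarrow> (AE x in lborel. g' x \<le> z)" for z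
      by (rule eventually_subst) (use ae in \<open>auto elim!: eventually_mono\<close>)
    then show ?thesis using \<open>g \<in> _\<close> m
      by (simp add: infinite Lp_enorm_infinity esssup_eq_AE AE_completion_iff)
  next
    case (finite q)
    have "(\<integral>\<^sup>+x. epowr (g x) q \<partial>lborel) = (\<integral>\<^sup>+x. epowr (g' x) q \<partial>lborel)"
      using ae by (intro nn_integral_cong_AE) (auto elim!: eventually_mono)
    then show ?thesis using finite by (simp add: Lp_enorm_ennreal nn_integral_completion)
  qed
qed

lemma Lp_enorm_lebesgue_on:
  fixes S :: "'a::euclidean_space set"
  assumes p: "1 \<le> p" and m[measurable]: "g' \<in> borel_measurable borel" and ae: "AE x in lborel. g x = g' x"
    and S[measurable]: "S \<in> sets borel"
  shows "Lp_enorm p (lebesgue_on S) g = Lp_enorm p (density lborel (indicator S)) g'"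
proof -
  have g: "g \<in> borel_measurable lebesgue"
    using m ae by (intro borel_measurable_lebesgue_cong_AE[of g' g]) (auto simp: AE_completion measurable_completion)
  have S': "S \<in> sets lebesgue" using S by simp
  from p show ?thesis
  proof (cases rule: exponent_cases)
    case infinite
    have "(AE x in lebesgue_on S. g x \<le> z) \<longleftrightarrow> (AE x in lborel. x \<in> S \<longrightarrow> g x \<le> z)" for z
      using S' by (subst AE_restrict_space_iff) (auto simp: AE_completion_iff)
    also have "\<dots> z \<longleftrightarrow> (AE x in lborel. x \<in> S \<longrightarrow> g' x \<le> z)" for z
      by (rule eventually_subst) (use ae in \<open>auto elim!: eventually_mono\<close>)
    also have "\<dots> z \<longleftrightarrow> (AE x in density lborel (indicator S). g' x \<le> z)" for z
      by (subst AE_density) (auto simp: indicator_def)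
    finally have "(AE x in lebesgue_on S. g x \<le> z) \<longleftrightarrow> (AE x in density lborel (indicator S). g' x \<le> z)" for z .
    then show ?thesis using g m
      by (simp add: infinite Lp_enorm_infinity esssup_eq_AE measurable_restrict_space1)
  next
    case (finite q)
    have "(\<integral>\<^sup>+x. epowr (g x) q \<partial>lebesgue_on S) = (\<integral>\<^sup>+x. epowr (g x) q * indicator S x \<partial>lebesgue)"
      using S' by (subst nn_integral_restrict_space) auto
    also have "\<dots> = (\<integral>\<^sup>+x. epowr (g x) q * indicator S x \<partial>lborel)" by (rule nn_integral_completion)
    also have "\<dots> = (\<integral>\<^sup>+x. indicator S x * epowr (g' x) q \<partial>lborel)"
      using ae by (intro nn_integral_cong_AE) (auto elim!: eventually_mono simp: mult.commute)
    also have "\<dots> = (\<integral>\<^sup>+x. epowr (g' x) q \<partial>density lborel (indicator S))"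
      by (subst nn_integral_density) auto
    finally show ?thesis using finite by (simp add: Lp_enorm_ennreal)
  qed
qed

lemma Lp_norm_eq:
  assumes "1 \<le> p" "borel_Lp p f" "AE x in lborel. F x = f x"
  shows "Lp_norm p F = Lp_borel_norm p f" "F \<in> Lp_space p"
proof -
  show eq: "Lp_norm p F = Lp_borel_norm p f"
    unfolding Lp_norm_def using assms
    by (intro Lp_enorm_lebesgue) (auto simp: borel_Lp_def elim!: eventually_mono)
  have "F \<in> borel_measurable lebesgue"
    using assms by (intro borel_measurable_lebesgue_cong_AE[of f F])
      (auto simp: AE_completion measurable_completion borel_Lp_def)
  then show "F \<in> Lp_space p" using eq assms by (simp add: Lp_space_def borel_Lp_def)
qed

lemma locally_integrable_of_Lp:
  fixes f :: "real ^ 'n::finite \<Rightarrow> complex"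
  assumes "1 \<le> p" "borel_Lp p f" "AE x in lborel. F x = f x"
  shows "locally_integrable F"
  unfolding locally_integrable_def set_integrable_def
proof (intro allI impI)
  fix K :: "(real ^ 'n) set" assume K: "compact K"
  have [measurable]: "f \<in> borel_measurable borel" using assms by (simp add: borel_Lp_def)
  have K'[measurable]: "K \<in> sets borel" using K by (simp add: borel_compact)
  obtain R where R: "\<And>x. x \<in> K \<Longrightarrow> norm x \<le> R"
    using compact_imp_bounded[OF K] by (auto simp: bounded_iff)
  have "norm (indicator K x :: complex) \<le> 1 \<and> (norm x > R \<longrightarrow> indicator K x = (0 :: complex))" for x
    using R[of x] by (auto simp: indicator_def)
  then have "compactly_bounded (\<lambda>x. indicator K x :: complex)"
    unfolding compactly_bounded_def by (intro conjI exI[of _ "1 :: real"] exI[of _ R]) auto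
  from compactly_bounded_integrable[OF assms(1,2) this]
  have "integrable lborel (\<lambda>x. indicator K x *\<^sub>R f x)"
    by (rule Bochner_Integration.integrable_cong[THEN iffD1, rotated -1]) (auto simp: indicator_def)
  then have "integrable lebesgue (\<lambda>x. indicator K x *\<^sub>R f x)"
    by (subst integrable_completion) auto
  then have int: "integrable lebesgue (\<lambda>x. indicator K x *\<^sub>R f x)" .
  have F: "F \<in> borel_measurable lebesgue" using Lp_norm_eq(2)[OF assms] by (simp add: Lp_space_def)
  have meas: "(\<lambda>x. indicator K x *\<^sub>R F x) \<in> borel_measurable lebesgue"
    using F K' by (intro borel_measurable_scaleR borel_measurable_indicator) auto
  show "integrable lebesgue (\<lambda>x. indicator K x *\<^sub>R F x)"
    by (rule integrable_cong_AE_imp[OF int meas])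
      (use assms(3) in \<open>auto simp: AE_completion_iff elim!: eventually_mono\<close>)
qed

text \<open>A pointwise limit of the restrictions to balls, which are integrable and hence
  measurable.\<close>

lemma locally_integrable_measurable:
  fixes f :: "real ^ 'n::finite \<Rightarrow> complex"
  assumes "locally_integrable f"
  shows "f \<in> borel_measurable lebesgue"
proof (rule borel_measurable_LIMSEQ_metric)
  fix n :: nat
  have "integrable lebesgue (\<lambda>x. indicator (cball 0 (real n)) x *\<^sub>R f x)"
    using assms by (simp add: locally_integrable_def set_integrable_def)
  then show "(\<lambda>x. indicator (cball 0 (real n)) x *\<^sub>R f x) \<in> borel_measurable lebesgue" by auto
next
  fix x
  have "\<forall>\<^sub>F n in sequentially. indicator (cball 0 (real n)) x *\<^sub>R f x = f x"
    using eventually_ge_at_top[of "nat \<lceil>norm x\<rceil>"]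
    by eventually_elim (auto simp: indicator_def) 
  then show "(\<lambda>n. indicator (cball 0 (real n)) x *\<^sub>R f x) \<longlonglongrightarrow> f x"
    by (rule tendsto_eventually)
qed

lemma integral_lebesgue_eq:
  fixes f g :: "'a::euclidean_space \<Rightarrow> complex"
  assumes "g \<in> borel_measurable borel" "AE x in lborel. f x = g x"
  shows "(LINT x|lebesgue. f x) = (LINT x|lborel. g x)"
proof -
  have "f \<in> borel_measurable lebesgue"
    using assms by (intro borel_measurable_lebesgue_cong_AE[of g f]) (auto simp: AE_completion measurable_completion)
  then have "(LINT x|lebesgue. f x) = (LINT x|lebesgue. g x)"
    using assms by (intro integral_cong_AE) (auto simp: AE_completion measurable_completion)
  also have "\<dots> = (LINT x|lborel. g x)" using assms by (intro integral_completion) auto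
  finally show ?thesis .
qed

text \<open>The fundamental lemma for Lebesgue functions: the difference is replaced by a Borel
  representative, which has the same integrals against test functions.\<close>

lemma locally_integrable_diff_zero:
  fixes g g' :: "real ^ 'n::finite \<Rightarrow> complex"
  assumes li: "locally_integrable g" "locally_integrable g'"
    and eq: "\<And>\<phi>. \<phi> \<in> test_functions \<Longrightarrow> (LINT x|lebesgue. g x * \<phi> x) = (LINT x|lebesgue. g' x * \<phi> x)"
  shows "AE x in lborel. g x = g' x"
proof -
  define h where "h x = g x - g' x" for x
  have hK: "integrable lebesgue (\<lambda>x. indicator K x *\<^sub>R h x)" if "compact K" for K
    using li that unfolding locally_integrable_def set_integrable_def h_def
    by (simp add: scaleR_diff_right)
  have "locally_integrable h" unfolding locally_integrable_def set_integrable_def using hK by blast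
  then obtain k where k[measurable]: "k \<in> borel_measurable borel" and hk: "AE x in lborel. h x = k x"
    using lebesgue_measurable_borel_representative locally_integrable_measurable by metis
  have "AE x in lborel. k x = 0"
  proof (rule fundamental_lemma_lborel[OF k])
    fix a b :: "real ^ 'n"
    have meas: "(\<lambda>x. indicator (cbox a b) x *\<^sub>R k x) \<in> borel_measurable lebesgue"
      by (rule measurable_completion) simp
    have "integrable lebesgue (\<lambda>x. indicator (cbox a b) x *\<^sub>R k x)"
      by (rule integrable_cong_AE_imp[OF hK[OF compact_cbox] meas])
        (use hk in \<open>auto simp: AE_completion_iff elim!: eventually_mono\<close>)
    then show "set_integrable lborel (cbox a b) k"
      unfolding set_integrable_def by (subst (asm) integrable_completion) auto
  next
    fix \<phi> :: "real ^ 'n \<Rightarrow> complex" assume \<phi>: "\<phi> \<in> test_functions"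
    note [measurable] = test_functions_borel[OF \<phi>]
    obtain R B where R: "\<And>x. norm x > R \<Longrightarrow> \<phi> x = 0" and B: "\<And>x. norm (\<phi> x) \<le> B"
      using test_functions_support[OF \<phi>] test_functions_bounded[OF \<phi>] by metis
    \<comment> \<open>The product is dominated by \<open>B\<close> times |g| on the ball of radius
      \<open>R\<close>, which allows the two integrals to be subtracted.\<close>
    have int: "integrable lebesgue (\<lambda>x. g x * \<phi> x)" if g: "locally_integrable g" for g
    proof (rule Bochner_Integration.integrable_bound[of _ "\<lambda>x. B * norm (indicator (cball 0 R) x *\<^sub>R g x)"])
      show "integrable lebesgue (\<lambda>x. B * norm (indicator (cball 0 R) x *\<^sub>R g x))"
        using g by (intro integrable_mult_right integrable_norm) (simp add: locally_integrable_def set_integrable_def)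
      show "(\<lambda>x. g x * \<phi> x) \<in> borel_measurable lebesgue"
        using locally_integrable_measurable[OF g] by (intro borel_measurable_times) (simp_all add: measurable_completion)
      show "AE x in lebesgue. norm (g x * \<phi> x) \<le> norm (B * norm (indicator (cball 0 R) x *\<^sub>R g x))"
      proof (rule AE_I2)
        fix x
        have "0 \<le> B" using B[of x] norm_ge_zero[of "\<phi> x"] by linarith
        then show "norm (g x * \<phi> x) \<le> norm (B * norm (indicator (cball 0 R) x *\<^sub>R g x))"
          using R[of x] mult_left_mono[OF B[of x], of "norm (g x)"]
          by (cases "norm x > R") (auto simp: norm_mult indicator_def mult.commute)
      qed
    qed
    have "(LINT x|lborel. k x * \<phi> x) = (LINT x|lebesgue. h x * \<phi> x)"
      using hk by (intro integral_lebesgue_eq[symmetric]) (auto elim!: eventually_mono)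
    also have "\<dots> = (LINT x|lebesgue. g x * \<phi> x) - (LINT x|lebesgue. g' x * \<phi> x)"
      using int[OF li(1)] int[OF li(2)] by (simp add: h_def left_diff_distrib)
    finally show "(LINT x|lborel. k x * \<phi> x) = 0" using eq[OF \<phi>] by simp
  qed
  with hk show ?thesis by eventually_elim (simp add: h_def)
qed

lemma is_weak_deriv_unique:
  assumes "is_weak_deriv \<rho> f g" "is_weak_deriv \<rho> f g'"
  shows "AE x in lborel. g x = g' x"
  using assms unfolding is_weak_deriv_def by (intro locally_integrable_diff_zero) auto

text \<open>The head of the list is the outermost derivative in \<open>foldr\<close>, so the first
  integration by parts takes the remaining derivatives of \<open>\<phi>\<close> as its test
  function. Each step contributes one sign.\<close>

lemma dir_sobolev_list_deriv:
  "dir_sobolev p n \<kappa> f \<Longrightarrow> length ts \<le> n \<Longrightarrow>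
    \<exists>g. borel_Lp p g \<and> Lp_borel_norm p g \<le> \<kappa> (map (\<lambda>t. axis t 1) ts) \<and>
      (\<forall>\<phi>\<in>test_functions. (LINT x|lborel. f x * foldr partial_deriv ts \<phi> x)
        = (-1) ^ length ts * (LINT x|lborel. g x * \<phi> x))"
proof (induction ts arbitrary: n \<kappa> f)
  case Nil
  then show ?case using dir_sobolevD[OF Nil(1)] by (intro exI[of _ f]) auto
next
  case (Cons t ts)
  then obtain k where n: "n = Suc k" "length ts \<le> k" by (cases n) auto
  obtain g where g: "weak_dir_deriv (axis t 1) f g" "dir_sobolev p k (\<lambda>vs. \<kappa> (axis t 1 # vs)) g"
    using Cons.prems(1) unfolding n by auto
  obtain h where h: "borel_Lp p h" "Lp_borel_norm p h \<le> \<kappa> (axis t 1 # map (\<lambda>t. axis t 1) ts)"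
    "\<And>\<phi>. \<phi> \<in> test_functions \<Longrightarrow> (LINT x|lborel. g x * foldr partial_deriv ts \<phi> x)
        = (-1) ^ length ts * (LINT x|lborel. h x * \<phi> x)"
    using Cons.IH[OF g(2) n(2)] by auto
  have tf: "foldr partial_deriv ts \<phi> \<in> test_functions" if "\<phi> \<in> test_functions" for \<phi> :: "real ^ 'a \<Rightarrow> complex"
    using that by (induction ts) (auto intro: test_functions_partial_deriv)
  have "(LINT x|lborel. f x * foldr partial_deriv (t # ts) \<phi> x) = (-1) ^ length (t # ts) * (LINT x|lborel. h x * \<phi> x)"
    if \<phi>: "\<phi> \<in> test_functions" for \<phi>
    using g(1) tf[OF \<phi>] h(3)[OF \<phi>] unfolding weak_dir_deriv_def by (simp add: partial_deriv_dir_deriv)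
  then show ?case using h by auto
qed

section \<open>Multiindices as words in the coordinates\<close>

definition multi_list :: "('n::finite \<Rightarrow> nat) \<Rightarrow> 'n list"
  where "multi_list \<rho> = concat (map (\<lambda>t. replicate (\<rho> t) t) coordinates)"

lemma coordinates: "distinct (coordinates :: 'n::finite list)" "set (coordinates :: 'n list) = UNIV"
proof -
  have "\<exists>ts :: 'n list. distinct ts \<and> set ts = UNIV"
    using finite_distinct_list[of "UNIV :: 'n set"] by auto
  from someI_ex[OF this] show "distinct (coordinates :: 'n list)" "set (coordinates :: 'n list) = UNIV"
    by (auto simp: coordinates_def)
qed

lemma multi_power_eq_foldr: "multi_power F \<rho> = foldr F (multi_list \<rho>)"
proof -
  have "foldr F (replicate n t) = F t ^^ n" for n t
    by (induction n) auto
  then have "foldr (\<lambda>t. F t ^^ \<rho> t) ts = foldr F (concat (map (\<lambda>t. replicate (\<rho> t) t) ts))" for ts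
    by (induction ts) auto
  then show ?thesis by (simp add: multi_power_def multi_list_def)
qed

lemma length_multi_list: "length (multi_list \<rho>) = order_of \<rho>"
proof -
  have "length (multi_list \<rho>) = sum_list (map \<rho> coordinates)"
    by (simp add: multi_list_def length_concat o_def)
  also have "\<dots> = order_of \<rho>"
    using sum_list_distinct_conv_sum_set[OF coordinates(1), of \<rho>] by (simp add: order_of_def coordinates(2))
  finally show ?thesis .
qed

text \<open>Passing from a list to its multiplicities and back changes only the order of the
  entries, which is harmless for commuting operators.\<close>

lemma mset_multi_list:
  fixes ts :: "'n::finite list"
  shows "mset (multi_list (\<lambda>t. count (mset ts) t)) = mset ts"
proof (rule multiset_eqI)
  fix s :: 'n
  have cnt: "count (mset (concat (map (\<lambda>t. replicate (r t) t) us))) s = (if s \<in> set us then r s else 0)"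
    if "distinct us" for r :: "'n \<Rightarrow> nat" and us
    using that by (induction us) auto
  show "count (mset (multi_list (\<lambda>t. count (mset ts) t))) s = count (mset ts) s"
    unfolding multi_list_def cnt[OF coordinates(1)] by (simp add: coordinates(2))
qed

lemma diff_op_commute: "diff_op s (diff_op t c) = diff_op t (diff_op s c)"
  by (simp add: diff_op_def fun_eq_iff algebra_simps)

lemma fold_diff_op_multi_list: "fold diff_op (multi_list \<rho>) c = multi_power diff_op \<rho> c"
proof -
  have "foldr diff_op (multi_list \<rho>) = fold diff_op (multi_list \<rho>)"
    by (rule foldr_fold) (auto simp: fun_eq_iff diff_op_commute)
  then show ?thesis by (simp add: multi_power_eq_foldr)
qed

lemma fold_diff_op_eq_multi_power:
  obtains \<rho> where "order_of \<rho> = length ts" "fold diff_op ts c = multi_power diff_op \<rho> c"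
proof (rule that[of "\<lambda>t. count (mset ts) t"])
  let ?\<rho> = "\<lambda>t. count (mset ts) t"
  have "fold diff_op ts = fold diff_op (multi_list ?\<rho>)"
    by (rule fold_multiset_equiv) (auto simp: fun_eq_iff diff_op_commute mset_multi_list)
  then show "fold diff_op ts c = multi_power diff_op ?\<rho> c" by (simp add: fold_diff_op_multi_list)
  show "order_of ?\<rho> = length ts"
    using arg_cong[OF mset_multi_list[of ts], of size] by (simp add: length_multi_list)
qed

lemma finite_order_of_le: "finite {\<rho> :: 'n::finite \<Rightarrow> nat. order_of \<rho> \<le> m}"
proof (rule finite_subset)
  have "\<rho> t \<le> order_of \<rho>" for \<rho> :: "'n \<Rightarrow> nat" and t
    unfolding order_of_def by (rule member_le_sum) auto
  then show "{\<rho> :: 'n \<Rightarrow> nat. order_of \<rho> \<le> m} \<subseteq> (UNIV \<rightarrow>\<^sub>E {..m})"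
    by (auto simp: PiE_def intro: order_trans)
  show "finite ((UNIV :: 'n set) \<rightarrow>\<^sub>E {..m})" by (intro finite_PiE) auto
qed

text \<open>The directional bound yields some weak derivative with the required norm. The one that
  enters \<open>sobolev_norm\<close> is chosen arbitrarily, but by uniqueness it agrees almost
  everywhere with the one found.\<close>

lemma sobolev_of_dir_sobolev:
  fixes f F :: "real ^ 'n::finite \<Rightarrow> complex"
  assumes p: "1 \<le> p" and f: "dir_sobolev p m \<kappa> f" and F: "AE x in lborel. F x = f x"
  shows "F \<in> sobolev m p"
    and "sobolev_norm m p F \<le> (\<Sum>\<rho> | order_of \<rho> \<le> m. \<kappa> (map (\<lambda>t. axis t 1) (multi_list \<rho>)))"
proof -
  have fL: "borel_Lp p f" using f by (rule dir_sobolevD)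
  have ex: "\<exists>g. borel_Lp p g \<and> Lp_borel_norm p g \<le> \<kappa> (map (\<lambda>t. axis t 1) (multi_list \<rho>)) \<and> is_weak_deriv \<rho> F g"
    if \<rho>: "order_of \<rho> \<le> m" for \<rho> :: "'n \<Rightarrow> nat"
  proof -
    obtain g where g: "borel_Lp p g" "Lp_borel_norm p g \<le> \<kappa> (map (\<lambda>t. axis t 1) (multi_list \<rho>))"
      "\<And>\<phi>. \<phi> \<in> test_functions \<Longrightarrow> (LINT x|lborel. f x * foldr partial_deriv (multi_list \<rho>) \<phi> x)
        = (-1) ^ order_of \<rho> * (LINT x|lborel. g x * \<phi> x)"
      using dir_sobolev_list_deriv[OF f, of "multi_list \<rho>"] \<rho> by (auto simp: length_multi_list)
    have "is_weak_deriv \<rho> F g"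
      unfolding is_weak_deriv_def
    proof (intro conjI ballI)
      show "locally_integrable F" using p fL F by (rule locally_integrable_of_Lp)
      show "locally_integrable g" using p g(1) by (rule locally_integrable_of_Lp) simp
      fix \<phi> :: "real ^ 'n \<Rightarrow> complex" assume \<phi>: "\<phi> \<in> test_functions"
      have tf: "foldr partial_deriv ts \<phi> \<in> test_functions" for ts
        using \<phi> by (induction ts) (auto intro: test_functions_partial_deriv)
      note [measurable] = test_functions_borel[OF \<phi>] test_functions_borel[OF tf]
        borel_Lp_measurable[OF fL] borel_Lp_measurable[OF g(1)]
      have "(LINT x|lebesgue. F x * multi_power partial_deriv \<rho> \<phi> x) = (LINT x|lborel. f x * multi_power partial_deriv \<rho> \<phi> x)"
        using F by (intro integral_lebesgue_eq) (auto simp: multi_power_eq_foldr elim!: eventually_mono)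
      also have "\<dots> = (-1) ^ order_of \<rho> * (LINT x|lborel. g x * \<phi> x)"
        using g(3)[OF \<phi>] by (simp add: multi_power_eq_foldr)
      also have "(LINT x|lborel. g x * \<phi> x) = (LINT x|lebesgue. g x * \<phi> x)"
        by (intro integral_lebesgue_eq[symmetric]) auto
      finally show "(LINT x|lebesgue. F x * multi_power partial_deriv \<rho> \<phi> x) = (-1) ^ order_of \<rho> * (LINT x|lebesgue. g x * \<phi> x)" .
    qed
    with g show ?thesis by blast
  qed
  show mem: "F \<in> sobolev m p"
    unfolding sobolev_def
  proof (intro CollectI conjI allI impI)
    show "F \<in> Lp_space p" using p fL F by (rule Lp_norm_eq)
    fix \<rho> :: "'n \<Rightarrow> nat" assume "order_of \<rho> \<le> m"
    from ex[OF this] obtain g where "borel_Lp p g" "is_weak_deriv \<rho> F g" by blast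
    then show "\<exists>g\<in>Lp_space p. is_weak_deriv \<rho> F g"
      using Lp_norm_eq(2)[OF p, of g g] by auto
  qed
  have "Lp_norm p (weak_deriv \<rho> F) \<le> \<kappa> (map (\<lambda>t. axis t 1) (multi_list \<rho>))" if \<rho>: "order_of \<rho> \<le> m" for \<rho> :: "'n \<Rightarrow> nat"
  proof -
    obtain g where g: "borel_Lp p g" "Lp_borel_norm p g \<le> \<kappa> (map (\<lambda>t. axis t 1) (multi_list \<rho>))" "is_weak_deriv \<rho> F g"
      using ex[OF \<rho>] by blast
    have "is_weak_deriv \<rho> F (weak_deriv \<rho> F)"
      unfolding weak_deriv_def using g(3) by (rule someI[of "is_weak_deriv \<rho> F"])
    then have "AE x in lborel. weak_deriv \<rho> F x = g x"
      using g(3) by (rule is_weak_deriv_unique)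
    then show ?thesis using Lp_norm_eq(1)[OF p g(1)] g(2) by simp
  qed
  then show "sobolev_norm m p F \<le> (\<Sum>\<rho> | order_of \<rho> \<le> m. \<kappa> (map (\<lambda>t. axis t 1) (multi_list \<rho>)))"
    using mem by (auto simp: sobolev_norm_def intro!: sum_mono)
qed

text \<open>A function in the space is its own weak derivative of order 0, and by uniqueness the
  representative chosen for the multiindex 0 equals it almost everywhere.\<close>

lemma Lp_norm_le_sobolev_norm:
  fixes u :: "real ^ 'n::finite \<Rightarrow> complex"
  assumes p: "1 \<le> p" and u: "u \<in> sobolev m p"
  shows "Lp_norm p u \<le> sobolev_norm m p u"
proof -
  let ?z = "\<lambda>t :: 'n. 0 :: nat"
  have z: "order_of ?z = 0" by (simp add: order_of_def)
  have uL: "u \<in> Lp_space p" using u by (simp add: sobolev_def)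
  have "\<forall>\<rho>. order_of \<rho> \<le> m \<longrightarrow> (\<exists>g\<in>Lp_space p. is_weak_deriv \<rho> u g)" using u by (simp add: sobolev_def)
  from this[rule_format, of ?z] z obtain g where g: "is_weak_deriv ?z u g" by auto
  from someI[of "is_weak_deriv ?z u", OF g] g have li: "locally_integrable u" and wd: "is_weak_deriv ?z u (weak_deriv ?z u)"
    unfolding weak_deriv_def by (auto simp: is_weak_deriv_def)
  have "multi_list ?z = []" using length_multi_list[of ?z] z by simp
  then have "is_weak_deriv ?z u u"
    using li by (simp add: is_weak_deriv_def multi_power_eq_foldr z)
  from is_weak_deriv_unique[OF wd this]
  have ae: "AE x in lborel. weak_deriv ?z u x = u x" .
  obtain v where v: "v \<in> borel_measurable borel" "AE x in lborel. u x = v x"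
    using uL lebesgue_measurable_borel_representative by (auto simp: Lp_space_def)
  have "Lp_norm p u = Lp_borel_norm p v"
    unfolding Lp_norm_def using p v by (intro Lp_enorm_lebesgue) (auto elim!: eventually_mono)
  moreover have "Lp_norm p (weak_deriv ?z u) = Lp_borel_norm p v"
  proof -
    have "AE x in lborel. weak_deriv ?z u x = v x" using ae v(2) by eventually_elim simp
    then show ?thesis
      unfolding Lp_norm_def using p v by (intro Lp_enorm_lebesgue) (auto elim!: eventually_mono)
  qed
  ultimately have "Lp_norm p u = Lp_norm p (weak_deriv ?z u)" by simp
  also have "\<dots> \<le> (\<Sum>\<rho> | order_of \<rho> \<le> m. Lp_norm p (weak_deriv \<rho> u))"
    using z by (intro member_le_sum finite_order_of_le) auto
  finally show ?thesis using u by (simp add: sobolev_norm_def)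
qed

text \<open>Pins down the arbitrary choice in \<open>synthesis\<close>. The difference of two limits
  is the difference of their remainders, whose L^p norms are at most their Sobolev norms and so tend
  to 0.\<close>

lemma sobolev_sums_unique:
  fixes f :: "nat \<Rightarrow> real ^ 'n::finite \<Rightarrow> complex"
  assumes p: "1 \<le> p" and F: "sobolev_sums m p f F" and G: "sobolev_sums m p f G"
  shows "AE x in lborel. F x = G x"
proof -
  define u where "u H J x = H x - (\<Sum>j=1..J. f j x)" for H :: "real ^ 'n \<Rightarrow> complex" and J x
  have meas: "H \<in> borel_measurable lebesgue" if "H \<in> sobolev m p" for H :: "real ^ 'n \<Rightarrow> complex"
    using that by (simp add: sobolev_def Lp_space_def)
  have FG[measurable]: "F \<in> borel_measurable lebesgue" "G \<in> borel_measurable lebesgue"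
    using F G meas by (auto simp: sobolev_sums_def)
  have [measurable]: "f j \<in> borel_measurable lebesgue" if "j > 0" for j
    using F meas that by (auto simp: sobolev_sums_def)
  have um: "u H J \<in> borel_measurable lebesgue" if "H \<in> borel_measurable lebesgue" for H J
    unfolding u_def[abs_def] using that F meas
    by (intro borel_measurable_diff borel_measurable_sum) (auto simp: sobolev_sums_def)
  \<comment> \<open>Outside the Sobolev space the bound is trivial, since the norm is infinite
    there.\<close>
  have le: "Lp_norm p (u H J) \<le> sobolev_norm m p (u H J)" for H J
    using Lp_norm_le_sobolev_norm[OF p, of "u H J" m]
    by (cases "u H J \<in> sobolev m p") (auto simp: sobolev_norm_def)
  have bound: "Lp_norm p (\<lambda>x. F x - G x) \<le> sobolev_norm m p (u F J) + sobolev_norm m p (u G J)" for J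
  proof -
    have "Lp_norm p (\<lambda>x. F x - G x) \<le> Lp_enorm p lebesgue (\<lambda>x. ennreal (norm (u F J x)) + ennreal (norm (u G J x)))"
      unfolding Lp_norm_def
    proof (intro Lp_enorm_mono_AE[OF p] AE_I2)
      fix x
      have "norm (F x - G x) \<le> norm (u F J x) + norm (u G J x)"
        using norm_triangle_ineq4[of "u F J x" "u G J x"] by (simp add: u_def)
      then show "ennreal (norm (F x - G x)) \<le> ennreal (norm (u F J x)) + ennreal (norm (u G J x))"
        by (simp add: ennreal_plus[symmetric] del: ennreal_plus)
    qed measurable
    also have "\<dots> \<le> Lp_norm p (u F J) + Lp_norm p (u G J)"
      unfolding Lp_norm_def using um[OF FG(1)] um[OF FG(2)] by (intro Lp_enorm_add_le[OF p]) auto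
    also have "\<dots> \<le> sobolev_norm m p (u F J) + sobolev_norm m p (u G J)"
      by (intro add_mono le)
    finally show ?thesis .
  qed
  have "(\<lambda>J. sobolev_norm m p (u F J) + sobolev_norm m p (u G J)) \<longlonglongrightarrow> 0 + 0"
    using F G unfolding sobolev_sums_def u_def by (intro tendsto_add) auto
  then have "Lp_norm p (\<lambda>x. F x - G x) \<le> 0"
    using bound by (intro LIMSEQ_le_const) auto
  then have "AE x in lebesgue. ennreal (norm (F x - G x)) = 0"
    unfolding Lp_norm_def by (intro Lp_enorm_eq_0D[OF p]) auto
  then show ?thesis by (auto simp: AE_completion_iff elim!: eventually_mono)
qed

section \<open>Affine synthesis\<close>

lemma mat_vector_mult: "mat r *v v = r *\<^sub>R v" for v :: "real ^ 'n::finite"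
  by (simp add: mat_def matrix_vector_mult_def vec_eq_iff if_distrib[of "\<lambda>x. x * _"] cong: if_cong)

lemma invertible_mat:
  assumes "r \<noteq> 0"
  shows "invertible (mat r :: real ^ 'n::finite ^ 'n)"
  unfolding invertible_def
  by (intro exI[of _ "mat (1 / r)"])
    (use assms in \<open>simp add: matrix_eq matrix_vector_mul_assoc[symmetric] mat_vector_mult\<close>)

lemma AE_lborel_reflect:
  fixes x :: "real ^ 'n::finite"
  assumes "AE y in lborel. P y"
  shows "AE y in lborel. P (x - y)"
proof -
  have "AE y in lborel. P (mat (-1) *v y + x)"
    by (rule AE_lborel_matrix[OF invertible_mat AE_lborel_translate[OF assms]]) simp
  then show ?thesis by (simp add: mat_vector_mult)
qed

text \<open>The substitution y = b u maps the cube onto the cell, and its Jacobian cancels the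
  normalisation of the kernel. The identity holds at every \<open>x\<close>, because for fixed
  \<open>x\<close> the integrand is altered only on a null set.\<close>

lemma convolution_box_kernel:
  fixes b :: "real ^ 'n ^ 'n::finite"
  assumes b: "invertible b" and f'[measurable]: "f' \<in> borel_measurable borel" and ae: "AE x in lborel. f x = f' x"
  shows "convolution (box_kernel b) f x = avg (cell_measure b) f' x"
proof -
  note [measurable] = cell_borel[OF b]
  have d: "\<bar>det b\<bar> > 0" using b by (simp add: invertible_det_nz)
  have "measure lebesgue (cell b) = measure lborel (cell b)"
    using cell_borel[OF b] by (intro measure_completion) simp
  also have "\<dots> = \<bar>det b\<bar>" using emeasure_cell[OF b] by (simp add: measure_def)
  finally have k: "box_kernel b y = of_real (indicator (cell b) y / \<bar>det b\<bar>)" for y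
    by (simp add: box_kernel_def)
  have [measurable]: "box_kernel b \<in> borel_measurable borel" unfolding k[abs_def] by measurable
  have ind: "indicator (cell b) (b *v y) = (indicator unit_cube y :: real)" for y
    using mem_cell_iff[OF b] b by (simp add: indicator_def matrix_inv_mult_vec)
  have "convolution (box_kernel b) f x = (LINT y|lborel. box_kernel b y * f' (x - y))"
    unfolding convolution_def
  proof (rule integral_lebesgue_eq)
    show "AE y in lborel. box_kernel b y * f (x - y) = box_kernel b y * f' (x - y)"
      using AE_lborel_reflect[OF ae, of x] by eventually_elim simp
  qed measurable
  also have "\<dots> = \<bar>det b\<bar> * (LINT y|lborel. box_kernel b (b *v y) * f' (x - b *v y))"
    by (rule integral_lborel_matrix[OF b]) measurable
  also have "\<dots> = (LINT y|lborel. of_real \<bar>det b\<bar> * (box_kernel b (b *v y) * f' (x - b *v y)))"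
    by simp
  also have "\<dots> = (LINT y|lborel. indicator unit_cube y *\<^sub>R f' (x - b *v y))"
    using d by (intro Bochner_Integration.integral_cong) (auto simp: k ind scaleR_conv_of_real)
  also have "\<dots> = (LINT y|cube_measure. f' (x - b *v y))"
    unfolding cube_measure_def
    by (subst integral_density[of "\<lambda>y. f' (x - b *v y)" lborel "indicator unit_cube", symmetric])
      (auto simp: ennreal_indicator)
  also have "\<dots> = avg (cell_measure b) f' x"
    unfolding avg_def cell_measure_def by (rule integral_distr[symmetric]) measurable
  finally show ?thesis .
qed

lemma avg_pow_measurable:
  assumes "borel_prob_space \<mu>" "f \<in> borel_measurable borel"
  shows "(avg \<mu> ^^ n) f \<in> borel_measurable borel"
  using assms(2) by (induction n) (auto intro: borel_prob_space.avg_measurable[OF assms(1)])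

lemma convolution_box_kernel_pow:
  fixes b :: "real ^ 'n ^ 'n::finite"
  assumes b: "invertible b" and f': "f' \<in> borel_measurable borel" and ae: "AE x in lborel. f x = f' x"
  shows "AE x in lborel. (convolution (box_kernel b) ^^ m) f x = (avg (cell_measure b) ^^ m) f' x"
proof (induction m)
  case (Suc m)
  then show ?case
    using convolution_box_kernel[OF b avg_pow_measurable[OF borel_prob_space_cell_measure f'] Suc]
    by simp
qed (use ae in simp)

text \<open>Finiteness of the sum makes all terms finite, so the tail can be written in the real
  numbers as the sum minus a partial sum.\<close>

lemma suminf_tail_tendsto_0:
  fixes a :: "nat \<Rightarrow> ennreal"
  assumes "(\<Sum>j. a j) < top"
  shows "(\<lambda>J. \<Sum>j. a (j + J)) \<longlonglongrightarrow> 0"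
proof -
  have fin: "a j < top" for j
    using le_less_trans[OF sum_le_suminf[of a "{j}"] assms] by simp
  define r where "r j = enn2real (a j)" for j
  have a: "a j = ennreal (r j)" for j using fin[of j] by (simp add: r_def)
  have r0: "0 \<le> r j" for j by (simp add: r_def)
  have sr: "summable r"
    using assms r0 by (intro summable_suminf_not_top) (auto simp: a[symmetric])
  have "(\<Sum>j. a (j + J)) = ennreal (suminf r - (\<Sum>j<J. r j))" for J
  proof -
    have "summable (\<lambda>j. r (j + J))" using sr by (rule summable_ignore_initial_segment)
    then have "(\<Sum>j. a (j + J)) = ennreal (\<Sum>j. r (j + J))" using r0 by (simp add: a suminf_ennreal2)
    then show ?thesis using suminf_minus_initial_segment[OF sr, of J] by simp
  qed
  moreover have "(\<lambda>J. ennreal (suminf r - (\<Sum>j<J. r j))) \<longlonglongrightarrow> ennreal (suminf r - suminf r)"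
    by (intro tendsto_ennrealI tendsto_diff tendsto_const summable_LIMSEQ sr)
  ultimately show ?thesis by simp
qed

text \<open>Scales are numbered from 1 and series from 0, hence the shift by \<open>Suc\<close> in
  all sums over scales.\<close>

lemma infsum_greaterThan_0_nat:
  fixes f :: "nat \<Rightarrow> ennreal"
  shows "(\<Sum>\<^sub>\<infinity>j\<in>{0<..}. f j) = (\<Sum>j. f (Suc j))"
proof -
  have bij: "bij_betw Suc UNIV {0<..}"
    by (rule bij_betw_byWitness[where f' = "\<lambda>j. j - 1"]) auto
  have "(\<Sum>\<^sub>\<infinity>j\<in>{0<..}. f j) = (\<integral>\<^sup>+j. f j \<partial>count_space {0<..})"
    by (rule nn_integral_count_space_eq_infsum[symmetric]) simp
  also have "\<dots> = (\<integral>\<^sup>+j. f (Suc j) \<partial>count_space UNIV)"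
    by (rule nn_integral_bij_count_space[OF bij, symmetric])
  finally show ?thesis by (simp add: nn_integral_count_space_nat)
qed

section \<open>Linear structure of the weighted sequence space\<close>

lemma multi_power_diff_op_add:
  "multi_power diff_op \<rho> (\<lambda>k. c k + c' k) = (\<lambda>k. multi_power diff_op \<rho> c k + multi_power diff_op \<rho> c' k)"
proof -
  have "fold diff_op ts (\<lambda>k. c k + c' k) = (\<lambda>k. fold diff_op ts c k + fold diff_op ts c' k)" for ts
  proof (induction ts arbitrary: c c')
    case (Cons t ts)
    have "diff_op t (\<lambda>k. c k + c' k) = (\<lambda>k. diff_op t c k + diff_op t c' k)"
      by (simp add: diff_op_def fun_eq_iff)
    then show ?case using Cons.IH by simp
  qed simp
  then show ?thesis by (simp add: fold_diff_op_multi_list[symmetric])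
qed

lemma multi_power_diff_op_cmult:
  "multi_power diff_op \<rho> (\<lambda>k. z * c k) = (\<lambda>k. z * multi_power diff_op \<rho> c k)"
proof -
  have "fold diff_op ts (\<lambda>k. z * c k) = (\<lambda>k. z * fold diff_op ts c k)" for ts
  proof (induction ts arbitrary: c)
    case (Cons t ts)
    have "diff_op t (\<lambda>k. z * c k) = (\<lambda>k. z * diff_op t c k)"
      by (simp add: diff_op_def fun_eq_iff right_diff_distrib)
    then show ?case using Cons.IH by simp
  qed simp
  then show ?thesis by (simp add: fold_diff_op_multi_list[symmetric])
qed

lemma lp_seq_norm_add_le:
  fixes s s' :: "int ^ 'n::finite \<Rightarrow> complex"
  assumes p: "1 \<le> p"
  shows "lp_seq_norm p (\<lambda>k. s k + s' k) \<le> lp_seq_norm p s + lp_seq_norm p s'"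
proof -
  have cnt: "countable (UNIV :: (int ^ 'n) set)" by simp
  have "lp_seq_norm p (\<lambda>k. s k + s' k) \<le> Lp_enorm p (count_space UNIV) (\<lambda>k. ennreal (norm (s k)) + ennreal (norm (s' k)))"
    unfolding lp_seq_norm_eq[OF cnt p] using p
    by (intro Lp_enorm_mono_AE AE_I2)
      (auto simp: ennreal_plus[symmetric] norm_triangle_ineq simp del: ennreal_plus intro!: ennreal_leI)
  also have "\<dots> \<le> lp_seq_norm p s + lp_seq_norm p s'"
    unfolding lp_seq_norm_eq[OF cnt p] using p by (intro Lp_enorm_add_le) auto
  finally show ?thesis .
qed

lemma lp_seq_norm_cmult_le:
  fixes s :: "int ^ 'n::finite \<Rightarrow> complex"
  assumes p: "1 \<le> p"
  shows "lp_seq_norm p (\<lambda>k. z * s k) \<le> ennreal (norm z) * lp_seq_norm p s"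
proof -
  have cnt: "countable (UNIV :: (int ^ 'n) set)" by simp
  show ?thesis
    unfolding lp_seq_norm_eq[OF cnt p]
    using Lp_enorm_cmult_le[OF p, of "\<lambda>k. ennreal (norm (s k))" "count_space UNIV" "ennreal (norm z)"]
    by (simp add: norm_mult ennreal_mult)
qed

lemma ell1_norm_eq_suminf:
  "ell1_norm m p \<alpha> c = (\<Sum>j. \<Sum>\<rho> | order_of \<rho> \<le> m.
    ennreal (\<bar>\<alpha> (Suc j)\<bar> ^ order_of \<rho>) * lp_seq_norm p (multi_power diff_op \<rho> (c (Suc j))))"
  unfolding ell1_norm_def by (rule infsum_greaterThan_0_nat)

lemma ell1_space_add:
  fixes c c' :: "nat \<Rightarrow> int ^ 'n::finite \<Rightarrow> complex"
  assumes p: "1 \<le> p" and c: "c \<in> ell1_space m p \<alpha>" "c' \<in> ell1_space m p \<alpha>"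
  shows "(\<lambda>j k. c j k + c' j k) \<in> ell1_space m p \<alpha>"
proof -
  have "ell1_norm m p \<alpha> (\<lambda>j k. c j k + c' j k) \<le> (\<Sum>j.
      (\<Sum>\<rho> | order_of \<rho> \<le> m. ennreal (\<bar>\<alpha> (Suc j)\<bar> ^ order_of \<rho>) * lp_seq_norm p (multi_power diff_op \<rho> (c (Suc j))))
    + (\<Sum>\<rho> | order_of \<rho> \<le> m. ennreal (\<bar>\<alpha> (Suc j)\<bar> ^ order_of \<rho>) * lp_seq_norm p (multi_power diff_op \<rho> (c' (Suc j)))))"
    unfolding ell1_norm_eq_suminf sum.distrib[symmetric] distrib_left[symmetric] multi_power_diff_op_add
    by (intro suminf_le sum_mono mult_left_mono lp_seq_norm_add_le p) auto
  also have "\<dots> = ell1_norm m p \<alpha> c + ell1_norm m p \<alpha> c'"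
    unfolding ell1_norm_eq_suminf by (rule suminf_add[symmetric]) auto
  also have "\<dots> < \<infinity>" using c by (simp add: ell1_space_def ennreal_add_eq_top less_top[symmetric])
  finally show ?thesis by (simp add: ell1_space_def)
qed

lemma ell1_space_cmult:
  fixes c :: "nat \<Rightarrow> int ^ 'n::finite \<Rightarrow> complex"
  assumes p: "1 \<le> p" and c: "c \<in> ell1_space m p \<alpha>"
  shows "(\<lambda>j k. z * c j k) \<in> ell1_space m p \<alpha>"
proof -
  have "ell1_norm m p \<alpha> (\<lambda>j k. z * c j k) \<le> (\<Sum>j. ennreal (norm z) *
      (\<Sum>\<rho> | order_of \<rho> \<le> m. ennreal (\<bar>\<alpha> (Suc j)\<bar> ^ order_of \<rho>) * lp_seq_norm p (multi_power diff_op \<rho> (c (Suc j)))))"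
    unfolding ell1_norm_eq_suminf sum_distrib_left multi_power_diff_op_cmult mult.left_commute[of "ennreal (norm z)"]
    by (intro suminf_le sum_mono mult_left_mono lp_seq_norm_cmult_le p) auto
  also have "\<dots> = ennreal (norm z) * ell1_norm m p \<alpha> c"
    unfolding ell1_norm_eq_suminf by simp
  also have "\<dots> < \<infinity>" using c by (simp add: ell1_space_def ennreal_mult_less_top)
  finally show ?thesis by (simp add: ell1_space_def)
qed

text \<open>Compares the half-open cell with a compact parallelepiped, where local membership in L^p
  applies.\<close>

lemma Lp_enorm_density_mono:
  assumes p: "1 \<le> p" and g[measurable]: "g \<in> borel_measurable borel"
    and S[measurable]: "S \<in> sets borel" "T \<in> sets borel" and ST: "S \<subseteq> T"
  shows "Lp_enorm p (density lborel (indicator S)) g \<le> Lp_enorm p (density lborel (indicator T)) g"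
  using p
proof (cases rule: exponent_cases)
  case infinite
  have "AE x in density lborel (indicator T). g x \<le> esssup (density lborel (indicator T)) g"
    by (rule esssup_AE)
  then have "AE x in lborel. x \<in> T \<longrightarrow> g x \<le> esssup (density lborel (indicator T)) g"
    by (subst (asm) AE_density) (auto simp: indicator_def elim!: eventually_mono)
  then have "AE x in density lborel (indicator S). g x \<le> esssup (density lborel (indicator T)) g"
    using ST by (subst AE_density) (auto simp: indicator_def elim!: eventually_mono)
  then show ?thesis unfolding infinite Lp_enorm_infinity by (intro esssup_I) auto
next
  case (finite q)
  have "(\<integral>\<^sup>+x. epowr (g x) q \<partial>density lborel (indicator S)) \<le> (\<integral>\<^sup>+x. epowr (g x) q \<partial>density lborel (indicator T))"
    using ST by (subst (1 2) nn_integral_density) (auto intro!: nn_integral_mono mult_right_mono simp: indicator_def)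
  then show ?thesis using finite by (simp add: Lp_enorm_ennreal epowr_mono)
qed

text \<open>\<open>L\<close> dominates every difference of order \<open>length vs\<close>, since
  expanding arbitrary directions in the lattice basis mixes all of them.\<close>

lemma cell_bound_syn_le:
  fixes b :: "real ^ 'n ^ 'n::finite"
  assumes p: "1 \<le> p" and b: "invertible b" and \<eta>: "\<eta> \<in> borel_measurable borel"
    and N: "N = Lp_enorm p (cell_lborel b) (nn_syn b (\<lambda>_. 1) (\<lambda>x. ennreal (norm (\<eta> x))))" "N < top"
    and c: "lp_seq_norm p c < top"
    and L: "\<And>\<rho>. order_of \<rho> = length vs \<Longrightarrow> lp_seq_norm p (multi_power diff_op \<rho> c) \<le> L"
  shows "cell_bound p b (syn b c \<eta>) vs \<le> ennreal (\<Prod>v\<leftarrow>vs. \<Sum>t\<in>UNIV. \<bar>(matrix_inv b *v v) $ t\<bar>) * (L * N)"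
proof (rule cell_bound_le)
  fix ts :: "'n list" assume ts: "length ts = length vs"
  obtain \<rho> where \<rho>: "order_of \<rho> = length ts" "fold diff_op ts c = multi_power diff_op \<rho> c"
    by (rule fold_diff_op_eq_multi_power)
  have "Lp_borel_norm p (fold (cell_diff b) ts (syn b c \<eta>)) \<le> lp_seq_norm p (fold diff_op ts c) * N"
    using c syn_measurable[OF \<eta>] by (intro Lp_fold_cell_diff_le[OF p b \<eta> N]) auto
  also have "\<dots> \<le> L * N" using L[of \<rho>] \<rho> ts by (intro mult_right_mono) auto
  finally show "Lp_borel_norm p (fold (cell_diff b) ts (syn b c \<eta>)) \<le> L * N" .
qed

text \<open>The normalisation |det|^(1/p) of the affine elements cancels the factor |det|^(-1/p) of
  the dilation, so only the homogeneity factor \<open>\<bar>r\<bar> ^ length vs\<close>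
  remains.\<close>

lemma single_scale:
  fixes b :: "real ^ 'n ^ 'n::finite"
  assumes p: "1 \<le> p" and b: "invertible b" and \<eta>: "\<eta> \<in> borel_measurable borel"
    and N: "N = Lp_enorm p (cell_lborel b) (nn_syn b (\<lambda>_. 1) (\<lambda>x. ennreal (norm (\<eta> x))))" "N < top"
    and c: "lp_seq_norm p c < top" and r: "r \<noteq> 0"
    and \<psi>: "AE x in lborel. \<psi> x = (avg (cell_measure b) ^^ m) \<eta> x"
    and f: "f = (\<lambda>x. of_real (\<bar>det (mat r :: real ^ 'n ^ 'n)\<bar> powr inv_exponent p) * (avg (cell_measure b) ^^ m) (syn b c \<eta>) (mat r *v x))"
  shows "AE x in lborel. (\<lambda>k. norm (c k * (of_real (\<bar>det (mat r :: real ^ 'n ^ 'n)\<bar> powr inv_exponent p) * \<psi> (mat r *v x - lattice_point b k)))) summable_on UNIV"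
    and "AE x in lborel. (\<Sum>\<^sub>\<infinity>k. c k * (of_real (\<bar>det (mat r :: real ^ 'n ^ 'n)\<bar> powr inv_exponent p) * \<psi> (mat r *v x - lattice_point b k))) = f x"
    and "dir_sobolev p m (\<lambda>vs. ennreal (\<bar>r\<bar> ^ length vs) * cell_bound p b (syn b c \<eta>) vs) f"
proof -
  let ?A = "mat r :: real ^ 'n ^ 'n"
  let ?w = "complex_of_real (\<bar>det ?A\<bar> powr inv_exponent p)"
  let ?T = "avg (cell_measure b) ^^ m"
  note C = borel_prob_space_cell_measure[of b]
  have A: "invertible ?A" using r by (rule invertible_mat)
  have d: "\<bar>det ?A\<bar> > 0" using A by (simp add: invertible_det_nz)
  have S: "Lp_synthesizable p b c \<eta>" using p b \<eta> N c by (rule Lp_synthesizableI)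
  have ST: "Lp_synthesizable p b c (?T \<eta>)" and syn: "AE x in lborel. syn b c (?T \<eta>) x = ?T (syn b c \<eta>) x"
    using syn_avg_pow[OF C p S, of m] by auto
  \<comment> \<open>There are countably many translates, so a single exceptional set serves all
    \<open>k\<close>.\<close>
  have "AE x in lborel. \<forall>k. \<psi> (x - lattice_point b k) = ?T \<eta> (x - lattice_point b k)"
    unfolding AE_all_countable using AE_lborel_translate[OF \<psi>, of "- lattice_point b k" for k] by simp
  with AE_norm_syn[OF p ST] syn
  have "AE x in lborel. (\<forall>k. \<psi> (x - lattice_point b k) = ?T \<eta> (x - lattice_point b k)) \<and>
      norm_syn b c (?T \<eta>) x < top \<and> syn b c (?T \<eta>) x = ?T (syn b c \<eta>) x"
    by eventually_elim auto
  from AE_lborel_matrix[OF A this]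
  have "AE x in lborel. (\<lambda>k. norm (c k * (?w * \<psi> (?A *v x - lattice_point b k)))) summable_on UNIV \<and>
      (\<Sum>\<^sub>\<infinity>k. c k * (?w * \<psi> (?A *v x - lattice_point b k))) = f x"
  proof eventually_elim
    case (elim x)
    have int: "integrable (count_space UNIV) (\<lambda>k. c k * ?T \<eta> (?A *v x - lattice_point b k))"
      using elim by (intro integrable_syn) auto
    then have "integrable (count_space UNIV) (\<lambda>k. ?w * (c k * ?T \<eta> (?A *v x - lattice_point b k)))"
      by (rule integrable_mult_right)
    then have int': "integrable (count_space UNIV) (\<lambda>k. c k * (?w * \<psi> (?A *v x - lattice_point b k)))"
      using elim by (simp add: mult_ac)
    have "(\<Sum>\<^sub>\<infinity>k. c k * (?w * \<psi> (?A *v x - lattice_point b k)))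
        = (LINT k|count_space UNIV. ?w * (c k * ?T \<eta> (?A *v x - lattice_point b k)))"
      using elim by (simp add: infsum_eq_integral_count_space mult_ac)
    also have "\<dots> = ?w * syn b c (?T \<eta>) (?A *v x)"
      unfolding syn_def by (rule integral_mult_right_zero)
    also have "\<dots> = f x" using elim by (simp add: f)
    finally show ?case using int' by (simp only: norm_summable_on_iff_integrable)
  qed
  then show "AE x in lborel. (\<lambda>k. norm (c k * (?w * \<psi> (?A *v x - lattice_point b k)))) summable_on UNIV"
    "AE x in lborel. (\<Sum>\<^sub>\<infinity>k. c k * (?w * \<psi> (?A *v x - lattice_point b k))) = f x"
    by (auto elim!: eventually_mono)
  have "dir_sobolev p m (cell_bound p b (syn b c \<eta>)) (?T (syn b c \<eta>))"
    using p b borel_Lp_syn(1)[OF p S] by (rule dir_sobolev_avg_cell)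
  from dir_sobolev_cmult[OF p dir_sobolev_matrix[OF p A this], of ?w]
  have "dir_sobolev p m (\<lambda>vs. ennreal (norm ?w) * (ennreal (\<bar>det ?A\<bar> powr - inv_exponent p) *
      cell_bound p b (syn b c \<eta>) (map ((*v) ?A) vs))) f"
    unfolding f .
  moreover have "ennreal (norm ?w) * (ennreal (\<bar>det ?A\<bar> powr - inv_exponent p) * X) = X" for X
    using d by (simp add: mult.assoc[symmetric] ennreal_mult[symmetric] powr_add[symmetric])
  ultimately show "dir_sobolev p m (\<lambda>vs. ennreal (\<bar>r\<bar> ^ length vs) * cell_bound p b (syn b c \<eta>) vs) f"
    by (simp add: cell_bound_scale)
qed

section \<open>Summation over the scales\<close>

locale affine_synthesis =
  fixes p :: ennreal and m :: nat and \<alpha> :: "nat \<Rightarrow> real" and b :: "real ^ 'n ^ 'n::finite"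
    and h \<psi> :: "real ^ 'n \<Rightarrow> complex" and N :: ennreal
  assumes scale_nz: "\<And>j. j > 0 \<Longrightarrow> \<alpha> j \<noteq> 0" and p: "1 \<le> p" and b: "invertible b"
    and h: "h \<in> borel_measurable borel"
    and N: "N = Lp_enorm p (cell_lborel b) (nn_syn b (\<lambda>_. 1) (\<lambda>x. ennreal (norm (h x))))" "N < top"
    and \<psi>: "AE x in lborel. \<psi> x = (avg (cell_measure b) ^^ m) h x"
begin

abbreviation scale :: "(nat \<Rightarrow> int ^ 'n \<Rightarrow> complex) \<Rightarrow> nat \<Rightarrow> real ^ 'n \<Rightarrow> complex"
  where "scale \<equiv> scale_sum p (dilation \<alpha>) b \<psi>"

abbreviation synth :: "(nat \<Rightarrow> int ^ 'n \<Rightarrow> complex) \<Rightarrow> real ^ 'n \<Rightarrow> complex"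
  where "synth \<equiv> synthesis m p (dilation \<alpha>) b \<psi>"

text \<open>A Borel representative of the sum over \<open>k\<close>: a dilated, iterated cell
  average of a synthesized function, to which the directional bounds apply.\<close>

definition scale_rep :: "(nat \<Rightarrow> int ^ 'n \<Rightarrow> complex) \<Rightarrow> nat \<Rightarrow> real ^ 'n \<Rightarrow> complex"
  where "scale_rep c j = (\<lambda>x. of_real (\<bar>det (mat (\<alpha> j) :: real ^ 'n ^ 'n)\<bar> powr inv_exponent p) *
    (avg (cell_measure b) ^^ m) (syn b (c j) h) (mat (\<alpha> j) *v x))"

definition scale_norm :: "(nat \<Rightarrow> int ^ 'n \<Rightarrow> complex) \<Rightarrow> nat \<Rightarrow> ennreal"
  where "scale_norm c j = (\<Sum>\<rho> | order_of \<rho> \<le> m.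
    ennreal (\<bar>\<alpha> j\<bar> ^ order_of \<rho>) * lp_seq_norm p (multi_power diff_op \<rho> (c j)))"

definition scale_bound :: "(nat \<Rightarrow> int ^ 'n \<Rightarrow> complex) \<Rightarrow> nat \<Rightarrow> (real ^ 'n) list \<Rightarrow> ennreal"
  where "scale_bound c j vs = ennreal (\<bar>\<alpha> j\<bar> ^ length vs) * cell_bound p b (syn b (c j) h) vs"

definition direction_weight :: "(real ^ 'n) list \<Rightarrow> ennreal"
  where "direction_weight vs = ennreal (\<Prod>v\<leftarrow>vs. \<Sum>t\<in>UNIV. \<bar>(matrix_inv b *v v) $ t\<bar>)"

text \<open>The cost of expanding the coordinate directions in the lattice basis. It depends on
  \<open>b\<close> and bounds the operator before rescaling.\<close>

definition op_bound :: ennreal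
  where "op_bound = (\<Sum>\<rho> :: 'n \<Rightarrow> nat | order_of \<rho> \<le> m.
    direction_weight (map (\<lambda>t. axis t 1) (multi_list \<rho>)) * N)"

lemma op_bound_finite: "op_bound < top"
  using N(2) by (simp add: op_bound_def direction_weight_def finite_order_of_le less_top[symmetric] ennreal_mult_eq_top_iff)

lemma scale_norm_sums:
  "(\<Sum>j. scale_norm c (Suc j)) = ell1_norm m p \<alpha> c"
  by (simp add: scale_norm_def ell1_norm_eq_suminf)

text \<open>The multiindex 0 has weight 1, so its term alone is the l^p norm of \<open>c j\<close>;
  a finite weighted norm thus makes each \<open>c j\<close> with \<open>j > 0\<close>
  synthesizable.\<close>

lemma lp_seq_norm_le_scale_norm: "lp_seq_norm p (c j) \<le> scale_norm c j"
proof -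
  have "multi_list (\<lambda>_ :: 'n. 0) = []"
    using length_multi_list[of "\<lambda>_ :: 'n. 0"] by (simp add: order_of_def)
  then have 0: "multi_power diff_op (\<lambda>_. 0) (c j) = c j"
    using fold_diff_op_multi_list[of "\<lambda>_. 0" "c j"] by simp
  have "ennreal (\<bar>\<alpha> j\<bar> ^ order_of (\<lambda>_ :: 'n. 0)) * lp_seq_norm p (multi_power diff_op (\<lambda>_. 0) (c j)) \<le> scale_norm c j"
    unfolding scale_norm_def using finite_order_of_le by (intro member_le_sum) (auto simp: order_of_def)
  then show ?thesis unfolding 0 by (simp add: order_of_def)
qed

lemma scale_norm_finite:
  assumes "c \<in> ell1_space m p \<alpha>" "j > 0"
  shows "scale_norm c j < top"
proof -
  have "scale_norm c j \<le> (\<Sum>j. scale_norm c (Suc j))"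
    using sum_le_suminf[of "\<lambda>j. scale_norm c (Suc j)" "{j - 1}"] assms(2) by simp
  then show ?thesis using assms(1) unfolding scale_norm_sums by (simp add: ell1_space_def)
qed

lemma lp_seq_norm_finite:
  fixes c :: "nat \<Rightarrow> int ^ 'n \<Rightarrow> complex"
  shows "c \<in> ell1_space m p \<alpha> \<Longrightarrow> j > 0 \<Longrightarrow> lp_seq_norm p (c j) < top"
  by (rule le_less_trans[OF lp_seq_norm_le_scale_norm[of c j] scale_norm_finite[of c j]])

lemma scale_bound_le:
  assumes c: "c \<in> ell1_space m p \<alpha>" "j > 0" and vs: "length vs \<le> m"
  shows "scale_bound c j vs \<le> direction_weight vs * N * scale_norm c j"
proof -
  \<comment> \<open>A common bound for all differences of order \<open>length vs\<close>; multiplied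
    by the matching power of the scale it is part of \<open>scale_norm c j\<close>.\<close>
  let ?L = "\<Sum>\<rho> | order_of \<rho> = length vs. lp_seq_norm p (multi_power diff_op \<rho> (c j))"
  have fin: "finite {\<rho> :: 'n \<Rightarrow> nat. order_of \<rho> = length vs}"
    by (rule finite_subset[OF _ finite_order_of_le[of "length vs"]]) auto
  have "cell_bound p b (syn b (c j) h) vs \<le> direction_weight vs * (?L * N)"
    unfolding direction_weight_def
    using fin lp_seq_norm_finite[OF c]
    by (intro cell_bound_syn_le[OF p b h N] member_le_sum) auto
  then have "scale_bound c j vs \<le> ennreal (\<bar>\<alpha> j\<bar> ^ length vs) * (direction_weight vs * (?L * N))"
    unfolding scale_bound_def by (rule mult_left_mono) simp
  also have "\<dots> = direction_weight vs * N * (ennreal (\<bar>\<alpha> j\<bar> ^ length vs) * ?L)"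
    by (simp only: mult_ac)
  also have "ennreal (\<bar>\<alpha> j\<bar> ^ length vs) * ?L
      = (\<Sum>\<rho> | order_of \<rho> = length vs. ennreal (\<bar>\<alpha> j\<bar> ^ order_of \<rho>) * lp_seq_norm p (multi_power diff_op \<rho> (c j)))"
    unfolding sum_distrib_left by (intro sum.cong) auto
  also have "\<dots> \<le> scale_norm c j"
    unfolding scale_norm_def using vs by (intro sum_mono2 finite_order_of_le) auto
  finally show ?thesis by (simp add: mult_left_mono)
qed

lemma scale_bound_axes_le:
  assumes "c \<in> ell1_space m p \<alpha>" "j > 0"
  shows "(\<Sum>\<rho> | order_of \<rho> \<le> m. scale_bound c j (map (\<lambda>t. axis t 1) (multi_list \<rho>))) \<le> op_bound * scale_norm c j"
  unfolding op_bound_def sum_distrib_right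
  by (intro sum_mono scale_bound_le assms) (auto simp: length_multi_list)

lemma scale_bound_sum_finite:
  assumes c: "c \<in> ell1_space m p \<alpha>" and vs: "length vs \<le> m"
  shows "(\<Sum>j. scale_bound c (Suc j) vs) < top"
proof -
  have "(\<Sum>j. scale_bound c (Suc j) vs) \<le> (\<Sum>j. direction_weight vs * N * scale_norm c (Suc j))"
    using vs by (intro suminf_le scale_bound_le c) auto
  also have "\<dots> = direction_weight vs * N * ell1_norm m p \<alpha> c"
    by (simp add: scale_norm_sums)
  also have "\<dots> < top"
    using c N(2) by (simp add: ell1_space_def direction_weight_def ennreal_mult_less_top)
  finally show ?thesis .
qed

lemma scale_AE:
  assumes c: "c \<in> ell1_space m p \<alpha>" and j: "j > 0"
  shows "AE x in lborel. (\<lambda>k. norm (c j k * affine_element p (dilation \<alpha>) b \<psi> j k x)) summable_on UNIV"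
    and "AE x in lborel. scale c j x = scale_rep c j x"
    and "dir_sobolev p m (scale_bound c j) (scale_rep c j)"
  using single_scale[OF p b h N lp_seq_norm_finite[OF c j] scale_nz[OF j] \<psi> scale_rep_def[of c j]]
  by (simp_all add: affine_element_def scale_sum_def dilation_def scale_bound_def[abs_def])

lemma scale_sobolev:
  assumes c: "c \<in> ell1_space m p \<alpha>" and j: "j > 0"
  shows "scale c j \<in> sobolev m p" "sobolev_norm m p (scale c j) \<le> op_bound * scale_norm c j"
  using sobolev_of_dir_sobolev[OF p scale_AE(3,2)[OF assms]] scale_bound_axes_le[OF assms]
  by (auto intro: order_trans)

lemma scale_sobolev_norm_sum:
  assumes c: "c \<in> ell1_space m p \<alpha>"
  shows "(\<Sum>\<^sub>\<infinity>j\<in>{0<..}. sobolev_norm m p (scale c j)) < top"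
proof -
  have "(\<Sum>j. sobolev_norm m p (scale c (Suc j))) \<le> (\<Sum>j. op_bound * scale_norm c (Suc j))"
    by (intro suminf_le scale_sobolev c) auto
  also have "\<dots> < top"
    using c op_bound_finite by (simp add: scale_norm_sums ell1_space_def ennreal_mult_less_top)
  finally show ?thesis by (simp add: infsum_greaterThan_0_nat)
qed

text \<open>An explicit pointwise limit. It witnesses that the choice in \<open>synthesis\<close> is
  possible and represents the chosen function almost everywhere.\<close>

definition limit :: "(nat \<Rightarrow> int ^ 'n \<Rightarrow> complex) \<Rightarrow> real ^ 'n \<Rightarrow> complex"
  where "limit c x = (\<Sum>j. scale_rep c (Suc j) x)"

text \<open>Remainders are treated together with the full sum: \<open>J = 0\<close> gives the limit,
  and large \<open>J\<close> the convergence in norm.\<close>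

lemma dir_sobolev_tail:
  assumes c: "c \<in> ell1_space m p \<alpha>"
  shows "dir_sobolev p m (\<lambda>vs. \<Sum>j. scale_bound c (Suc (j + J)) vs) (\<lambda>x. \<Sum>j. scale_rep c (Suc (j + J)) x)"
proof (rule dir_sobolev_suminf[OF p])
  show "dir_sobolev p m (scale_bound c (Suc (j + J))) (scale_rep c (Suc (j + J)))" for j
    by (intro scale_AE c) simp
next
  fix vs :: "(real ^ 'n) list" assume vs: "length vs \<le> m"
  have "(\<Sum>j. scale_bound c (Suc (j + J)) vs) \<le> (\<Sum>j. direction_weight vs * N * scale_norm c (Suc (j + J)))"
    using vs by (intro suminf_le scale_bound_le c) auto
  also have "\<dots> = direction_weight vs * N * (\<Sum>j. scale_norm c (Suc (j + J)))" by simp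
  also have "(\<Sum>j. scale_norm c (Suc (j + J))) \<le> (\<Sum>j. scale_norm c (Suc j))"
    using suminf_offset[of "\<lambda>j. scale_norm c (Suc j)" J] by simp
  then have "direction_weight vs * N * (\<Sum>j. scale_norm c (Suc (j + J))) \<le> direction_weight vs * N * (\<Sum>j. scale_norm c (Suc j))"
    by (rule mult_left_mono) simp
  also have "\<dots> < top"
    using c N(2) by (simp add: scale_norm_sums ell1_space_def direction_weight_def ennreal_mult_less_top)
  finally show "(\<Sum>j. scale_bound c (Suc (j + J)) vs) < \<infinity>" by simp
qed

lemma dir_sobolev_limit:
  "c \<in> ell1_space m p \<alpha> \<Longrightarrow> dir_sobolev p m (\<lambda>vs. \<Sum>j. scale_bound c (Suc j) vs) (limit c)"
  using dir_sobolev_tail[of c 0] by (simp add: limit_def[abs_def])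

lemma scale_summable:
  assumes c: "c \<in> ell1_space m p \<alpha>"
  shows "AE x in lborel. summable (\<lambda>j. scale_rep c (Suc j) x)"
proof -
  have fB: "dir_sobolev p m (scale_bound c (Suc j)) (scale_rep c (Suc j))" for j
    by (intro scale_AE c) simp
  have "(\<Sum>j. Lp_borel_norm p (scale_rep c (Suc j))) \<le> (\<Sum>j. scale_bound c (Suc j) [])"
    by (intro suminf_le dir_sobolevD(2)[OF fB]) auto
  also have "\<dots> < top" using scale_bound_sum_finite[OF c, of "[]"] by simp
  finally have "AE x in lborel. summable (\<lambda>j. norm (scale_rep c (Suc j) x))"
    by (intro AE_summable_of_Lp[OF p]) (auto intro: borel_Lp_measurable dir_sobolevD(1)[OF fB])
  then show ?thesis by eventually_elim (rule summable_norm_cancel)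
qed

lemma scale_AE_all:
  assumes c: "c \<in> ell1_space m p \<alpha>"
  shows "AE x in lborel. \<forall>j. scale c (Suc j) x = scale_rep c (Suc j) x"
  unfolding AE_all_countable by (intro allI scale_AE c) simp

text \<open>The remainder after \<open>J\<close> scales is almost everywhere a tail of the series of
  representatives, and its norm is at most a finite sum of tails of convergent series of
  bounds.\<close>

lemma sums_limit:
  assumes c: "c \<in> ell1_space m p \<alpha>"
  shows "sobolev_sums m p (scale c) (limit c)"
  unfolding sobolev_sums_def
proof (intro conjI allI impI scale_sobolev(1)[OF c])
  show "limit c \<in> sobolev m p"
    by (rule sobolev_of_dir_sobolev(1)[OF p dir_sobolev_limit[OF c]]) simp
  let ?\<kappa> = "\<lambda>J \<rho> j. scale_bound c (Suc (j + J)) (map (\<lambda>t. axis t 1) (multi_list \<rho>))"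
  have "AE x in lborel. limit c x - (\<Sum>j=1..J. scale c j x) = (\<Sum>j. scale_rep c (Suc (j + J)) x)" for J
    using scale_AE_all[OF c] scale_summable[OF c]
  proof eventually_elim
    case (elim x)
    have "(\<Sum>j=1..J. scale c j x) = (\<Sum>j<J. scale c (Suc j) x)"
      by (simp add: sum.atLeast1_atMost_eq)
    then show ?case
      using elim suminf_minus_initial_segment[of "\<lambda>j. scale_rep c (Suc j) x" J] by (simp add: limit_def)
  qed
  then have le: "sobolev_norm m p (\<lambda>x. limit c x - (\<Sum>j=1..J. scale c j x)) \<le> (\<Sum>\<rho> | order_of \<rho> \<le> m. \<Sum>j. ?\<kappa> J \<rho> j)" for J
    by (rule sobolev_of_dir_sobolev(2)[OF p dir_sobolev_tail[OF c]])
  have "(\<lambda>J. \<Sum>\<rho> | order_of \<rho> \<le> m. \<Sum>j. ?\<kappa> J \<rho> j) \<longlonglongrightarrow> (\<Sum>\<rho> :: 'n \<Rightarrow> nat | order_of \<rho> \<le> m. 0)"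
    by (intro tendsto_sum suminf_tail_tendsto_0[where a = "\<lambda>j. scale_bound c (Suc j) _"] scale_bound_sum_finite c)
      (auto simp: length_multi_list)
  then have lim: "(\<lambda>J. \<Sum>\<rho> | order_of \<rho> \<le> m. \<Sum>j. ?\<kappa> J \<rho> j) \<longlonglongrightarrow> 0" by simp
  show "(\<lambda>J. sobolev_norm m p (\<lambda>x. limit c x - (\<Sum>j=1..J. scale c j x))) \<longlonglongrightarrow> 0"
    by (rule tendsto_sandwich[OF _ _ tendsto_const lim]) (intro always_eventually allI le zero_le)+
qed

lemma synthesis_sums:
  assumes c: "c \<in> ell1_space m p \<alpha>"
  shows "sobolev_sums m p (scale c) (synth c)" "AE x in lborel. synth c x = limit c x"
proof -
  show "sobolev_sums m p (scale c) (synth c)"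
    unfolding synthesis_def by (rule someI[of "sobolev_sums m p (scale c)", OF sums_limit[OF c]])
  then show "AE x in lborel. synth c x = limit c x"
    using sums_limit[OF c] by (rule sobolev_sums_unique[OF p])
qed

text \<open>The functions chosen by \<open>synthesis\<close> for different coefficients are
  unrelated as choices; linearity is checked on this pointwise series.\<close>

lemma synthesis_AE_suminf:
  assumes c: "c \<in> ell1_space m p \<alpha>"
  shows "AE x in lborel. (\<lambda>j. scale c (Suc j) x) sums synth c x"
  using synthesis_sums(2)[OF c] scale_AE_all[OF c] scale_summable[OF c]
  by eventually_elim (simp add: limit_def summable_sums)

lemma synthesis_sobolev:
  assumes c: "c \<in> ell1_space m p \<alpha>"
  shows "synth c \<in> sobolev m p" "sobolev_norm m p (synth c) \<le> op_bound * ell1_norm m p \<alpha> c"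
proof -
  note S = sobolev_of_dir_sobolev[OF p dir_sobolev_limit[OF c] synthesis_sums(2)[OF c]]
  show "synth c \<in> sobolev m p" by (rule S)
  have "sobolev_norm m p (synth c) \<le> (\<Sum>\<rho> | order_of \<rho> \<le> m. \<Sum>j. scale_bound c (Suc j) (map (\<lambda>t. axis t 1) (multi_list \<rho>)))"
    by (rule S)
  also have "\<dots> = (\<Sum>j. \<Sum>\<rho> | order_of \<rho> \<le> m. scale_bound c (Suc j) (map (\<lambda>t. axis t 1) (multi_list \<rho>)))"
    by (rule suminf_sum[symmetric]) simp
  also have "\<dots> \<le> (\<Sum>j. op_bound * scale_norm c (Suc j))"
    by (intro suminf_le scale_bound_axes_le c) auto
  finally show "sobolev_norm m p (synth c) \<le> op_bound * ell1_norm m p \<alpha> c"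
    by (simp add: scale_norm_sums)
qed

text \<open>Rescaling by \<open>b\<close> turns \<open>axis t 1\<close> into the lattice vector
  \<open>b *v axis t 1\<close>, where \<open>cell_bound_lattice\<close> is exact: the derivative of
  order \<open>\<rho>\<close> costs the norm of the difference of order \<open>\<rho>\<close> times
  \<open>N\<close>. The factor |det b| comes from \<open>matrix_rescale\<close>, its power -1/p from
  the substitution.\<close>

lemma synthesis_rescaled_norm_le:
  assumes c: "c \<in> ell1_space m p \<alpha>"
  shows "sobolev_norm m p (matrix_rescale b (synth c))
    \<le> ennreal (\<bar>det b\<bar> powr - inv_exponent p) * (ennreal \<bar>det b\<bar> * N) * ell1_norm m p \<alpha> c"
proof -
  let ?d = "ennreal (norm (complex_of_real \<bar>det b\<bar>))" and ?e = "ennreal (\<bar>det b\<bar> powr - inv_exponent p)"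
  have "AE x in lborel. matrix_rescale b (synth c) x = of_real \<bar>det b\<bar> * limit c (b *v x)"
    using AE_lborel_matrix[OF b synthesis_sums(2)[OF c]] by eventually_elim (simp add: matrix_rescale_def)
  from sobolev_of_dir_sobolev(2)[OF p dir_sobolev_cmult[OF p dir_sobolev_matrix[OF p b dir_sobolev_limit[OF c]]] this]
  have "sobolev_norm m p (matrix_rescale b (synth c)) \<le> (\<Sum>\<rho> | order_of \<rho> \<le> m.
      ?d * (?e * (\<Sum>j. scale_bound c (Suc j) (map ((*v) b) (map (\<lambda>t. axis t 1) (multi_list \<rho>))))))" .
  also have "\<dots> \<le> (\<Sum>\<rho> | order_of \<rho> \<le> m.
      ?d * (?e * (\<Sum>j. ennreal (\<bar>\<alpha> (Suc j)\<bar> ^ order_of \<rho>) * lp_seq_norm p (multi_power diff_op \<rho> (c (Suc j))) * N)))"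
  proof (intro sum_mono mult_left_mono suminf_le)
    fix \<rho> :: "'n \<Rightarrow> nat" and j
    have "Lp_borel_norm p (fold (cell_diff b) (multi_list \<rho>) (syn b (c (Suc j)) h))
        \<le> lp_seq_norm p (fold diff_op (multi_list \<rho>) (c (Suc j))) * N"
      using lp_seq_norm_finite[OF c] syn_measurable[OF h] by (intro Lp_fold_cell_diff_le[OF p b h N]) auto
    then show "scale_bound c (Suc j) (map ((*v) b) (map (\<lambda>t. axis t 1) (multi_list \<rho>)))
        \<le> ennreal (\<bar>\<alpha> (Suc j)\<bar> ^ order_of \<rho>) * lp_seq_norm p (multi_power diff_op \<rho> (c (Suc j))) * N"
      by (simp add: scale_bound_def length_multi_list fold_diff_op_multi_list comp_def cell_bound_lattice[OF b]
          mult.assoc mult_left_mono)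
  qed auto
  also have "\<dots> = ?d * (?e * (\<Sum>\<rho> | order_of \<rho> \<le> m.
      \<Sum>j. ennreal (\<bar>\<alpha> (Suc j)\<bar> ^ order_of \<rho>) * lp_seq_norm p (multi_power diff_op \<rho> (c (Suc j))) * N))"
    by (simp only: sum_distrib_left)
  also have "(\<Sum>\<rho> | order_of \<rho> \<le> m.
      \<Sum>j. ennreal (\<bar>\<alpha> (Suc j)\<bar> ^ order_of \<rho>) * lp_seq_norm p (multi_power diff_op \<rho> (c (Suc j))) * N)
      = (\<Sum>j. \<Sum>\<rho> | order_of \<rho> \<le> m.
      ennreal (\<bar>\<alpha> (Suc j)\<bar> ^ order_of \<rho>) * lp_seq_norm p (multi_power diff_op \<rho> (c (Suc j))) * N)"
    by (rule suminf_sum[symmetric]) simp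
  also have "\<dots> = ell1_norm m p \<alpha> c * N"
    by (simp only: sum_distrib_right[symmetric] ennreal_suminf_multc ell1_norm_eq_suminf)
  finally show ?thesis by (simp only: mult_ac norm_of_real abs_abs)
qed

lemma synthesis_add:
  assumes c: "c \<in> ell1_space m p \<alpha>" "c' \<in> ell1_space m p \<alpha>"
  shows "AE x in lborel. synth (\<lambda>j k. c j k + c' j k) x = synth c x + synth c' x"
proof -
  have ae: "AE x in lborel. \<forall>j. (\<lambda>k. norm (u (Suc j) k * affine_element p (dilation \<alpha>) b \<psi> (Suc j) k x)) summable_on UNIV"
    if "u \<in> ell1_space m p \<alpha>" for u
    unfolding AE_all_countable by (intro allI scale_AE that) simp
  show ?thesis
    using ae[OF c(1)] ae[OF c(2)] synthesis_AE_suminf[OF c(1)] synthesis_AE_suminf[OF c(2)]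
      synthesis_AE_suminf[OF ell1_space_add[OF p c]]
  proof eventually_elim
    case (elim x)
    \<comment> \<open>Absolute summability over \<open>k\<close> at almost every point lets the two
      lattice sums be added.\<close>
    have "scale (\<lambda>j k. c j k + c' j k) (Suc j) x = scale c (Suc j) x + scale c' (Suc j) x" for j
      unfolding scale_sum_def distrib_right
      by (rule infsum_add[OF abs_summable_summable[OF elim(1)[rule_format]] abs_summable_summable[OF elim(2)[rule_format]]])
    then have "(\<lambda>j. scale c (Suc j) x + scale c' (Suc j) x) sums synth (\<lambda>j k. c j k + c' j k) x"
      using elim(5) by simp
    then show ?case using elim(3,4) by (intro sums_unique2[OF _ sums_add])
  qed
qed

lemma synthesis_cmult:
  assumes c: "c \<in> ell1_space m p \<alpha>"
  shows "AE x in lborel. synth (\<lambda>j k. z * c j k) x = z * synth c x"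
  using synthesis_AE_suminf[OF c] synthesis_AE_suminf[OF ell1_space_cmult[OF p c, of z]]
proof eventually_elim
  case (elim x)
  have "scale (\<lambda>j k. z * c j k) (Suc j) x = z * scale c (Suc j) x" for j
    unfolding scale_sum_def mult.assoc by (rule infsum_cmult_right')
  then have "(\<lambda>j. z * scale c (Suc j) x) sums synth (\<lambda>j k. z * c j k) x"
    using elim(2) by simp
  then show ?case using elim(1) by (intro sums_unique2[OF _ sums_mult])
qed

lemma bounded_operator_synthesis: "bounded_operator m p \<alpha> synth"
  unfolding bounded_operator_def
proof (intro conjI ballI allI exI)
  fix c c' :: "nat \<Rightarrow> int ^ 'n \<Rightarrow> complex" and z :: complex
  assume c: "c \<in> ell1_space m p \<alpha>"
  show "synth c \<in> sobolev m p" by (rule synthesis_sobolev[OF c])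
  show "sobolev_norm m p (synth c) \<le> ennreal (enn2real op_bound) * ell1_norm m p \<alpha> c"
    using synthesis_sobolev[OF c] op_bound_finite by simp
  show "AE x in lebesgue. synth (\<lambda>j k. z * c j k) x = z * synth c x"
    using synthesis_cmult[OF c] by (rule AE_completion)
  assume c': "c' \<in> ell1_space m p \<alpha>"
  show "AE x in lebesgue. synth (\<lambda>j k. c j k + c' j k) x = synth c x + synth c' x"
    using synthesis_add[OF c c'] by (rule AE_completion)
qed

end

text \<open>The periodization involves countably many translates, so the representative can be
  exchanged in all of them outside one null set.\<close>

lemma periodization_AE:
  fixes b :: "real ^ 'n ^ 'n::finite"
  assumes "AE x in lborel. f x = h x"
  shows "AE x in lborel. periodization b f x = ennreal \<bar>det b\<bar> * nn_syn b (\<lambda>_. 1) h x"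
proof -
  have "AE x in lborel. \<forall>k. f (x - lattice_point b k) = h (x - lattice_point b k)"
    unfolding AE_all_countable using AE_lborel_translate[OF assms, of "- lattice_point b _"] by simp
  then show ?thesis
  proof eventually_elim
    case (elim x)
    have "nn_syn b (\<lambda>_. 1) h x = (\<Sum>\<^sub>\<infinity>k. h (x - lattice_point b k))"
      unfolding nn_syn_def by (subst nn_integral_count_space_eq_infsum) auto
    then show ?case using elim by (simp add: periodization_def)
  qed
qed

theorem theorem11:
  fixes p :: ennreal and m :: nat
    and \<alpha> :: "nat \<Rightarrow> real"
    and b :: "real ^ 'n ^ 'n::finite"
    and \<eta> \<psi> :: "real ^ 'n \<Rightarrow> complex"
    and a :: "nat \<Rightarrow> real ^ 'n ^ 'n"
  assumes "\<And>j. j > 0 \<Longrightarrow> \<alpha> j \<noteq> 0"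
    and "filterlim (\<lambda>j. \<bar>\<alpha> j\<bar>) at_top sequentially"
    and "a = dilation \<alpha>"
    and "invertible b"
    and "1 \<le> p"
    and "\<eta> \<in> Lp_space p"
    and "periodization b (\<lambda>x. ennreal (norm (\<eta> x))) \<in> Lp_loc p"
    and "\<psi> = (convolution (box_kernel b) ^^ m) \<eta>"
  shows "\<psi> \<in> sobolev m p \<and>
    bounded_operator m p \<alpha> (synthesis m p a b \<psi>) \<and>
    (\<forall>c\<in>ell1_space m p \<alpha>.
      (\<forall>j>0. (AE x in lebesgue. (\<lambda>k. norm (c j k * affine_element p a b \<psi> j k x)) summable_on UNIV) \<and>
             scale_sum p a b \<psi> c j \<in> sobolev m p) \<and>
      (\<Sum>\<^sub>\<infinity>j\<in>{0<..}. sobolev_norm m p (scale_sum p a b \<psi> c j)) < \<infinity> \<and>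
      sobolev_sums m p (scale_sum p a b \<psi> c) (synthesis m p a b \<psi> c) \<and>
      sobolev_norm m p (matrix_rescale b (synthesis m p a b \<psi> c))
        \<le> ennreal (\<bar>det b\<bar> powr (- inv_exponent p))
           * Lp_enorm p (lebesgue_on (cell b)) (periodization b (\<lambda>x. ennreal (norm (\<eta> x))))
           * ell1_norm m p \<alpha> c)"
proof -
  let ?g = "\<lambda>x. ennreal (norm (\<eta> x))" and ?d = "\<bar>det b\<bar>"
  have d: "?d > 0" using \<open>invertible b\<close> by (simp add: invertible_det_nz)
  have "\<eta> \<in> borel_measurable lebesgue" using \<open>\<eta> \<in> Lp_space p\<close> by (simp add: Lp_space_def)
  \<comment> \<open>With a Borel representative of \<open>\<eta>\<close> the periodization and
    \<open>\<psi>\<close> change on null sets only, and the norms not at all.\<close>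
  then obtain h where h[measurable]: "h \<in> borel_measurable borel" and \<eta>h: "AE x in lborel. \<eta> x = h x"
    by (rule lebesgue_measurable_borel_representative)
  \<comment> \<open>The norm of P|\<eta>| over the cell without the factor |det b|, as it enters the
    lattice estimates; \<open>PN\<close> restores the factor.\<close>
  define N where "N = Lp_enorm p (cell_lborel b) (nn_syn b (\<lambda>_. 1) (\<lambda>x. ennreal (norm (h x))))"
  let ?P = "\<lambda>x. ennreal ?d * nn_syn b (\<lambda>_. 1) (\<lambda>x. ennreal (norm (h x))) x"
  have per: "AE x in lborel. periodization b ?g x = ?P x"
    using \<eta>h by (intro periodization_AE) (auto elim: eventually_mono)
  have Pm: "?P \<in> borel_measurable borel" by measurable
  have PN: "Lp_enorm p (density lborel (indicator (cell b))) ?P = ennreal ?d * N"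
    unfolding N_def cell_lborel_def by (rule Lp_enorm_cmult[OF \<open>1 \<le> p\<close> _ d]) measurable
  have "Lp_enorm p (lebesgue_on (cell b)) (periodization b ?g) = ennreal ?d * N"
    unfolding PN[symmetric] using \<open>1 \<le> p\<close> Pm per cell_borel[OF \<open>invertible b\<close>] by (rule Lp_enorm_lebesgue_on)
  have Nfin: "N < top"
  proof -
    \<comment> \<open>The cell is half-open, so the local assumption on the periodization is applied
      to the compact parallelepiped that contains it.\<close>
    let ?K = "(*v) b ` cbox 0 (1 :: real ^ 'n)"
    have K: "compact ?K" by (intro compact_continuous_image linear_continuous_on matrix_vector_mul_bounded_linear compact_cbox)
    then have Kb: "?K \<in> sets borel" by (intro borel_closed compact_imp_closed)
    have "ennreal ?d * N \<le> Lp_enorm p (density lborel (indicator ?K)) ?P"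
      unfolding PN[symmetric]
      by (intro Lp_enorm_density_mono \<open>1 \<le> p\<close> Pm Kb cell_borel \<open>invertible b\<close>)
        (auto simp: cell_def mem_box_cart less_imp_le)
    also have "\<dots> = Lp_enorm p (lebesgue_on ?K) (periodization b ?g)"
      by (intro Lp_enorm_lebesgue_on[symmetric] \<open>1 \<le> p\<close> Pm per Kb)
    also have "\<dots> < top" using assms(7) K by (simp add: Lp_loc_def)
    finally show ?thesis using d by (auto simp: ennreal_mult_less_top)
  qed
  have hLp: "borel_Lp p h"
  proof -
    have "Lp_norm p \<eta> = Lp_borel_norm p h"
      unfolding Lp_norm_def using \<eta>h by (intro Lp_enorm_lebesgue \<open>1 \<le> p\<close>) (auto elim: eventually_mono)
    then show ?thesis using \<open>\<eta> \<in> Lp_space p\<close> h by (simp add: borel_Lp_def Lp_space_def)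
  qed
  have \<psi>: "AE x in lborel. \<psi> x = (avg (cell_measure b) ^^ m) h x"
    unfolding \<open>\<psi> = _\<close> using \<open>invertible b\<close> h \<eta>h by (rule convolution_box_kernel_pow)
  interpret affine_synthesis p m \<alpha> b h \<psi> N
    using assms(1) \<open>1 \<le> p\<close> \<open>invertible b\<close> h N_def Nfin \<psi> by unfold_locales
  have "\<psi> \<in> sobolev m p"
    by (rule sobolev_of_dir_sobolev(1)[OF \<open>1 \<le> p\<close> dir_sobolev_avg_cell[OF \<open>1 \<le> p\<close> \<open>invertible b\<close> hLp] \<psi>])
  moreover have "sobolev_norm m p (matrix_rescale b (synth c))
      \<le> ennreal (?d powr - inv_exponent p) * Lp_enorm p (lebesgue_on (cell b)) (periodization b ?g) * ell1_norm m p \<alpha> c"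
    if "c \<in> ell1_space m p \<alpha>" for c
    using synthesis_rescaled_norm_le[OF that] \<open>Lp_enorm p (lebesgue_on (cell b)) _ = _\<close> by simp
  ultimately show ?thesis
    unfolding \<open>a = _\<close>
    using bounded_operator_synthesis scale_sobolev(1) scale_sobolev_norm_sum synthesis_sums(1)
    by (auto intro: AE_completion[OF scale_AE(1)])
qed

end
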